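(* Let $m\in\mathbb R$, $0<\rho\le1$, $0\le\delta<1$, let $p\in BS^m_{\rho,\delta}(\mathbb R^n)$, and let $k(x,y,z)$ denote the distributional kernel of the associated bilinear pseudodifferential operator $T_p$. Let $\mathbf Z^+$ denote the set of non-negative integers and, for $x,y,z\in\mathbb R^n$, set $S(x,y,z)=|x-y|+|x-z|+|y-z|$. (i) Given multi-indices $\alpha,\beta,\gamma\in(\mathbf Z^+)^n$, there exists $N_0\in\mathbf Z^+$ such that for each $N\ge N_0$, $$\sup_{(x,y,z):\,S(x,y,z)>0}S(x,y,z)^N\,|\partial_x^\alpha\partial_y^\beta\partial_z^\gamma k(x,y,z)|<\infty.$$ (ii) Suppose that $p$ has compact support in $(\xi,\eta)$ uniformly in $x$. Then $k$ is smooth, and given $\alpha,\beta,\gamma\in(\mathbf Z^+)^n$ and $N\in\mathbf Z^+$, there exists $C>0$ such that for all $x,y,z\in\mathbb R^n$ with $S(x,y,z)>0$, $$|\partial_x^\alpha\partial_y^\beta\partial_z^\gamma k(x,y,z)|\le C(1+S(x,y,z))^{-N}.$$ (iii) Suppose that $m+M+2n<0$ for some $M\in\mathbf Z^+$. Then $k$ is a bounded continuous function with bounded continuous derivatives of order $\le M$. (iv) Suppose that $m+M+2n=0$ for some $M\in\mathbf Z^+$. Then there exists a constant $C>0$ such that for all $x,y,z\in\mathbb R^n$ with $S(x,y,z)>0$, $$\sup_{|\alpha+\beta+\gamma|=M}|\partial_x^\alpha\partial_y^\beta\partial_z^\gamma k(x,y,z)|\le C\,\big|\log|S(x,y,z)|\big|.$$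 (v) Suppose that $m+M+2n>0$ for some $M\in\mathbf Z^+$. Then there exists a positive constant $C$ such that for all $x,y,z\in\mathbb R^n$ with $S(x,y,z)>0$, $$\sup_{|\alpha+\beta+\gamma|=M}|\partial_x^\alpha\partial_y^\beta\partial_z^\gamma k(x,y,z)|\le C\,S(x,y,z)^{-(m+M+2n)/\rho}.$$
   Context: For $m\in\mathbb R$ and $\rho,\delta\in[0,1]$, the bilinear Hörmander class $BS^m_{\rho,\delta}=BS^m_{\rho,\delta}(\mathbb R^n)$ is the set of all $C^\infty$ functions $p$ on $\mathbb R^n\times\mathbb R^n\times\mathbb R^n$ such that for all multi-indices $\alpha,\beta,\gamma$ there is a constant $C_{\alpha\beta\gamma}>0$ with $$|\partial_x^\alpha\partial_\xi^\beta\partial_\eta^\gamma p(x,\xi,\eta)|\le C_{\alpha\beta\gamma}(1+|\xi|+|\eta|)^{m+\delta|\alpha|-\rho(|\beta|+|\gamma|)}\quad\text{for all }x,\xi,\eta\in\mathbb R^n.$$ The associated bilinear pseudodifferential operator is, a priori for test functions $f,g$ (e.g. Schwartz functions), $$T_p(f,g)(x)=\int_{\mathbb R^n}\int_{\mathbb R^n}p(x,\xi,\eta)\widehat f(\xi)\widehat g(\eta)e^{ix\cdot(\xi+\eta)}\,d\xi\,d\eta,$$ where $\widehat{\ }$ denotes the Fourier transform. Its distributional kernel $k$ is the distribution on $\mathbb R^{3n}$ for which $T_p(f,g)(x)=\int\int k(x,y,z)f(y)g(z)\,dy\,dz$ in the sense of distributions.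
   Formalization: In (iv) the bound C|log|S|| is replaced by C(1+|log|S||), because the printed bound vanishes at S=1 and fails there, e.g. for the symbol (1+|ξ|²+|η|²)^(-n) with M=0, m=-2n, whose kernel is strictly positive; away from S=1 the two bounds are equivalent. *)

theory Defs
  imports "HOL-Analysis.Analysis"
begin

text \<open>
  Points \<open>(x, y, z)\<close> of \<open>\<real>\<^sup>3\<^sup>n\<close> are triples of vectors. A multi-index is a function
  \<open>'n \<Rightarrow> nat\<close>.
\<close>

type_synonym 'n triple = "(real ^ 'n) \<times> (real ^ 'n) \<times> (real ^ 'n)"

text \<open>Meant for open \<open>S\<close>, where it is the usual class \<open>C\<^sup>k(S)\<close>.\<close>

primrec Ck_on :: "nat \<Rightarrow> 'a::real_normed_vector set \<Rightarrow> ('a \<Rightarrow> 'b::real_normed_vector) \<Rightarrow> bool" where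
  "Ck_on 0 S f \<longleftrightarrow> continuous_on S f"
| "Ck_on (Suc k) S f \<longleftrightarrow>
     (\<forall>x\<in>S. f differentiable (at x)) \<and> (\<forall>v. Ck_on k S (\<lambda>x. frechet_derivative f (at x) v))"

definition Cinf_on :: "'a::real_normed_vector set \<Rightarrow> ('a \<Rightarrow> 'b::real_normed_vector) \<Rightarrow> bool" where
  "Cinf_on S f \<longleftrightarrow> (\<forall>k. Ck_on k S f)"

primrec dir_derivs :: "'a::real_normed_vector list \<Rightarrow> ('a \<Rightarrow> 'b::real_normed_vector) \<Rightarrow> 'a \<Rightarrow> 'b" where
  "dir_derivs [] f = f"
| "dir_derivs (v # vs) f = (\<lambda>x. frechet_derivative (dir_derivs vs f) (at x) v)"

definition mi_order :: "('n::finite \<Rightarrow> nat) \<Rightarrow> nat" where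
  "mi_order \<alpha> = (\<Sum>i\<in>UNIV. \<alpha> i)"

text \<open>
  The index type carries no order, so an enumeration of the coordinates is chosen. The choice only
  affects the order of differentiation, which is irrelevant for the \<open>C\<^sup>k\<close> functions to which
  these derivatives are applied.
\<close>

definition coords :: "'n::finite list" where
  "coords = (SOME is. distinct is \<and> set is = UNIV)"

definition mi_dirs :: "('n::finite \<Rightarrow> nat) \<Rightarrow> (real ^ 'n) list" where
  "mi_dirs \<alpha> = concat (map (\<lambda>i. replicate (\<alpha> i) (axis i 1)) coords)"

text \<open>\<open>pd3 \<alpha> \<beta> \<gamma> F\<close> is \<open>\<partial>\<^sub>u\<^sup>\<alpha> \<partial>\<^sub>v\<^sup>\<beta> \<partial>\<^sub>w\<^sup>\<gamma> F(u, v, w)\<close>.\<close>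

definition pd3 :: "('n::finite \<Rightarrow> nat) \<Rightarrow> ('n \<Rightarrow> nat) \<Rightarrow> ('n \<Rightarrow> nat) \<Rightarrow>
    ('n triple \<Rightarrow> complex) \<Rightarrow> 'n triple \<Rightarrow> complex" where
  "pd3 \<alpha> \<beta> \<gamma> =
     dir_derivs (map (\<lambda>u. (u, 0, 0)) (mi_dirs \<alpha>) @ map (\<lambda>v. (0, v, 0)) (mi_dirs \<beta>)
                 @ map (\<lambda>w. (0, 0, w)) (mi_dirs \<gamma>))"

definition BS :: "real \<Rightarrow> real \<Rightarrow> real \<Rightarrow> ('n::finite triple \<Rightarrow> complex) set" where
  "BS m \<rho> \<delta> = {p. Cinf_on UNIV p \<and>
     (\<forall>\<alpha> \<beta> \<gamma>. \<exists>C>0. \<forall>x \<xi> \<eta>. norm (pd3 \<alpha> \<beta> \<gamma> p (x, \<xi>, \<eta>)) \<le>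
        C * (1 + norm \<xi> + norm \<eta>) powr
          (m + \<delta> * real (mi_order \<alpha>) - \<rho> * (real (mi_order \<beta>) + real (mi_order \<gamma>))))}"

text \<open>The normalization of the Fourier transform affects the kernel only by a constant factor.\<close>

definition fourier :: "(real ^ 'n::finite \<Rightarrow> complex) \<Rightarrow> real ^ 'n \<Rightarrow> complex" where
  "fourier f \<xi> = (LINT y|lborel. f y * exp (- \<i> * complex_of_real (y \<bullet> \<xi>)))"

definition bilin_op :: "('n::finite triple \<Rightarrow> complex) \<Rightarrow>
    (real ^ 'n \<Rightarrow> complex) \<Rightarrow> (real ^ 'n \<Rightarrow> complex) \<Rightarrow> real ^ 'n \<Rightarrow> complex" where
  "bilin_op p f g x =
     (LINT \<xi>|lborel. LINT \<eta>|lborel.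
        p (x, \<xi>, \<eta>) * fourier f \<xi> * fourier g \<eta> * exp (\<i> * complex_of_real (x \<bullet> (\<xi> + \<eta>))))"

definition tsupp :: "('a::topological_space \<Rightarrow> complex) \<Rightarrow> 'a set" where
  "tsupp f = closure {x. f x \<noteq> 0}"

definition test_fun :: "('a::euclidean_space \<Rightarrow> complex) \<Rightarrow> bool" where
  "test_fun f \<longleftrightarrow> Cinf_on UNIV f \<and> compact (tsupp f)"

text \<open>
  Distributions on the whole space: only the values on test functions are relevant. Continuity is
  expressed by the usual seminorm estimates on each compact set; the lists \<open>vs\<close> run through
  all partial derivatives of order at most \<open>N\<close>.
\<close>

definition distribution :: "(('a::euclidean_space \<Rightarrow> complex) \<Rightarrow> complex) \<Rightarrow> bool" where
  "distribution T \<longleftrightarrow>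
     (\<forall>\<phi> \<psi>. test_fun \<phi> \<longrightarrow> test_fun \<psi> \<longrightarrow> T (\<lambda>u. \<phi> u + \<psi> u) = T \<phi> + T \<psi>) \<and>
     (\<forall>c \<phi>. test_fun \<phi> \<longrightarrow> T (\<lambda>u. c * \<phi> u) = c * T \<phi>) \<and>
     (\<forall>A. compact A \<longrightarrow> (\<exists>C N. \<forall>\<phi>. test_fun \<phi> \<longrightarrow> tsupp \<phi> \<subseteq> A \<longrightarrow>
        norm (T \<phi>) \<le>
          C * (\<Sum>vs | set vs \<subseteq> Basis \<and> length vs \<le> N. SUP u. norm (dir_derivs vs \<phi> u))))"

text \<open>The restriction of \<open>T\<close> to the open set \<open>S\<close> is the continuous function \<open>F\<close>.\<close>

definition dist_eq_fun_on ::
    "'a::euclidean_space set \<Rightarrow> (('a \<Rightarrow> complex) \<Rightarrow> complex) \<Rightarrow> ('a \<Rightarrow> complex) \<Rightarrow> bool" where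
  "dist_eq_fun_on S T F \<longleftrightarrow> continuous_on S F \<and>
     (\<forall>\<phi>. test_fun \<phi> \<longrightarrow> tsupp \<phi> \<subseteq> S \<longrightarrow> T \<phi> = (LINT u|lborel. F u * \<phi> u))"

text \<open>
  The identity \<open>T\<^sub>p(f,g)(x) = \<integral>\<integral> k(x,y,z) f(y) g(z) dy dz\<close>, tested against \<open>h(x)\<close>.
\<close>

definition dist_kernel :: "('n::finite triple \<Rightarrow> complex) \<Rightarrow>
    (('n triple \<Rightarrow> complex) \<Rightarrow> complex) \<Rightarrow> bool" where
  "dist_kernel p k \<longleftrightarrow> distribution k \<and>
     (\<forall>f g h. test_fun f \<longrightarrow> test_fun g \<longrightarrow> test_fun h \<longrightarrow>
        k (\<lambda>(x, y, z). h x * f y * g z) = (LINT x|lborel. bilin_op p f g x * h x))"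

definition S3 :: "real ^ 'n::finite \<Rightarrow> real ^ 'n \<Rightarrow> real ^ 'n \<Rightarrow> real" where
  "S3 x y z = norm (x - y) + norm (x - z) + norm (y - z)"

definition off_diag :: "('n::finite triple) set" where
  "off_diag = {(x, y, z). S3 x y z > 0}"

definition mi_triples :: "nat \<Rightarrow> (('n::finite \<Rightarrow> nat) \<times> ('n \<Rightarrow> nat) \<times> ('n \<Rightarrow> nat)) set" where
  "mi_triples M = {(\<alpha>, \<beta>, \<gamma>). mi_order (\<lambda>i. \<alpha> i + \<beta> i + \<gamma> i) = M}"

end

theory Submission
  imports Defs
begin

text \<open>
  With \<open>\<zeta> = (\<xi>, \<eta>)\<close> and \<open>u = (x - y, x - z)\<close> the kernel is the oscillatory integral of
  \<open>p(x, \<zeta>) exp(i u \<bullet> \<zeta>)\<close> over \<open>\<zeta>\<close>, understood as the limit of the absolutely convergent integrals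
  with the regularized symbols \<open>p(x, \<zeta>) exp(-\<epsilon>|\<zeta>|\<^sup>2)\<close>, which satisfy the symbol estimates uniformly in
  \<open>\<epsilon>\<close>. Integration by parts in \<open>\<zeta>\<close> gains \<open>\<rho>\<close> orders of decay and costs one factor \<open>|u|\<^sup>-\<^sup>1\<close>;
  hence the regularized kernels converge locally uniformly where \<open>u \<noteq> 0\<close>, with rapid decay in \<open>|u|\<close>.
  A derivative of the kernel in \<open>(x, y, z)\<close> is again the kernel of a symbol, of order one higher, so
  only the kernel itself has to be estimated: frequencies \<open>|\<zeta>| < R = |u| powr (-1/\<rho>)\<close>
  contribute at most the integral of \<open>(1 + |\<zeta>|) powr \<mu>\<close> over the ball of radius \<open>R\<close>, the others are
  handled by integration by parts. Finally, a distribution is determined by its values on tensor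
  products, because translates of tensor mollifiers span a dense subspace.
\<close>

section \<open>Calculus of smooth functions\<close>

text \<open>Two demands have to be kept apart. Manipulating the integrals asks for absolute
  convergence, which in general holds only for fixed \<open>\<epsilon>\<close>, with constants that
  blow up as \<open>\<epsilon>\<close> tends to 0; the estimates must be uniform in
  \<open>\<epsilon>\<close> and \<open>x\<close>. The decay lemmas therefore take two hypotheses: a
  uniform order, which yields the constant, and for each single member some integrable order, which
  merely licenses integration by parts.

  Gaussians serve both as regularization and as frequency cutoff, because all their symbol estimates
  follow from one inequality: each factor \<open>\<epsilon>\<close> in front of
  \<open>exp (- \<epsilon> * (norm \<zeta>)\<^sup>2)\<close> is worth two powers of decay. The
  radius \<open>R\<close> is the point of balance: at \<open>norm \<zeta> = R\<close> the gain
  \<open>R powr (- \<rho>)\<close> of one integration by parts just offsets its cost.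

  No explicit bump function is built. Mollifiers are called for only when a nonzero test function is
  at hand, and a slice of that function is rescaled.\<close>

lemma frechet_derivative_eqI: "(f has_derivative f') (at x) \<Longrightarrow> frechet_derivative f (at x) = f'"
  by (metis frechet_derivative_at)

lemma differentiableD: "f differentiable (at x) \<Longrightarrow> (f has_derivative frechet_derivative f (at x)) (at x)"
  by (simp add: frechet_derivative_works)

text \<open>No differentiability is assumed: \<open>f\<close> and \<open>g\<close> have the same
  derivatives at \<open>x\<close>, so the choice in the definition of
  \<open>frechet_derivative\<close> picks the same value for both.\<close>

lemma frechet_derivative_cong_open:
  assumes "open S" "x \<in> S" "\<And>y. y \<in> S \<Longrightarrow> f y = g y"
  shows "frechet_derivative f (at x) = frechet_derivative g (at x)"
proof -
  have "(f has_derivative h) (at x) \<longleftrightarrow> (g has_derivative h) (at x)" for h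
    using assms has_derivative_transform_within_open[of f h x UNIV S g]
      has_derivative_transform_within_open[of g h x UNIV S f] by auto
  then show ?thesis unfolding frechet_derivative_def by simp
qed

lemma differentiable_cong_open:
  assumes "open S" "x \<in> S" "\<And>y. y \<in> S \<Longrightarrow> f y = g y"
  shows "f differentiable (at x) \<longleftrightarrow> g differentiable (at x)"
  unfolding differentiable_def
  using assms has_derivative_transform_within_open[of f _ x UNIV S g]
      has_derivative_transform_within_open[of g _ x UNIV S f] by auto

lemma Ck_on_cong_open:
  assumes "open S" "\<And>y. y \<in> S \<Longrightarrow> f y = g y"
  shows "Ck_on k S f \<longleftrightarrow> Ck_on k S g"
  using assms(2)
proof (induction k arbitrary: f g)
  case 0
  then show ?case by (simp cong: continuous_on_cong)
next
  case (Suc k)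
  have 1: "f differentiable (at x) \<longleftrightarrow> g differentiable (at x)" if "x \<in> S" for x
    using differentiable_cong_open[OF assms(1) that] Suc.prems by blast
  have "Ck_on k S (\<lambda>x. frechet_derivative f (at x) v) \<longleftrightarrow>
     Ck_on k S (\<lambda>x. frechet_derivative g (at x) v)" for v
  proof (rule Suc.IH)
    fix y assume "y \<in> S"
    then show "frechet_derivative f (at y) v = frechet_derivative g (at y) v"
      using frechet_derivative_cong_open[OF assms(1), of y f g] Suc.prems by metis
  qed
  with 1 show ?case by auto
qed

lemma Ck_on_Suc_imp: "Ck_on (Suc k) S f \<Longrightarrow> Ck_on k S f"
proof (induction k arbitrary: f)
  case 0
  then show ?case
    by (auto simp: continuous_on_eq_continuous_within intro: differentiable_imp_continuous_within
        differentiable_at_withinI)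
next
  case (Suc k)
  from Suc.prems have "\<forall>x\<in>S. f differentiable (at x)"
    and "\<And>v. Ck_on (Suc k) S (\<lambda>x. frechet_derivative f (at x) v)" by simp_all
  then show ?case using Suc.IH by auto
qed

lemma Ck_on_mono: "Ck_on k S f \<Longrightarrow> j \<le> k \<Longrightarrow> Ck_on j S f"
  by (induction k rule: nat_induct) (auto simp: le_Suc_eq simp del: Ck_on.simps dest: Ck_on_Suc_imp)

lemma Ck_on_imp_continuous: "Ck_on k S f \<Longrightarrow> continuous_on S f"
  using Ck_on_mono[of k S f 0] by simp

text \<open>The form in which the closure properties are proved: an explicit formula
  \<open>f'\<close> replaces the chosen derivative, and its regularity is supplied by
  induction.\<close>

lemma Ck_on_SucI:
  assumes "open S" "\<And>x. x \<in> S \<Longrightarrow> (f has_derivative (\<lambda>v. f' v x)) (at x)"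
    and "\<And>v. Ck_on k S (f' v)"
  shows "Ck_on (Suc k) S f"
proof -
  have "Ck_on k S (\<lambda>x. frechet_derivative f (at x) v)" for v
    using Ck_on_cong_open[OF assms(1), of "f' v" "\<lambda>x. frechet_derivative f (at x) v" k]
      assms(3) frechet_derivative_eqI[OF assms(2)] by fastforce
  then show ?thesis using assms(2) by (auto simp: differentiable_def)
qed

lemma Cinf_on_differentiable: "Cinf_on S f \<Longrightarrow> x \<in> S \<Longrightarrow> f differentiable (at x)"
  unfolding Cinf_on_def by (metis Ck_on.simps(2))

lemma Cinf_on_deriv: "Cinf_on S f \<Longrightarrow> Cinf_on S (\<lambda>x. frechet_derivative f (at x) v)"
  unfolding Cinf_on_def by (metis Ck_on.simps(2))

lemma Cinf_on_has_derivative: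
  "Cinf_on S f \<Longrightarrow> x \<in> S \<Longrightarrow> (f has_derivative frechet_derivative f (at x)) (at x)"
  by (simp add: Cinf_on_differentiable differentiableD)

lemma Cinf_on_continuous: "Cinf_on S f \<Longrightarrow> continuous_on S f"
  unfolding Cinf_on_def by (metis Ck_on_imp_continuous)

lemma Ck_on_const: "Ck_on k S (\<lambda>x. c)"
  by (induction k arbitrary: c) (auto intro: continuous_on_const)

lemma Ck_on_bounded_linear_comp:
  assumes "bounded_linear L" "Ck_on k S f" "open S"
  shows "Ck_on k S (\<lambda>x. L (f x))"
  using assms(2)
proof (induction k arbitrary: f)
  case 0
  then show ?case by (simp add: bounded_linear.continuous_on[OF assms(1)])
next
  case (Suc k)
  show ?case
    by (rule Ck_on_SucI[OF assms(3), of _ "\<lambda>v x. L (frechet_derivative f (at x) v)"])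
      (use Suc in \<open>auto intro!: bounded_linear.has_derivative[OF assms(1)] differentiableD\<close>)
qed

lemma Ck_on_add:
  assumes "Ck_on k S f" "Ck_on k S g" "open S"
  shows "Ck_on k S (\<lambda>x. f x + g x)"
  using assms(1,2)
proof (induction k arbitrary: f g)
  case 0
  then show ?case by (auto intro: continuous_intros)
next
  case (Suc k)
  show ?case
    by (rule Ck_on_SucI[OF assms(3), of _ "\<lambda>v x. frechet_derivative f (at x) v + frechet_derivative g (at x) v"])
      (use Suc in \<open>auto intro!: has_derivative_add differentiableD\<close>)
qed

lemma Ck_on_mult:
  fixes f g :: "'a::real_normed_vector \<Rightarrow> 'b::real_normed_algebra"
  assumes "Ck_on k S f" "Ck_on k S g" "open S"
  shows "Ck_on k S (\<lambda>x. f x * g x)"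
  using assms(1,2)
proof (induction k arbitrary: f g)
  case 0
  then show ?case by (auto intro: continuous_intros)
next
  case (Suc k)
  have "Ck_on k S f" "Ck_on k S g" using Suc.prems Ck_on_Suc_imp by blast+
  with Suc show ?case
    by (intro Ck_on_SucI[OF assms(3), of _ "\<lambda>v x. f x * frechet_derivative g (at x) v + frechet_derivative f (at x) v * g x"])
      (auto intro!: has_derivative_mult differentiableD Ck_on_add assms(3))
qed

lemma Ck_on_affine:
  assumes "bounded_linear L" "Ck_on k UNIV f"
  shows "Ck_on k UNIV (\<lambda>x. f (L x + c))"
  using assms(2)
proof (induction k arbitrary: f)
  case 0
  then show ?case using assms(1)
    by (auto intro!: continuous_intros continuous_on_compose2[of UNIV f]
        simp: linear_continuous_on)
next
  case (Suc k)
  have "((\<lambda>x. f (L x + c)) has_derivative (\<lambda>v. frechet_derivative f (at (L x + c)) (L v))) (at x)" for x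
  proof -
    have "((\<lambda>x. L x + c) has_derivative L) (at x)"
      using assms(1) by (auto intro!: derivative_eq_intros bounded_linear_imp_has_derivative)
    moreover have "(f has_derivative frechet_derivative f (at (L x + c))) (at (L x + c))"
      using Suc.prems by (auto intro: differentiableD)
    ultimately show ?thesis using diff_chain_at unfolding o_def by fast
  qed
  with Suc show ?case
    by (intro Ck_on_SucI[of _ _ "\<lambda>v x. frechet_derivative f (at (L x + c)) (L v)"]) auto
qed

lemma Ck_on_bounded_linear: "bounded_linear L \<Longrightarrow> Ck_on k UNIV L"
proof (induction k)
  case 0 then show ?case by (simp add: linear_continuous_on)
next
  case (Suc k) then show ?case
    by (intro Ck_on_SucI[of _ _ "\<lambda>v x. L v"])
      (auto intro: bounded_linear_imp_has_derivative Ck_on_const)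
qed

lemma Cinf_on_add: "Cinf_on S f \<Longrightarrow> Cinf_on S g \<Longrightarrow> open S \<Longrightarrow> Cinf_on S (\<lambda>x. f x + g x)"
  by (simp add: Cinf_on_def Ck_on_add)

lemma Cinf_on_mult:
  fixes f g :: "'a::real_normed_vector \<Rightarrow> 'b::real_normed_algebra"
  shows "Cinf_on S f \<Longrightarrow> Cinf_on S g \<Longrightarrow> open S \<Longrightarrow> Cinf_on S (\<lambda>x. f x * g x)"
  by (simp add: Cinf_on_def Ck_on_mult)

lemma Cinf_on_const: "Cinf_on S (\<lambda>x. c)"
  by (simp add: Cinf_on_def Ck_on_const)

lemma Cinf_on_bounded_linear: "bounded_linear L \<Longrightarrow> Cinf_on UNIV L"
  by (simp add: Cinf_on_def Ck_on_bounded_linear)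

lemma Cinf_on_bounded_linear_comp:
  "bounded_linear L \<Longrightarrow> Cinf_on S f \<Longrightarrow> open S \<Longrightarrow> Cinf_on S (\<lambda>x. L (f x))"
  by (simp add: Cinf_on_def Ck_on_bounded_linear_comp)

lemma Cinf_on_affine: "bounded_linear L \<Longrightarrow> Cinf_on UNIV f \<Longrightarrow> Cinf_on UNIV (\<lambda>x. f (L x + c))"
  by (simp add: Cinf_on_def Ck_on_affine)

lemma Cinf_on_sum:
  "(\<And>i. i \<in> A \<Longrightarrow> Cinf_on S (f i)) \<Longrightarrow> open S \<Longrightarrow> Cinf_on S (\<lambda>x. \<Sum>i\<in>A. f i x)"
  by (induction A rule: infinite_finite_induct) (auto intro: Cinf_on_const Cinf_on_add)

section \<open>Iterated directional derivatives and their symmetry\<close>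

lemma Cinf_dir_derivs: "Cinf_on S f \<Longrightarrow> Cinf_on S (dir_derivs vs f)"
  by (induction vs) (auto intro: Cinf_on_deriv)

lemma dir_derivs_append: "dir_derivs (us @ vs) f = dir_derivs us (dir_derivs vs f)"
  by (induction us) auto

lemma dir_derivs_add:
  assumes "Cinf_on UNIV f" "Cinf_on UNIV g"
  shows "dir_derivs vs (\<lambda>x. f x + g x) = (\<lambda>x. dir_derivs vs f x + dir_derivs vs g x)"
proof (induction vs)
  case (Cons v vs)
  show ?case
    by (rule ext, simp add: Cons)
      (intro fun_cong[OF frechet_derivative_eqI] has_derivative_add differentiableD
        Cinf_on_differentiable[of UNIV] Cinf_dir_derivs assms UNIV_I)
qed simp

lemma dir_derivs_bounded_linear:
  assumes "Cinf_on UNIV f" "bounded_linear L"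
  shows "dir_derivs vs (\<lambda>x. L (f x)) = (\<lambda>x. L (dir_derivs vs f x))"
proof (induction vs)
  case (Cons v vs)
  show ?case
    by (rule ext, simp add: Cons)
      (intro fun_cong[OF frechet_derivative_eqI] bounded_linear.has_derivative[OF assms(2)] differentiableD
        Cinf_on_differentiable[of UNIV] Cinf_dir_derivs assms UNIV_I)
qed simp

lemma dir_derivs_cmult:
  fixes f :: "'a::real_normed_vector \<Rightarrow> complex"
  assumes "Cinf_on UNIV f"
  shows "dir_derivs vs (\<lambda>x. c * f x) = (\<lambda>x. c * dir_derivs vs f x)"
  using dir_derivs_bounded_linear[OF assms bounded_linear_mult_right] .

lemma dir_derivs_zero: "dir_derivs vs (\<lambda>x. 0) = (\<lambda>x. 0)"
  by (induction vs) auto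

lemma dir_derivs_sum:
  assumes "\<And>i. i \<in> A \<Longrightarrow> Cinf_on UNIV (f i)"
  shows "dir_derivs vs (\<lambda>x. \<Sum>i\<in>A. f i x) = (\<lambda>x. \<Sum>i\<in>A. dir_derivs vs (f i) x)"
  using assms
proof (induction A rule: infinite_finite_induct)
  case (insert a A)
  then show ?case by (simp add: dir_derivs_add Cinf_on_sum)
qed (auto simp: dir_derivs_zero)

lemma dir_derivs_translate:
  fixes f :: "'a::real_normed_vector \<Rightarrow> 'b::real_normed_vector"
  assumes "Cinf_on UNIV f"
  shows "dir_derivs vs (\<lambda>x. f (x + c)) = (\<lambda>x. dir_derivs vs f (x + c))"
proof (induction vs)
  case (Cons v vs)
  have "((\<lambda>x. dir_derivs vs f (x + c)) has_derivative frechet_derivative (dir_derivs vs f) (at (x+c))) (at x)" for x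
  proof -
    have "((\<lambda>x. x + c) has_derivative (\<lambda>h. h)) (at x)" by (auto intro!: derivative_eq_intros)
    from diff_chain_at[OF this Cinf_on_has_derivative[OF Cinf_dir_derivs[OF assms] UNIV_I]]
    show ?thesis by (simp add: o_def)
  qed
  from frechet_derivative_eqI[OF this] show ?case by (auto simp: Cons)
qed simp

lemma dir_derivs_cong_open:
  assumes "open S" "\<And>x. x \<in> S \<Longrightarrow> f x = g x" "x \<in> S"
  shows "dir_derivs vs f x = dir_derivs vs g x"
  using assms(3)
proof (induction vs arbitrary: x)
  case (Cons v vs)
  then show ?case
    using frechet_derivative_cong_open[OF assms(1) Cons.prems, of "dir_derivs vs f" "dir_derivs vs g"] by simp
qed (use assms in auto)

text \<open>Symmetry of second derivatives follows because the second difference over a small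
  parallelogram can be evaluated in either order.\<close>

lemma second_difference_mean_value:
  fixes g :: "'a::real_normed_vector \<Rightarrow> real"
  assumes "\<And>x. (g has_derivative g' x) (at x)"
    and "\<And>x. ((\<lambda>y. g' y u) has_derivative g'' x) (at x)" "s > 0"
  shows "\<exists>a b. 0 \<le> a \<and> a \<le> s \<and> 0 \<le> b \<and> b \<le> s \<and>
    g (x + s *\<^sub>R u + s *\<^sub>R v) - g (x + s *\<^sub>R u) - g (x + s *\<^sub>R v) + g x
      = s\<^sup>2 * g'' (x + a *\<^sub>R u + b *\<^sub>R v) v"
proof -
  let ?h = "\<lambda>a. g (x + a *\<^sub>R u + s *\<^sub>R v) - g (x + a *\<^sub>R u)"
  have "(?h has_real_derivative g' (x + a *\<^sub>R u + s *\<^sub>R v) u - g' (x + a *\<^sub>R u) u) (at a)" for a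
  proof -
    have l: "linear (g' y)" for y using assms(1) has_derivative_linear by blast
    have 1: "((\<lambda>a. g (c + a *\<^sub>R u)) has_derivative (\<lambda>t. g' (c + a *\<^sub>R u) (t *\<^sub>R u))) (at a)" for c
    proof -
      have "((\<lambda>a. c + a *\<^sub>R u) has_derivative (\<lambda>t. t *\<^sub>R u)) (at a)" by (auto intro!: derivative_eq_intros)
      from diff_chain_at[OF this assms(1)] show ?thesis by (simp add: o_def)
    qed
    have "(?h has_derivative (\<lambda>t. g' ((x + s *\<^sub>R v) + a *\<^sub>R u) (t *\<^sub>R u) - g' (x + a *\<^sub>R u) (t *\<^sub>R u))) (at a)"
      using has_derivative_diff[OF 1[of "x + s *\<^sub>R v"] 1[of x]] by (simp add: algebra_simps)
    then show ?thesis unfolding has_field_derivative_def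
      by (rule has_derivative_eq_rhs)
        (simp add: linear_scale[OF l] right_diff_distrib mult.commute fun_eq_iff add_ac)
  qed
  from MVT2[OF \<open>s > 0\<close> this] obtain a where a: "0 < a" "a < s"
    "?h s - ?h 0 = (s - 0) * (g' (x + a *\<^sub>R u + s *\<^sub>R v) u - g' (x + a *\<^sub>R u) u)" by blast
  let ?k = "\<lambda>b. g' (x + a *\<^sub>R u + b *\<^sub>R v) u"
  have "(?k has_real_derivative g'' (x + a *\<^sub>R u + b *\<^sub>R v) v) (at b)" for b
  proof -
    have l: "linear (g'' y)" for y using assms(2) has_derivative_linear by blast
    have "((\<lambda>b. x + a *\<^sub>R u + b *\<^sub>R v) has_derivative (\<lambda>t. t *\<^sub>R v)) (at b)" by (auto intro!: derivative_eq_intros)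
    from diff_chain_at[OF this assms(2)] show ?thesis unfolding has_field_derivative_def o_def
      by (rule has_derivative_eq_rhs) (simp add: linear_scale[OF l] fun_eq_iff mult.commute)
  qed
  from MVT2[OF \<open>s > 0\<close> this] obtain b where b: "0 < b" "b < s"
    "?k s - ?k 0 = (s - 0) * g'' (x + a *\<^sub>R u + b *\<^sub>R v) v" by blast
  show ?thesis
    using a b by (intro exI[of _ a] exI[of _ b]) (auto simp: power2_eq_square)
qed

lemma symmetric_second_derivative_real:
  fixes g :: "'a::real_normed_vector \<Rightarrow> real"
  assumes g: "\<And>x. (g has_derivative g' x) (at x)"
    and u: "\<And>x. ((\<lambda>y. g' y u) has_derivative gu x) (at x)"
    and v: "\<And>x. ((\<lambda>y. g' y v) has_derivative gv x) (at x)"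
    and cont: "isCont (\<lambda>x. gu x v) x" "isCont (\<lambda>x. gv x u) x"
  shows "gu x v = gv x u"
proof (rule ccontr)
  assume ne: "gu x v \<noteq> gv x u"
  \<comment> \<open>Half the gap: two values within \<open>e\<close> of \<open>gu x v\<close> and of
    \<open>gv x u\<close> cannot coincide.\<close>
  define e where "e = \<bar>gu x v - gv x u\<bar> / 2"
  have "e > 0" using ne by (simp add: e_def)
  obtain d1 where d1: "d1 > 0" "\<And>y. dist y x < d1 \<Longrightarrow> dist (gu y v) (gu x v) < e"
    using cont(1) \<open>e > 0\<close> unfolding continuous_at_eps_delta by blast
  obtain d2 where d2: "d2 > 0" "\<And>y. dist y x < d2 \<Longrightarrow> dist (gv y u) (gv x u) < e"
    using cont(2) \<open>e > 0\<close> unfolding continuous_at_eps_delta by blast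
  \<comment> \<open>With this side all intermediate points of the parallelogram lie within
    \<open>min d1 d2\<close> of \<open>x\<close>; the summand 1 keeps the denominator positive when
    \<open>u\<close> and \<open>v\<close> vanish.\<close>
  define s where "s = min d1 d2 / (2 * (norm u + norm v + 1))"
  have s: "s > 0" using d1 d2 by (auto simp: s_def intro!: divide_pos_pos add_nonneg_pos)
  have near: "dist (x + a *\<^sub>R p + b *\<^sub>R q) x < min d1 d2"
    if "0 \<le> a" "a \<le> s" "0 \<le> b" "b \<le> s" "norm p + norm q = norm u + norm v" for a b p q
  proof -
    have "norm (a *\<^sub>R p + b *\<^sub>R q) \<le> a * norm p + b * norm q"
      using norm_triangle_ineq[of "a *\<^sub>R p" "b *\<^sub>R q"] that by simp
    also have "\<dots> \<le> s * norm p + s * norm q" using that by (intro add_mono mult_right_mono) auto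
    also have "\<dots> = s * (norm u + norm v)" using that by (simp add: distrib_left[symmetric])
    also have "\<dots> < s * (2 * (norm u + norm v + 1))" using s
      by (intro mult_strict_left_mono) (auto simp: add_nonneg_pos intro: less_le_trans[of _ "norm u + norm v + 1"])
    also have "\<dots> = min d1 d2"
    proof -
      have "2 * (norm u + norm v + 1) \<noteq> 0"
        using norm_ge_zero[of u] norm_ge_zero[of v] by (smt (verit))
      then show ?thesis by (simp add: s_def)
    qed
    finally show ?thesis by (simp add: dist_norm add.assoc)
  qed
  obtain a b where ab: "0 \<le> a" "a \<le> s" "0 \<le> b" "b \<le> s" and 1:
    "g (x + s *\<^sub>R u + s *\<^sub>R v) - g (x + s *\<^sub>R u) - g (x + s *\<^sub>R v) + g x
      = s\<^sup>2 * gu (x + a *\<^sub>R u + b *\<^sub>R v) v"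
    using second_difference_mean_value[OF g u s, of x v] by blast
  obtain a' b' where ab': "0 \<le> a'" "a' \<le> s" "0 \<le> b'" "b' \<le> s" and 2:
    "g (x + s *\<^sub>R v + s *\<^sub>R u) - g (x + s *\<^sub>R v) - g (x + s *\<^sub>R u) + g x
      = s\<^sup>2 * gv (x + a' *\<^sub>R v + b' *\<^sub>R u) u"
    using second_difference_mean_value[OF g v s, of x u] by blast
  have "x + s *\<^sub>R v + s *\<^sub>R u = x + s *\<^sub>R u + s *\<^sub>R v" by simp
  with 1 2 have "s\<^sup>2 * gu (x + a *\<^sub>R u + b *\<^sub>R v) v = s\<^sup>2 * gv (x + a' *\<^sub>R v + b' *\<^sub>R u) u"
    by (smt (verit))
  then have "gu (x + a *\<^sub>R u + b *\<^sub>R v) v = gv (x + a' *\<^sub>R v + b' *\<^sub>R u) u" using s by simp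
  moreover have "dist (gu (x + a *\<^sub>R u + b *\<^sub>R v) v) (gu x v) < e"
    using d1(2) near[OF ab] by auto
  moreover have "dist (gv (x + a' *\<^sub>R v + b' *\<^sub>R u) u) (gv x u) < e"
    using d2(2) near[OF ab', of v u] by auto
  ultimately show False by (auto simp: e_def dist_real_def abs_if split: if_splits)
qed

text \<open>The mean value theorem is real, so the real case is applied to the real and imaginary
  parts of \<open>f\<close>.\<close>

lemma symmetric_second_derivative:
  fixes f :: "'a::real_normed_vector \<Rightarrow> complex"
  assumes "Cinf_on UNIV f"
  shows "frechet_derivative (\<lambda>y. frechet_derivative f (at y) u) (at x) v =
    frechet_derivative (\<lambda>y. frechet_derivative f (at y) v) (at x) u"
proof -
  let ?D = "\<lambda>w y. frechet_derivative f (at y) w"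
  have D: "(?D w has_derivative frechet_derivative (?D w) (at y)) (at y)" for w y
    using Cinf_on_has_derivative[OF Cinf_on_deriv[OF assms] UNIV_I] .
  have cD: "isCont (\<lambda>x. frechet_derivative (?D w) (at x) w') x" for w w'
    using Cinf_on_continuous[OF Cinf_on_deriv[OF Cinf_on_deriv[OF assms]], of w w']
    by (simp add: continuous_on_eq_continuous_at)
  have L: "l (frechet_derivative (?D u) (at x) v) = l (frechet_derivative (?D v) (at x) u)"
    if "bounded_linear l" for l :: "complex \<Rightarrow> real"
    by (rule symmetric_second_derivative_real[where g = "\<lambda>x. l (f x)" and g' = "\<lambda>x w. l (?D w x)"
        and gu = "\<lambda>x w. l (frechet_derivative (?D u) (at x) w)"
        and gv = "\<lambda>x w. l (frechet_derivative (?D v) (at x) w)"])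
      (auto intro!: bounded_linear.has_derivative[OF that] D Cinf_on_has_derivative[OF assms]
        bounded_linear.isCont[OF that] cD)
  show ?thesis using L[OF bounded_linear_Re] L[OF bounded_linear_Im] by (simp add: complex_eq_iff)
qed

lemma dir_derivs_move:
  fixes f :: "'a::real_normed_vector \<Rightarrow> complex"
  assumes "Cinf_on UNIV f"
  shows "dir_derivs (us @ v # vs) f = dir_derivs (v # us @ vs) f"
proof (induction us)
  case (Cons u us)
  show ?case
    using symmetric_second_derivative[OF Cinf_dir_derivs[OF assms, of "us @ vs"], of v _ u]
    by (auto simp: Cons)
qed simp

text \<open>This makes the arbitrary enumeration \<open>coords\<close> harmless: lists of directions
  may be treated as multisets.\<close>

lemma dir_derivs_perm:
  fixes f :: "'a::real_normed_vector \<Rightarrow> complex"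
  assumes "Cinf_on UNIV f" "mset us = mset vs"
  shows "dir_derivs us f = dir_derivs vs f"
  using assms(2)
proof (induction us arbitrary: vs)
  case (Cons u us)
  then have "u \<in> set vs" by (metis list.set_intros(1) set_mset_mset)
  then obtain as bs where vs: "vs = as @ u # bs" by (meson split_list)
  with Cons.prems have "mset us = mset (as @ bs)" by simp
  from Cons.IH[OF this] show ?case unfolding vs dir_derivs_move[OF assms(1)] by simp
qed simp

section \<open>Weights\<close>

lemma one_plus_power_le_exp:
  fixes t :: real assumes "0 \<le> t"
  shows "(1 + t) ^ l \<le> real l ^ l * exp t"
proof (cases "l = 0")
  case False
  have "1 + t \<le> real l * (1 + t / real l)" using False assms by (simp add: field_simps)
  then have "(1 + t) ^ l \<le> (real l * (1 + t / real l)) ^ l" using assms by (intro power_mono) auto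
  also have "\<dots> = real l ^ l * (1 + t / real l) ^ l" by (simp add: power_mult_distrib)
  also have "\<dots> \<le> real l ^ l * exp t" using False assms
    by (intro mult_left_mono exp_ge_one_plus_x_over_n_power_n) (auto intro: order_trans[of _ 0])
  finally show ?thesis .
qed (use assms in simp)

text \<open>Each factor \<open>\<epsilon>\<close> buys two powers of decay, with a constant free of
  \<open>\<epsilon>\<close>: \<open>\<epsilon> * (1 + s)\<^sup>2\<close> is at most
  \<open>2 * (1 + \<epsilon> * s\<^sup>2)\<close>, and powers of the latter are beaten by
  \<open>exp (\<epsilon> * s\<^sup>2)\<close>.\<close>

lemma gaussian_weight_bound:
  fixes s \<epsilon> :: real
  assumes "0 < \<epsilon>" "\<epsilon> \<le> 1" "0 \<le> s"
  shows "\<epsilon> ^ l * exp (- \<epsilon> * s\<^sup>2) \<le> 2 ^ l * real l ^ l * (1 + s) powr (- 2 * real l)"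
proof -
  have "\<epsilon> * (1 + s)\<^sup>2 \<le> 2 * (1 + \<epsilon> * s\<^sup>2)"
  proof -
    have "(1 + s)\<^sup>2 \<le> 2 * (1 + s\<^sup>2)" using sum_squares_ge_zero[of "1 - s" 0] by (simp add: power2_eq_square algebra_simps)
    then have "\<epsilon> * (1 + s)\<^sup>2 \<le> \<epsilon> * (2 * (1 + s\<^sup>2))" using assms by (intro mult_left_mono) auto
    also have "\<dots> \<le> 2 * (1 + \<epsilon> * s\<^sup>2)" using assms by (simp add: algebra_simps)
    finally show ?thesis .
  qed
  then have "(\<epsilon> * (1 + s)\<^sup>2) ^ l \<le> (2 * (1 + \<epsilon> * s\<^sup>2)) ^ l" using assms by (intro power_mono) auto
  also have "\<dots> = 2 ^ l * (1 + \<epsilon> * s\<^sup>2) ^ l" by (simp only: power_mult_distrib)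
  also have "\<dots> \<le> 2 ^ l * (real l ^ l * exp (\<epsilon> * s\<^sup>2))"
    using assms by (intro mult_left_mono one_plus_power_le_exp) auto
  finally have 1: "(\<epsilon> * (1 + s)\<^sup>2) ^ l \<le> 2 ^ l * real l ^ l * exp (\<epsilon> * s\<^sup>2)" by simp
  have p: "((1 + s)\<^sup>2) ^ l = (1 + s) powr (2 * real l)" "(1 + s) powr (2 * real l) > 0"
    using assms powr_realpow[of "1 + s" "2 * l"] by (simp_all add: power_mult)
  have "\<epsilon> ^ l * exp (- \<epsilon> * s\<^sup>2) = (\<epsilon> * (1 + s)\<^sup>2) ^ l * exp (- \<epsilon> * s\<^sup>2) * (1 + s) powr (- 2 * real l)"
    using p(2) by (simp add: power_mult_distrib p(1) powr_minus field_simps)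
  also have "\<dots> \<le> (2 ^ l * real l ^ l * exp (\<epsilon> * s\<^sup>2)) * exp (- \<epsilon> * s\<^sup>2) * (1 + s) powr (- 2 * real l)"
    using 1 by (intro mult_right_mono) auto
  also have "\<dots> = 2 ^ l * real l ^ l * (1 + s) powr (- 2 * real l)"
    by (simp add: exp_minus field_simps)
  finally show ?thesis .
qed

text \<open>For a fixed \<open>\<epsilon>\<close> any order is reached, at the price of a constant
  containing \<open>1 / \<epsilon> ^ l\<close>.\<close>

lemma gaussian_decay:
  fixes \<epsilon> a :: real
  assumes "0 < \<epsilon>" "\<epsilon> \<le> 1"
  shows "\<exists>C>0. \<forall>s\<ge>0. exp (- \<epsilon> * s\<^sup>2) \<le> C * (1 + s) powr a"
proof -
  define l where "l = nat \<lceil>\<bar>a\<bar>\<rceil>"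
  have l: "- 2 * real l \<le> a" unfolding l_def by linarith
  have "exp (- \<epsilon> * s\<^sup>2) \<le> 2 ^ l * real l ^ l / \<epsilon> ^ l * (1 + s) powr a" if "s \<ge> 0" for s
  proof -
    have "exp (- \<epsilon> * s\<^sup>2) \<le> 2 ^ l * real l ^ l / \<epsilon> ^ l * (1 + s) powr (- 2 * real l)"
      using gaussian_weight_bound[OF assms that, of l] assms by (simp add: field_simps)
    also have "\<dots> \<le> 2 ^ l * real l ^ l / \<epsilon> ^ l * (1 + s) powr a"
      using l assms that by (intro mult_left_mono powr_mono) auto
    finally show ?thesis .
  qed
  moreover have "2 ^ l * real l ^ l / \<epsilon> ^ l > 0" using assms by (cases "l = 0") auto
  ultimately show ?thesis by blast
qed

section \<open>Weights and their integrals over balls\<close>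

definition weight :: "real \<Rightarrow> 'e::real_normed_vector \<Rightarrow> real" where
  "weight \<mu> \<zeta> = (1 + norm \<zeta>) powr \<mu>"

lemma one_plus_norm_pos: "0 < 1 + norm x" by (smt (verit) norm_ge_zero)

lemma weight_pos: "weight \<mu> \<zeta> > 0"
  using one_plus_norm_pos[of \<zeta>] by (simp add: weight_def)

lemma weight_nonneg: "weight \<mu> \<zeta> \<ge> 0"
  using weight_pos less_imp_le by blast

lemma weight_mono: "\<mu> \<le> \<nu> \<Longrightarrow> weight \<mu> \<zeta> \<le> weight \<nu> \<zeta>"
  by (simp add: weight_def powr_mono)

lemma weight_add: "weight (\<mu> + \<nu>) \<zeta> = weight \<mu> \<zeta> * weight \<nu> \<zeta>"
  by (simp add: weight_def powr_add)

lemma weight_zero: "weight 0 \<zeta> = 1"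
  using one_plus_norm_pos[of \<zeta>] by (simp add: weight_def)

lemma continuous_on_weight: "continuous_on S (weight \<mu>)"
  unfolding weight_def[abs_def]
  by (intro continuous_intros) (auto simp: add_nonneg_eq_0_iff)

lemma borel_measurable_weight [measurable]:
  "(weight \<mu> :: 'e::real_normed_vector \<Rightarrow> real) \<in> borel_measurable borel"
  by (intro borel_measurable_continuous_onI continuous_on_weight)

text \<open>The absolute value in the exponent of \<open>K\<close> covers both signs of
  \<open>\<mu>\<close>: for negative \<open>\<mu>\<close> the extra factor is at least 1 and
  \<open>b \<le> a\<close> suffices.\<close>

lemma powr_le_of_comparable:
  fixes a b \<mu> :: real
  assumes "0 < b" "b \<le> a" "a \<le> K * b" "K \<ge> 1"
  shows "a powr \<mu> \<le> K powr \<bar>\<mu>\<bar> * b powr \<mu>"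
proof (cases "\<mu> \<ge> 0")
  case True
  have "a powr \<mu> \<le> (K * b) powr \<mu>" using assms True by (intro powr_mono2) auto
  then show ?thesis using assms True by (simp add: powr_mult)
next
  case False
  have "a powr \<mu> \<le> b powr \<mu>" using assms False by (intro powr_mono2') auto
  also have "\<dots> \<le> K powr \<bar>\<mu>\<bar> * b powr \<mu>"
    using ge_one_powr_ge_zero[of K "\<bar>\<mu>\<bar>"] assms by (simp add: mult_le_cancel_right1)
  finally show ?thesis .
qed

text \<open>The type argument fixes the space, and with it the dimension, which neither
  \<open>\<mu>\<close> nor \<open>R\<close> determines.\<close>

definition ball_mass :: "'e::euclidean_space itself \<Rightarrow> real \<Rightarrow> real \<Rightarrow> real" where
  "ball_mass _ \<mu> R = (LINT \<zeta>|lborel. indicator (ball (0::'e) R) \<zeta> * weight \<mu> \<zeta>)"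

lemma integrable_ball_weight:
  "integrable lborel (\<lambda>\<zeta>::'e::euclidean_space. indicator (ball 0 R) \<zeta> * weight \<mu> \<zeta> :: real)"
proof -
  have "set_integrable lborel (cball 0 R) (weight \<mu> :: 'e \<Rightarrow> real)"
    unfolding set_integrable_def by (intro borel_integrable_compact compact_cball continuous_on_weight)
  then have "set_integrable lborel (ball 0 R) (weight \<mu> :: 'e \<Rightarrow> real)"
    by (rule set_integrable_subset) auto
  then show ?thesis by (simp add: set_integrable_def)
qed

lemma ball_mass_mono: "R \<le> R' \<Longrightarrow> ball_mass TYPE('e::euclidean_space) \<mu> R \<le> ball_mass TYPE('e) \<mu> R'"
  unfolding ball_mass_def
  by (intro integral_mono integrable_ball_weight mult_right_mono)
    (auto simp: indicator_def weight_nonneg)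

text \<open>On the shell between \<open>R\<close> and \<open>2 * R\<close> the weight is comparable
  with \<open>R powr \<mu>\<close>, since \<open>1 + norm \<zeta> \<le> 3 * R\<close> there, and the
  volume is of order \<open>R powr real DIM('e)\<close>.\<close>

lemma ball_mass_double:
  "\<exists>C>0. \<forall>R\<ge>1. ball_mass TYPE('e::euclidean_space) \<mu> (2 * R) \<le>
     ball_mass TYPE('e) \<mu> R + C * R powr (\<mu> + real DIM('e))"
proof -
  define c where "c = unit_ball_vol (real DIM('e)) * 2 ^ DIM('e)"
  have c: "c > 0" by (simp add: c_def)
  have "ball_mass TYPE('e) \<mu> (2 * R) \<le> ball_mass TYPE('e) \<mu> R + 3 powr \<bar>\<mu>\<bar> * c * R powr (\<mu> + real DIM('e))"
    if R: "R \<ge> 1" for R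
  proof -
    have i: "integrable lborel (\<lambda>\<zeta>::'e. 3 powr \<bar>\<mu>\<bar> * R powr \<mu> * indicator (ball 0 (2 * R)) \<zeta> :: real)"
      by (intro integrable_mult_right integrable_real_indicator) (use emeasure_bounded_finite[OF bounded_ball[of 0 "2 * R"]] in auto)
    have "ball_mass TYPE('e) \<mu> (2 * R) \<le> (LINT \<zeta>|lborel. indicator (ball (0::'e) R) \<zeta> * weight \<mu> \<zeta>
        + 3 powr \<bar>\<mu>\<bar> * R powr \<mu> * indicator (ball 0 (2 * R)) \<zeta>)"
      unfolding ball_mass_def
    proof (intro integral_mono Bochner_Integration.integrable_add integrable_ball_weight i)
      fix \<zeta> :: 'e
      have "weight \<mu> \<zeta> \<le> 3 powr \<bar>\<mu>\<bar> * R powr \<mu>" if "R \<le> norm \<zeta>" "norm \<zeta> < 2 * R"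
        unfolding weight_def using that R by (intro powr_le_of_comparable) auto
      then show "indicator (ball 0 (2 * R)) \<zeta> * weight \<mu> \<zeta> \<le> indicator (ball 0 R) \<zeta> * weight \<mu> \<zeta>
        + 3 powr \<bar>\<mu>\<bar> * R powr \<mu> * indicator (ball 0 (2 * R)) \<zeta>"
        using weight_nonneg[of \<mu> \<zeta>] R by (auto simp: indicator_def)
    qed
    also have "\<dots> = ball_mass TYPE('e) \<mu> R + 3 powr \<bar>\<mu>\<bar> * R powr \<mu> * measure lborel (ball (0::'e) (2 * R))"
      unfolding ball_mass_def
      using emeasure_bounded_finite[OF bounded_ball[of "0::'e" "2 * R"]]
      by (subst Bochner_Integration.integral_add) (auto intro: integrable_ball_weight i)
    also have "measure lborel (ball (0::'e) (2 * R)) = c * R powr real DIM('e)"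
      using R by (subst content_ball) (auto simp: c_def power_mult_distrib powr_realpow)
    finally show ?thesis by (simp add: powr_add mult_ac)
  qed
  then show ?thesis using c by (intro exI[of _ "3 powr \<bar>\<mu>\<bar> * c"]) auto
qed

lemma two_power_powr: "((2::real) ^ j) powr x = (2 powr x) ^ j"
proof -
  have "((2::real) ^ j) powr x = 2 powr (real j * x)" by (simp add: powr_powr powr_realpow[symmetric])
  also have "\<dots> = (2 powr x) powr real j" by (simp add: powr_powr mult.commute)
  also have "\<dots> = (2 powr x) ^ j" by (simp add: powr_realpow)
  finally show ?thesis .
qed

text \<open>Iterated doubling leads to a geometric sum whose ratio is below, at or above 1. These
  are the three regimes of the kernel estimates: bounded, logarithmic and power-like.\<close>

lemma ball_mass_dyadic:
  "\<exists>C>0. \<forall>j. ball_mass TYPE('e::euclidean_space) \<mu> (2 ^ j) \<le>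
     C * (1 + (\<Sum>i<j. (2 powr (\<mu> + real DIM('e))) ^ i))"
proof -
  obtain C where C: "C > 0" "\<And>R. R \<ge> 1 \<Longrightarrow> ball_mass TYPE('e) \<mu> (2 * R) \<le>
     ball_mass TYPE('e) \<mu> R + C * R powr (\<mu> + real DIM('e))" using ball_mass_double by blast
  define K where "K = max C (ball_mass TYPE('e) \<mu> 1)"
  have "ball_mass TYPE('e) \<mu> (2 ^ j) \<le> K * (1 + (\<Sum>i<j. (2 powr (\<mu> + real DIM('e))) ^ i))" for j
  proof (induction j)
    case (Suc j)
    have "((2::real) ^ j) powr (\<mu> + real DIM('e)) = (2 powr (\<mu> + real DIM('e))) ^ j"
      by (rule two_power_powr)
    then have "ball_mass TYPE('e) \<mu> (2 ^ Suc j) \<le> ball_mass TYPE('e) \<mu> (2 ^ j) + C * (2 powr (\<mu> + real DIM('e))) ^ j"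
      using C(2)[of "2 ^ j"] by simp
    also have "\<dots> \<le> K * (1 + (\<Sum>i<j. (2 powr (\<mu> + real DIM('e))) ^ i)) + K * (2 powr (\<mu> + real DIM('e))) ^ j"
      using Suc by (intro add_mono mult_right_mono) (auto simp: K_def)
    finally show ?case by (simp add: algebra_simps)
  qed (simp add: K_def)
  moreover have "K > 0" using C by (simp add: K_def)
  ultimately show ?thesis by blast
qed

text \<open>Monotone convergence along dyadic balls takes the place of polar coordinates: for a
  ratio below 1 the geometric sums stay bounded.\<close>

lemma integrable_weight:
  assumes "\<nu> < - real DIM('e::euclidean_space)"
  shows "integrable lborel (weight \<nu> :: 'e \<Rightarrow> real)"
proof -
  obtain C where C: "C > 0" "\<And>j. ball_mass TYPE('e) \<nu> (2 ^ j) \<le>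
     C * (1 + (\<Sum>i<j. (2 powr (\<nu> + real DIM('e))) ^ i))" 
    using ball_mass_dyadic[where ?'e = 'e, of \<nu>] by blast
  let ?a = "2 powr (\<nu> + real DIM('e)) :: real"
  have a: "?a < 1" "?a > 0" using assms powr_less_cancel_iff[of 2 "\<nu> + real DIM('e)" 0] by auto
  have "(\<Sum>i<j. ?a ^ i) \<le> 1 / (1 - ?a)" for j
    using a sum_gp_strict[of ?a j] by (auto simp: divide_right_mono)
  then have "C * (1 + (\<Sum>i<j. ?a ^ i)) \<le> C * (1 + 1 / (1 - ?a))" for j
    using C by (intro mult_left_mono add_left_mono) auto
  with C(2) have B: "ball_mass TYPE('e) \<nu> (2 ^ j) \<le> C * (1 + 1 / (1 - ?a))" for j
    using order_trans by blast
  have inc: "incseq (\<lambda>j. ball_mass TYPE('e) \<nu> (2 ^ j))"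
    by (intro monoI ball_mass_mono power_increasing) auto
  obtain L where L: "(\<lambda>j. ball_mass TYPE('e) \<nu> (2 ^ j)) \<longlonglongrightarrow> L"
    using incseq_convergent[OF inc] B by blast
  show ?thesis
  proof (rule integrable_monotone_convergence)
    show "integrable lborel (\<lambda>\<zeta>::'e. indicator (ball 0 (2 ^ j)) \<zeta> * weight \<nu> \<zeta> :: real)" for j
      by (rule integrable_ball_weight)
    show "AE \<zeta>::'e in lborel. mono (\<lambda>j. indicator (ball 0 (2 ^ j)) \<zeta> * weight \<nu> \<zeta> :: real)"
    proof (intro AE_I2 monoI mult_right_mono weight_nonneg)
      fix \<zeta> :: 'e and i j :: nat assume "i \<le> j"
      then have "ball (0::'e) (2 ^ i) \<subseteq> ball 0 (2 ^ j)" by (intro subset_ball power_increasing) auto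
      then show "indicator (ball 0 (2 ^ i)) \<zeta> \<le> (indicator (ball 0 (2 ^ j)) \<zeta> :: real)"
        by (auto simp: indicator_def)
    qed
    show "AE \<zeta>::'e in lborel. (\<lambda>j. indicator (ball 0 (2 ^ j)) \<zeta> * weight \<nu> \<zeta> :: real) \<longlonglongrightarrow> weight \<nu> \<zeta>"
    proof (intro AE_I2)
      fix \<zeta> :: 'e
      obtain n where n: "norm \<zeta> < 2 ^ n" using real_arch_pow[of 2 "norm \<zeta>"] by auto
      have "eventually (\<lambda>j. indicator (ball 0 (2 ^ j)) \<zeta> * weight \<nu> \<zeta> = weight \<nu> \<zeta>) sequentially"
        using eventually_ge_at_top[of n]
      proof eventually_elim
        case (elim j)
        then have "(2::real) ^ n \<le> 2 ^ j" by (intro power_increasing) auto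
        then have "norm \<zeta> < 2 ^ j" using n by linarith
        then show ?case by simp
      qed
      then show "(\<lambda>j. indicator (ball 0 (2 ^ j)) \<zeta> * weight \<nu> \<zeta> :: real) \<longlonglongrightarrow> weight \<nu> \<zeta>"
        by (rule tendsto_eventually)
    qed
    show "(\<lambda>j. LINT \<zeta>::'e|lborel. indicator (ball 0 (2 ^ j)) \<zeta> * weight \<nu> \<zeta>) \<longlonglongrightarrow> L"
      using L by (simp add: ball_mass_def)
  qed auto
qed

lemma dyadic_above:
  fixes R :: real assumes "R \<ge> 1"
  obtains j where "R \<le> 2 ^ j" "2 ^ j \<le> 2 * R" "real j \<le> 1 + ln R / ln 2"
proof
  let ?j = "nat \<lceil>log 2 R\<rceil>"
  have nn: "log 2 R \<ge> 0" using assms by simp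
  have 1: "log 2 R \<le> real ?j" by linarith
  have 2: "real ?j \<le> 1 + log 2 R" using nn by linarith
  show "R \<le> 2 ^ ?j" using powr_mono[OF 1, of 2] assms powr_realpow[of 2 ?j] by simp
  have "(2::real) ^ ?j = 2 powr real ?j" by (simp add: powr_realpow)
  also have "\<dots> \<le> 2 powr (1 + log 2 R)" using 2 by (intro powr_mono) auto
  also have "\<dots> = 2 * R" using assms by (simp add: powr_add)
  finally show "2 ^ ?j \<le> 2 * R" .
  show "real ?j \<le> 1 + ln R / ln 2" using 2 by (simp add: log_def)
qed

text \<open>For a ratio above 1 the geometric sum is comparable with its last term, that is, with
  the contribution of the outermost shell.\<close>

lemma ball_mass_pos_order:
  assumes "\<mu> + real DIM('e::euclidean_space) > 0"
  shows "\<exists>C>0. \<forall>R\<ge>1. ball_mass TYPE('e) \<mu> R \<le> C * R powr (\<mu> + real DIM('e))"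
proof -
  obtain C where C: "C > 0" "\<And>j. ball_mass TYPE('e) \<mu> (2 ^ j) \<le>
     C * (1 + (\<Sum>i<j. (2 powr (\<mu> + real DIM('e))) ^ i))" 
    using ball_mass_dyadic[where ?'e = 'e, of \<mu>] by blast
  let ?a = "2 powr (\<mu> + real DIM('e)) :: real"
  have a: "?a > 1" using assms by simp
  have "ball_mass TYPE('e) \<mu> R \<le> C * (1 + 1 / (?a - 1)) * ?a * R powr (\<mu> + real DIM('e))" if R: "R \<ge> 1" for R
  proof -
    obtain j where j: "R \<le> 2 ^ j" "2 ^ j \<le> 2 * R" using dyadic_above[OF R] by blast
    have "(\<Sum>i<j. ?a ^ i) = (?a ^ j - 1) / (?a - 1)" using geometric_sum[of ?a j] a assms by simp
    also have "\<dots> \<le> ?a ^ j / (?a - 1)" using a by (intro divide_right_mono) auto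
    finally have "(\<Sum>i<j. ?a ^ i) \<le> ?a ^ j / (?a - 1)" .
    moreover have "1 \<le> ?a ^ j" using a by (intro one_le_power less_imp_le)
    ultimately have "1 + (\<Sum>i<j. ?a ^ i) \<le> ?a ^ j * (1 + 1 / (?a - 1))"
      by (simp add: distrib_left)
    also have "?a ^ j \<le> ?a * R powr (\<mu> + real DIM('e))"
    proof -
      have "?a ^ j = (2 ^ j) powr (\<mu> + real DIM('e))" by (rule two_power_powr[symmetric])
      also have "\<dots> \<le> (2 * R) powr (\<mu> + real DIM('e))" using j assms by (intro powr_mono2) auto
      finally show ?thesis using R by (simp add: powr_mult)
    qed
    finally have "1 + (\<Sum>i<j. ?a ^ i) \<le> ?a * R powr (\<mu> + real DIM('e)) * (1 + 1 / (?a - 1))"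
      using a by (simp add: mult_right_mono)
    then have "C * (1 + (\<Sum>i<j. ?a ^ i)) \<le> C * (?a * R powr (\<mu> + real DIM('e)) * (1 + 1 / (?a - 1)))"
      using C by (intro mult_left_mono) auto
    then show ?thesis using ball_mass_mono[OF j(1), where ?'e = 'e, of \<mu>] C(2)[of j] by (simp add: mult_ac)
  qed
  moreover have "C * (1 + 1 / (?a - 1)) * ?a > 0" using a C by (auto intro!: mult_pos_pos add_pos_pos)
  ultimately show ?thesis by blast
qed

text \<open>The ratio is 1, so the sum counts the dyadic shells inside the ball, about
  \<open>log 2 R\<close> of them. This is the source of the logarithm in the borderline
  case.\<close>

lemma ball_mass_zero_order:
  assumes "\<mu> + real DIM('e::euclidean_space) = 0"
  shows "\<exists>C>0. \<forall>R\<ge>1. ball_mass TYPE('e) \<mu> R \<le> C * (1 + ln R)"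
proof -
  obtain C where C: "C > 0" "\<And>j. ball_mass TYPE('e) \<mu> (2 ^ j) \<le>
     C * (1 + (\<Sum>i<j. (2 powr (\<mu> + real DIM('e))) ^ i))" 
    using ball_mass_dyadic[where ?'e = 'e, of \<mu>] by blast
  have "ball_mass TYPE('e) \<mu> R \<le> C * 2 / ln 2 * (1 + ln R)" if R: "R \<ge> 1" for R
  proof -
    obtain j where j: "R \<le> 2 ^ j" "real j \<le> 1 + ln R / ln 2" using dyadic_above[OF R] by blast
    have "ball_mass TYPE('e) \<mu> R \<le> C * (1 + real j)"
      using ball_mass_mono[OF j(1), where ?'e = 'e, of \<mu>] C(2)[of j] assms by simp
    also have "\<dots> \<le> C * (2 / ln 2 * (1 + ln R))"
    proof -
      have l2: "0 < ln (2::real)" "ln (2::real) \<le> 1" using ln_le_minus_one[of 2] by auto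
      have "1 + real j \<le> 2 + ln R / ln 2" using j by simp
      also have "\<dots> \<le> 2 / ln 2 * (1 + ln R)"
        proof -
        have "ln R / ln 2 \<le> 2 / ln 2 * ln R" using R l2 by (simp add: field_simps)
        moreover have "2 \<le> 2 / ln (2::real)" using l2 by (simp add: field_simps)
        moreover have "2 / ln 2 * (1 + ln R) = 2 / ln 2 + 2 / ln 2 * ln R" using distrib_left[of "2 / ln 2" 1 "ln R"] by simp
        ultimately show ?thesis by linarith
      qed
      finally show ?thesis using C by (intro mult_left_mono) auto
    qed
    finally show ?thesis by (simp add: mult_ac)
  qed
  moreover have "C * 2 / ln 2 > 0" using C by simp
  ultimately show ?thesis by blast
qed

lemma integral_weight_scale:
  fixes R :: real
  assumes "R > 0" "\<nu> < - real DIM('e::euclidean_space)"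
  shows "integrable lborel (\<lambda>\<zeta>::'e. weight \<nu> (\<zeta> /\<^sub>R R))"
    and "(LINT \<zeta>::'e|lborel. weight \<nu> (\<zeta> /\<^sub>R R)) = R powr real DIM('e) * (LINT \<zeta>::'e|lborel. weight \<nu> \<zeta>)"
proof -
  let ?D = "distr lborel borel (\<lambda>x::'e. 0 + R *\<^sub>R x)"
  let ?f = "\<lambda>\<zeta>::'e. weight \<nu> (\<zeta> /\<^sub>R R)"
  have l: "lborel = density ?D (\<lambda>_. R ^ DIM('e))"
    using lborel_affine[of R "0::'e"] assms by simp
  have eq: "?f (0 + R *\<^sub>R x) = weight \<nu> x" for x using assms by simp
  have m: "?f \<in> borel_measurable borel" by measurable
  have i: "integrable ?D ?f"
    using integrable_weight[OF assms(2)] by (subst integrable_distr_eq) (use eq m in auto)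
  show "integrable lborel ?f"
    by (subst l, subst integrable_density) (use i m assms in \<open>auto intro!: integrable_scaleR_right\<close>)
  have "(LINT \<zeta>|lborel. ?f \<zeta>) = (LINT \<zeta>|?D. R ^ DIM('e) *\<^sub>R ?f \<zeta>)"
    by (subst l, subst integral_density) (use m assms in auto)
  also have "\<dots> = R ^ DIM('e) * (LINT \<zeta>|?D. ?f \<zeta>)" by simp
  also have "(LINT \<zeta>|?D. ?f \<zeta>) = (LINT \<zeta>::'e|lborel. weight \<nu> \<zeta>)"
    by (subst integral_distr) (use eq m in auto)
  finally show "(LINT \<zeta>|lborel. ?f \<zeta>) = R powr real DIM('e) * (LINT \<zeta>::'e|lborel. weight \<nu> \<zeta>)"
    using assms by (simp add: powr_realpow)
qed

text \<open>Inside the ball the Gaussian is bounded by 1. Outside, in the scaled variable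
  \<open>s = norm \<zeta> / R\<close>, it outweighs the factor
  \<open>(1 + s) powr \<bar>\<mu>\<bar>\<close> by which the weight may exceed
  \<open>R powr \<mu>\<close>, and leaves a tail of any prescribed order
  \<open>\<nu>\<close>.\<close>

lemma gaussian_weight_pointwise:
  "\<exists>C>0. \<forall>R\<ge>1. \<forall>\<zeta>::'e::euclidean_space. weight \<mu> \<zeta> * exp (- (norm \<zeta>)\<^sup>2 / R\<^sup>2) \<le>
     indicator (ball 0 R) \<zeta> * weight \<mu> \<zeta> + C * R powr \<mu> * weight \<nu> (\<zeta> /\<^sub>R R)"
proof -
  obtain C where C: "C > 0" "\<And>s::real. s \<ge> 0 \<Longrightarrow> exp (- s\<^sup>2) \<le> C * (1 + s) powr (\<nu> - \<bar>\<mu>\<bar>)"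
    using gaussian_decay[of 1] by auto
  have "weight \<mu> \<zeta> * exp (- (norm \<zeta>)\<^sup>2 / R\<^sup>2) \<le>
     indicator (ball 0 R) \<zeta> * weight \<mu> \<zeta> + (2 powr \<bar>\<mu>\<bar> * C) * R powr \<mu> * weight \<nu> (\<zeta> /\<^sub>R R)"
    if R: "R \<ge> 1" for R and \<zeta> :: 'e
  proof (cases "norm \<zeta> < R")
    case True
    have "weight \<mu> \<zeta> * exp (- (norm \<zeta>)\<^sup>2 / R\<^sup>2) \<le> weight \<mu> \<zeta> * 1"
      by (intro mult_left_mono weight_nonneg) auto
    then show ?thesis using True C R weight_nonneg[of \<nu> "\<zeta> /\<^sub>R R"] by (simp add: add_increasing2)
  next
    case False
    define s where "s = norm \<zeta> / R"
    have s: "s \<ge> 1" "norm \<zeta> = R * s" using False R by (auto simp: s_def)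
    have "weight \<mu> \<zeta> \<le> 2 powr \<bar>\<mu>\<bar> * (R * s) powr \<mu>"
      unfolding weight_def s(2) using R s mult_mono[of 1 R 1 s] by (intro powr_le_of_comparable) auto
    also have "(R * s) powr \<mu> = R powr \<mu> * s powr \<mu>" using R s by (simp add: powr_mult)
    also have "s powr \<mu> \<le> (1 + s) powr \<bar>\<mu>\<bar>"
      using s powr_mono[of \<mu> "\<bar>\<mu>\<bar>" s] powr_mono2[of "\<bar>\<mu>\<bar>" s "1 + s"] by (smt (verit))
    finally have 1: "weight \<mu> \<zeta> \<le> 2 powr \<bar>\<mu>\<bar> * (R powr \<mu> * (1 + s) powr \<bar>\<mu>\<bar>)"
      by (simp add: mult_left_mono)
    have 2: "exp (- (norm \<zeta>)\<^sup>2 / R\<^sup>2) \<le> C * (1 + s) powr (\<nu> - \<bar>\<mu>\<bar>)"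
    proof -
      have "- (norm \<zeta>)\<^sup>2 / R\<^sup>2 = - s\<^sup>2" by (simp add: s_def power_divide)
      then show ?thesis using C(2)[of s] s by simp
    qed
    have "weight \<mu> \<zeta> * exp (- (norm \<zeta>)\<^sup>2 / R\<^sup>2) \<le>
        (2 powr \<bar>\<mu>\<bar> * (R powr \<mu> * (1 + s) powr \<bar>\<mu>\<bar>)) * (C * (1 + s) powr (\<nu> - \<bar>\<mu>\<bar>))"
      using 1 2 by (intro mult_mono) auto
    also have "\<dots> = (2 powr \<bar>\<mu>\<bar> * C) * R powr \<mu> * ((1 + s) powr \<bar>\<mu>\<bar> * (1 + s) powr (\<nu> - \<bar>\<mu>\<bar>))" by simp
    also have "(1 + s) powr \<bar>\<mu>\<bar> * (1 + s) powr (\<nu> - \<bar>\<mu>\<bar>) = (1 + s) powr \<nu>" by (simp add: powr_add[symmetric])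
    also have "(1 + s) powr \<nu> = weight \<nu> (\<zeta> /\<^sub>R R)" using R by (simp add: weight_def s_def field_simps)
    finally show ?thesis using False by simp
  qed
  moreover have "2 powr \<bar>\<mu>\<bar> * C > 0" using C by simp
  ultimately show ?thesis by blast
qed

lemma gaussian_weight_integral:
  assumes "\<nu> < - real DIM('e::euclidean_space)"
  shows "\<exists>C>0. \<forall>R\<ge>1. integrable lborel (\<lambda>\<zeta>::'e. weight \<mu> \<zeta> * exp (- (norm \<zeta>)\<^sup>2 / R\<^sup>2)) \<and>
     (LINT \<zeta>::'e|lborel. weight \<mu> \<zeta> * exp (- (norm \<zeta>)\<^sup>2 / R\<^sup>2)) \<le>
       ball_mass TYPE('e) \<mu> R + C * R powr (\<mu> + real DIM('e))"
proof -
  obtain C where C: "C > 0" "\<And>R \<zeta>. R \<ge> 1 \<Longrightarrow> weight \<mu> \<zeta> * exp (- (norm \<zeta>)\<^sup>2 / R\<^sup>2) \<le>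
     indicator (ball 0 R) \<zeta> * weight \<mu> \<zeta> + C * R powr \<mu> * weight \<nu> ((\<zeta>::'e) /\<^sub>R R)"
    using gaussian_weight_pointwise[where ?'e = 'e, of \<mu> \<nu>] by blast
  define J where "J = (LINT \<zeta>::'e|lborel. weight \<nu> \<zeta>)"
  have "J \<ge> 0" unfolding J_def by (intro integral_nonneg_AE AE_I2 weight_nonneg)
  have "integrable lborel (\<lambda>\<zeta>::'e. weight \<mu> \<zeta> * exp (- (norm \<zeta>)\<^sup>2 / R\<^sup>2)) \<and>
     (LINT \<zeta>::'e|lborel. weight \<mu> \<zeta> * exp (- (norm \<zeta>)\<^sup>2 / R\<^sup>2)) \<le>
       ball_mass TYPE('e) \<mu> R + (C * (J + 1)) * R powr (\<mu> + real DIM('e))" if R: "R \<ge> 1" for R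
  proof -
    have R0: "R > 0" using R by simp
    let ?g = "\<lambda>\<zeta>::'e. indicator (ball 0 R) \<zeta> * weight \<mu> \<zeta> + C * R powr \<mu> * weight \<nu> (\<zeta> /\<^sub>R R)"
    have ig: "integrable lborel ?g"
      by (intro Bochner_Integration.integrable_add integrable_ball_weight integrable_mult_right
          integral_weight_scale(1)[OF R0 assms])
    have i: "integrable lborel (\<lambda>\<zeta>::'e. weight \<mu> \<zeta> * exp (- (norm \<zeta>)\<^sup>2 / R\<^sup>2))"
    proof (rule Bochner_Integration.integrable_bound[OF ig])
      have "norm (weight \<mu> \<zeta> * exp (- (norm \<zeta>)\<^sup>2 / R\<^sup>2)) \<le> norm (?g \<zeta>)" for \<zeta>
        using C(2)[OF R, of \<zeta>] weight_nonneg[of \<mu> \<zeta>] by (simp only: real_norm_def abs_mult abs_exp_cancel abs_of_nonneg)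
      then show "AE \<zeta> in lborel. norm (weight \<mu> \<zeta> * exp (- (norm \<zeta>)\<^sup>2 / R\<^sup>2)) \<le> norm (?g \<zeta>)" by simp
    qed measurable
    have "(LINT \<zeta>::'e|lborel. weight \<mu> \<zeta> * exp (- (norm \<zeta>)\<^sup>2 / R\<^sup>2)) \<le> (LINT \<zeta>|lborel. ?g \<zeta>)"
      by (intro integral_mono i ig C(2) R)
    also have "\<dots> = ball_mass TYPE('e) \<mu> R + C * R powr \<mu> * (R powr real DIM('e) * J)"
      unfolding ball_mass_def J_def integral_weight_scale(2)[OF R0 assms, symmetric]
      by (subst Bochner_Integration.integral_add)
        (auto intro: integrable_ball_weight integrable_mult_right integral_weight_scale(1)[OF R0 assms])
    also have "\<dots> \<le> ball_mass TYPE('e) \<mu> R + (C * (J + 1)) * R powr (\<mu> + real DIM('e))"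
      using C by (simp add: powr_add algebra_simps)
    finally show ?thesis using i by blast
  qed
  moreover have "C * (J + 1) > 0" using C \<open>J \<ge> 0\<close> by simp
  ultimately show ?thesis by blast
qed

text \<open>The first bound is used where \<open>norm \<zeta> \<ge> R\<close>. Closer to the origin
  it is too large and the second one takes over: as \<open>\<nu> + 2 * real L \<ge> 0\<close>, its
  weight is at most its size at radius \<open>R\<close>, up to constants. Both cases end in one
  profile in \<open>\<zeta> /\<^sub>R R\<close>, whose integral scales exactly.\<close>

lemma high_frequency_pointwise:
  fixes \<zeta> :: "'e::euclidean_space"
  assumes "\<nu> < 0" "\<nu> + 2 * real L \<ge> 0" "R \<ge> 1"
    "0 \<le> a" "a \<le> A * weight \<nu> \<zeta>" "a \<le> A * (1 / R\<^sup>2) ^ L * weight (\<nu> + 2 * real L) \<zeta>"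
  shows "a \<le> A * 4 ^ L * 2 powr (- \<nu>) * R powr \<nu> * weight \<nu> (\<zeta> /\<^sub>R R)"
proof -
  have A: "A \<ge> 0" using assms(4,5) weight_pos[of \<nu> \<zeta>] by (smt (verit) mult_neg_pos)
  define s where "s = norm \<zeta> / R"
  have s: "s \<ge> 0" "norm \<zeta> = R * s" using assms(3) by (auto simp: s_def)
  have w: "weight \<nu> (\<zeta> /\<^sub>R R) = (1 + s) powr \<nu>" using assms(3) by (simp add: weight_def s_def field_simps)
  have pw: "1 \<le> (4::real) ^ L" by simp
  show ?thesis
  proof (cases "s \<ge> 1")
    case True
    have "weight \<nu> \<zeta> \<le> (R * ((1 + s) / 2)) powr \<nu>" unfolding weight_def s(2)
    proof (rule powr_mono2')
      have "R * ((1 + s) / 2) \<le> R * s" using True assms by (intro mult_left_mono) auto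
      then show "R * ((1 + s) / 2) \<le> 1 + R * s" by simp
      show "0 < R * ((1 + s) / 2)" using s assms by (intro mult_pos_pos) auto
    qed (use assms in simp)
    also have "\<dots> = R powr \<nu> * (1 + s) powr \<nu> * 2 powr (-\<nu>)"
      using assms s by (simp add: powr_mult powr_divide powr_minus_divide)
    finally have "A * weight \<nu> \<zeta> \<le> A * (R powr \<nu> * (1 + s) powr \<nu> * 2 powr (-\<nu>))"
      using A by (rule mult_left_mono)
    also have "\<dots> \<le> 4 ^ L * (A * (R powr \<nu> * (1 + s) powr \<nu> * 2 powr (-\<nu>)))"
      using A mult_right_mono[OF pw, of "A * (R powr \<nu> * (1 + s) powr \<nu> * 2 powr (-\<nu>))"] by simp
    finally show ?thesis using assms(5) by (simp add: w mult_ac)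
  next
    case False
    have "weight (\<nu> + 2 * real L) \<zeta> \<le> (2 * R) powr (\<nu> + 2 * real L)"
      unfolding weight_def s(2) using assms s False
      by (intro powr_mono2) (auto intro!: add_nonneg_nonneg order_trans[of "1 + R * s" "R + R * 1"] add_mono mult_left_mono)
    also have "\<dots> = 4 ^ L * 2 powr \<nu> * R powr \<nu> * (R\<^sup>2) ^ L"
    proof -
      have "(2 * R) powr (2 * real L) = (2 * R) ^ (2 * L)"
        using assms powr_realpow[of "2 * R" "2 * L"] by simp
      also have "\<dots> = 4 ^ L * (R\<^sup>2) ^ L" by (simp add: power_mult power_mult_distrib)
      finally show ?thesis using assms by (simp add: powr_add powr_mult)
    qed
    finally have "A * (1 / R\<^sup>2) ^ L * weight (\<nu> + 2 * real L) \<zeta> \<le> A * (1 / R\<^sup>2) ^ L * (4 ^ L * 2 powr \<nu> * R powr \<nu> * (R\<^sup>2) ^ L)"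
      using A assms by (intro mult_left_mono) auto
    also have "\<dots> = A * 4 ^ L * R powr \<nu> * 2 powr \<nu>" using assms by (simp add: power_divide)
    also have "\<dots> \<le> A * 4 ^ L * R powr \<nu> * (2 powr (- \<nu>) * (1 + s) powr \<nu>)"
    proof (intro mult_left_mono)
      have "2 powr \<nu> \<le> (1 + s) powr \<nu>" using assms s False by (intro powr_mono2') auto
      also have "\<dots> \<le> 2 powr (- \<nu>) * (1 + s) powr \<nu>"
        using assms ge_one_powr_ge_zero[of 2 "- \<nu>"] by (simp add: mult_le_cancel_right1)
      finally show "2 powr \<nu> \<le> 2 powr (- \<nu>) * (1 + s) powr \<nu>" .
    qed (use A in auto)
    finally show ?thesis using assms(6) by (simp add: w mult_ac)
  qed
qed

lemma
  fixes f :: "'e::euclidean_space \<Rightarrow> 'b::{banach, second_countable_topology}"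
  shows integral_translate: "(LINT x|lborel. f (x + t)) = (LINT x|lborel. f x)"
    and integrable_translate: "integrable lborel f \<Longrightarrow> integrable lborel (\<lambda>x. f (x + t))"
proof -
  have d: "distr lborel borel ((+) t) = (lborel :: 'e measure)" by (rule lborel_distr_plus)
  show i: "integrable lborel (\<lambda>x. f (x + t))" if "integrable lborel f" for f :: "'e \<Rightarrow> 'b" and t
  proof -
    have "integrable (distr lborel borel ((+) t)) f" using that lborel_distr_plus[of t] by simp
    then have "integrable lborel (\<lambda>x. f (t + x))" by (rule integrable_distr[rotated]) auto
    then show ?thesis by (simp add: add.commute)
  qed
  show "(LINT x|lborel. f (x + t)) = (LINT x|lborel. f x)"
  proof (cases "integrable lborel f")
    case True
    then have m: "f \<in> borel_measurable borel" by auto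
    have "(LINT x|lborel. f x) = (LINT x|distr lborel borel ((+) t). f x)" by (simp add: d)
    also have "\<dots> = (LINT x|lborel. f (t + x))" using m by (subst integral_distr) auto
    finally show ?thesis by (simp add: add.commute)
  next
    case False
    \<comment> \<open>Then neither function is integrable, and both integrals are 0 by
      convention.\<close>
    then have "\<not> integrable lborel (\<lambda>x. f (x + t))" using i[of "\<lambda>x. f (x + t)" "-t"] by auto
    then show ?thesis using False by (simp add: not_integrable_integral_eq)
  qed
qed

section \<open>Oscillatory integrals of symbols\<close>

text \<open>Functions of order \<open>\<mu>\<close> with \<open>k\<close> derivatives, each derivative lowering the order by \<open>\<rho>\<close>, and
  with constants uniform in the index. The index carries the variable \<open>x\<close> of a symbol and the
  regularization and cutoff parameters.\<close>

primrec symbol_family :: "real \<Rightarrow> 'i set \<Rightarrow> nat \<Rightarrow> real \<Rightarrow> ('i \<Rightarrow> 'e::euclidean_space \<Rightarrow> complex) \<Rightarrow> bool" where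
  "symbol_family \<rho> I 0 \<mu> F \<longleftrightarrow> (\<exists>C>0. \<forall>i\<in>I. \<forall>\<zeta>. norm (F i \<zeta>) \<le> C * weight \<mu> \<zeta>) \<and> (\<forall>i\<in>I. continuous_on UNIV (F i))"
| "symbol_family \<rho> I (Suc k) \<mu> F \<longleftrightarrow> (\<exists>C>0. \<forall>i\<in>I. \<forall>\<zeta>. norm (F i \<zeta>) \<le> C * weight \<mu> \<zeta>) \<and>
     (\<forall>i\<in>I. \<forall>\<zeta>. F i differentiable (at \<zeta>)) \<and>
     (\<forall>v. symbol_family \<rho> I k (\<mu> - \<rho>) (\<lambda>i \<zeta>. frechet_derivative (F i) (at \<zeta>) v))"

lemma symbol_family_bound: "symbol_family \<rho> I k \<mu> F \<Longrightarrow> \<exists>C>0. \<forall>i\<in>I. \<forall>\<zeta>. norm (F i \<zeta>) \<le> C * weight \<mu> \<zeta>"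
  by (cases k) auto

lemma symbol_family_continuous: "symbol_family \<rho> I k \<mu> F \<Longrightarrow> i \<in> I \<Longrightarrow> continuous_on UNIV (F i)"
  by (cases k) (auto simp: continuous_on_eq_continuous_within intro!: differentiable_imp_continuous_within)

lemma symbol_family_cong:
  assumes "\<And>i. i \<in> I \<Longrightarrow> F i = G i" shows "symbol_family \<rho> I k \<mu> F \<longleftrightarrow> symbol_family \<rho> I k \<mu> G"
  using assms
proof (induction k arbitrary: F G \<mu>)
  case 0 then show ?case by simp
next
  case (Suc k)
  have "symbol_family \<rho> I k (\<mu> - \<rho>) (\<lambda>i \<zeta>. frechet_derivative (F i) (at \<zeta>) v) \<longleftrightarrow>
    symbol_family \<rho> I k (\<mu> - \<rho>) (\<lambda>i \<zeta>. frechet_derivative (G i) (at \<zeta>) v)" for v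
    by (rule Suc.IH) (simp add: Suc.prems)
  then show ?case using Suc.prems by simp
qed

lemma symbol_family_SucI:
  assumes "\<exists>C>0. \<forall>i\<in>I. \<forall>\<zeta>. norm (F i \<zeta>) \<le> C * weight \<mu> \<zeta>"
    and "\<And>i \<zeta>. i \<in> I \<Longrightarrow> (F i has_derivative (\<lambda>v. F' v i \<zeta>)) (at \<zeta>)"
    and "\<And>v. symbol_family \<rho> I k (\<mu> - \<rho>) (F' v)"
  shows "symbol_family \<rho> I (Suc k) \<mu> F"
proof -
  have "symbol_family \<rho> I k (\<mu> - \<rho>) (\<lambda>i \<zeta>. frechet_derivative (F i) (at \<zeta>) v)" for v
    using symbol_family_cong[of I "F' v" "\<lambda>i \<zeta>. frechet_derivative (F i) (at \<zeta>) v"] assms(3)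
      frechet_derivative_eqI[OF assms(2)] by (metis (no_types, lifting) ext)
  moreover have "F i differentiable (at \<zeta>)" if "i \<in> I" for i \<zeta>
    using assms(2)[OF that] differentiable_def by blast
  ultimately show ?thesis using assms(1) by simp
qed

lemma symbol_family_Suc_has_derivative:
  "symbol_family \<rho> I (Suc k) \<mu> F \<Longrightarrow> i \<in> I \<Longrightarrow> (F i has_derivative frechet_derivative (F i) (at \<zeta>)) (at \<zeta>)"
  by (auto intro: differentiableD)

lemma symbol_family_Suc_imp: "symbol_family \<rho> I (Suc k) \<mu> F \<Longrightarrow> symbol_family \<rho> I k \<mu> F"
proof (induction k arbitrary: F \<mu>)
  case 0
  then show ?case using symbol_family_continuous[OF 0] by simp
next
  case (Suc k)
  from Suc.prems have "\<exists>C>0. \<forall>i\<in>I. \<forall>\<zeta>. norm (F i \<zeta>) \<le> C * weight \<mu> \<zeta>"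
    "\<forall>i\<in>I. \<forall>\<zeta>. F i differentiable (at \<zeta>)"
    "\<And>v. symbol_family \<rho> I (Suc k) (\<mu> - \<rho>) (\<lambda>i \<zeta>. frechet_derivative (F i) (at \<zeta>) v)"
    by simp_all
  then show ?case using Suc.IH by auto
qed

lemma weight_bound_mono:
  assumes "\<exists>C>0. \<forall>i\<in>I. \<forall>\<zeta>. norm (F i \<zeta>) \<le> C * weight \<mu> \<zeta>" "\<mu> \<le> \<nu>"
  shows "\<exists>C>0. \<forall>i\<in>I. \<forall>\<zeta>. norm (F i \<zeta>) \<le> C * weight \<nu> \<zeta>"
  using assms weight_mono[OF assms(2)] by (meson mult_left_mono order_less_imp_le order_trans)

lemma symbol_family_mono: "symbol_family \<rho> I k \<mu> F \<Longrightarrow> \<mu> \<le> \<nu> \<Longrightarrow> symbol_family \<rho> I k \<nu> F"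
proof (induction k arbitrary: F \<mu> \<nu>)
  case 0
  then show ?case using weight_bound_mono[of I F \<mu> \<nu>] by simp
next
  case (Suc k)
  have "symbol_family \<rho> I k (\<nu> - \<rho>) (\<lambda>i \<zeta>. frechet_derivative (F i) (at \<zeta>) v)" for v
    by (rule Suc.IH[of "\<mu> - \<rho>"]) (use Suc.prems in auto)
  with Suc.prems show ?case using weight_bound_mono[of I F \<mu> \<nu>] by simp
qed

text \<open>The constants do not see the index, so any map of index sets is allowed. Estimates in
  one parameter are thus transferred to families indexed by pairs or triples.\<close>

lemma symbol_family_reindex:
  assumes "symbol_family \<rho> I k \<mu> F" "\<And>j. j \<in> J \<Longrightarrow> g j \<in> I"
  shows "symbol_family \<rho> J k \<mu> (\<lambda>j. F (g j))"
  using assms by (induction k arbitrary: F \<mu>) (simp_all, blast+)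

lemma weight_bound_add:
  assumes "\<exists>C>0. \<forall>i\<in>I. \<forall>\<zeta>. norm (F i \<zeta> :: complex) \<le> C * weight \<mu> \<zeta>"
    "\<exists>C>0. \<forall>i\<in>I. \<forall>\<zeta>. norm (G i \<zeta> :: complex) \<le> C * weight \<mu> \<zeta>"
  shows "\<exists>C>0. \<forall>i\<in>I. \<forall>\<zeta>. norm (F i \<zeta> + G i \<zeta>) \<le> C * weight \<mu> \<zeta>"
proof -
  obtain C D where "C > 0" "D > 0" "\<And>i \<zeta>. i \<in> I \<Longrightarrow> norm (F i \<zeta>) \<le> C * weight \<mu> \<zeta>"
    "\<And>i \<zeta>. i \<in> I \<Longrightarrow> norm (G i \<zeta>) \<le> D * weight \<mu> \<zeta>" using assms by blast
  then show ?thesis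
    by (intro exI[of _ "C + D"]) (auto simp: distrib_right intro!: norm_triangle_le add_mono)
qed

lemma weight_bound_scale:
  assumes "\<exists>C>0. \<forall>i\<in>I. \<forall>\<zeta>. norm (F i \<zeta> :: complex) \<le> C * weight \<mu> \<zeta>"
    "\<And>i. i \<in> I \<Longrightarrow> norm (c i) \<le> B"
  shows "\<exists>C>0. \<forall>i\<in>I. \<forall>\<zeta>. norm (c i * F i \<zeta>) \<le> C * weight \<mu> \<zeta>"
proof -
  obtain C where C: "C > 0" "\<And>i \<zeta>. i \<in> I \<Longrightarrow> norm (F i \<zeta>) \<le> C * weight \<mu> \<zeta>" using assms by blast
  have "norm (c i * F i \<zeta>) \<le> (\<bar>B\<bar> + 1) * C * weight \<mu> \<zeta>" if "i \<in> I" for i \<zeta>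
  proof -
    have "norm (c i) \<le> \<bar>B\<bar> + 1" using assms(2)[OF that] by linarith
    then have "norm (c i) * norm (F i \<zeta>) \<le> (\<bar>B\<bar> + 1) * (C * weight \<mu> \<zeta>)"
      using C(2)[OF that] by (intro mult_mono) auto
    then show ?thesis by (simp add: norm_mult)
  qed
  moreover have "(\<bar>B\<bar> + 1) * C > 0" using C by simp
  ultimately show ?thesis by blast
qed

lemma weight_bound_mult:
  assumes "\<exists>C>0. \<forall>i\<in>I. \<forall>\<zeta>. norm (F i \<zeta> :: complex) \<le> C * weight \<mu> \<zeta>"
    "\<exists>C>0. \<forall>i\<in>I. \<forall>\<zeta>. norm (G i \<zeta> :: complex) \<le> C * weight \<nu> \<zeta>"
  shows "\<exists>C>0. \<forall>i\<in>I. \<forall>\<zeta>. norm (F i \<zeta> * G i \<zeta>) \<le> C * weight (\<mu> + \<nu>) \<zeta>"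
proof -
  obtain C D where CD: "C > 0" "D > 0" "\<And>i \<zeta>. i \<in> I \<Longrightarrow> norm (F i \<zeta>) \<le> C * weight \<mu> \<zeta>"
    "\<And>i \<zeta>. i \<in> I \<Longrightarrow> norm (G i \<zeta>) \<le> D * weight \<nu> \<zeta>" using assms by blast
  have "norm (F i \<zeta> * G i \<zeta>) \<le> (C * D) * weight (\<mu> + \<nu>) \<zeta>" if "i \<in> I" for i \<zeta>
    using mult_mono[OF CD(3)[OF that, of \<zeta>] CD(4)[OF that, of \<zeta>]] CD(1,2)
    by (simp add: norm_mult weight_add weight_nonneg mult_ac)
  with CD show ?thesis by (intro exI[of _ "C * D"]) auto
qed

lemma symbol_family_add:
  assumes "symbol_family \<rho> I k \<mu> F" "symbol_family \<rho> I k \<mu> G"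
  shows "symbol_family \<rho> I k \<mu> (\<lambda>i \<zeta>. F i \<zeta> + G i \<zeta>)"
  using assms
proof (induction k arbitrary: F G \<mu>)
  case (0 F G \<mu>)
  show ?case unfolding symbol_family.simps(1)
    by (rule conjI[OF weight_bound_add[OF symbol_family_bound[OF 0(1)] symbol_family_bound[OF 0(2)]]])
      (use 0 in \<open>auto intro!: continuous_on_add\<close>)
next
  case (Suc k)
  have "\<exists>C>0. \<forall>i\<in>I. \<forall>\<zeta>. norm (F i \<zeta> + G i \<zeta>) \<le> C * weight \<mu> \<zeta>"
    using weight_bound_add symbol_family_bound[OF Suc.prems(1)] symbol_family_bound[OF Suc.prems(2)] by blast
  then show ?case
    using Suc by (intro symbol_family_SucI[where F' = "\<lambda>v i \<zeta>. frechet_derivative (F i) (at \<zeta>) v + frechet_derivative (G i) (at \<zeta>) v"])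
      (auto intro!: has_derivative_add differentiableD)
qed

lemma symbol_family_scale:
  assumes "symbol_family \<rho> I k \<mu> F" "\<And>i. i \<in> I \<Longrightarrow> norm (c i) \<le> B"
  shows "symbol_family \<rho> I k \<mu> (\<lambda>i \<zeta>. c i * F i \<zeta>)"
  using assms(1)
proof (induction k arbitrary: F \<mu>)
  case (0 F \<mu>)
  show ?case unfolding symbol_family.simps(1)
    by (rule conjI[OF weight_bound_scale[OF symbol_family_bound[OF 0(1)] assms(2)]])
      (use 0 in \<open>auto intro!: continuous_on_mult continuous_on_const\<close>)
next
  case (Suc k)
  have "\<exists>C>0. \<forall>i\<in>I. \<forall>\<zeta>. norm (c i * F i \<zeta>) \<le> C * weight \<mu> \<zeta>"
    by (rule weight_bound_scale[OF symbol_family_bound[OF Suc.prems] assms(2)])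
  then show ?case
    using Suc by (intro symbol_family_SucI[where F' = "\<lambda>v i \<zeta>. c i * frechet_derivative (F i) (at \<zeta>) v"])
      (auto intro!: has_derivative_mult_right differentiableD)
qed

lemma symbol_family_mult:
  assumes "symbol_family \<rho> I k \<mu> F" "symbol_family \<rho> I k \<nu> G"
  shows "symbol_family \<rho> I k (\<mu> + \<nu>) (\<lambda>i \<zeta>. F i \<zeta> * G i \<zeta>)"
  using assms
proof (induction k arbitrary: F G \<mu> \<nu>)
  case (0 F G \<mu> \<nu>)
  show ?case unfolding symbol_family.simps(1)
    by (rule conjI[OF weight_bound_mult[OF symbol_family_bound[OF 0(1)] symbol_family_bound[OF 0(2)]]])
      (use 0 in \<open>auto intro!: continuous_on_mult\<close>)
next
  case (Suc k)
  have b: "\<exists>C>0. \<forall>i\<in>I. \<forall>\<zeta>. norm (F i \<zeta> * G i \<zeta>) \<le> C * weight (\<mu> + \<nu>) \<zeta>"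
    using weight_bound_mult[OF symbol_family_bound[OF Suc.prems(1)] symbol_family_bound[OF Suc.prems(2)]] .
  have k: "symbol_family \<rho> I k \<mu> F" "symbol_family \<rho> I k \<nu> G" using Suc.prems symbol_family_Suc_imp by blast+
  have "symbol_family \<rho> I k (\<mu> + (\<nu> - \<rho>)) (\<lambda>i \<zeta>. F i \<zeta> * frechet_derivative (G i) (at \<zeta>) v)"
    "symbol_family \<rho> I k (\<mu> - \<rho> + \<nu>) (\<lambda>i \<zeta>. frechet_derivative (F i) (at \<zeta>) v * G i \<zeta>)" for v
    using Suc.IH k Suc.prems by simp_all
  then have "symbol_family \<rho> I k (\<mu> + \<nu> - \<rho>) (\<lambda>i \<zeta>. F i \<zeta> * frechet_derivative (G i) (at \<zeta>) v
      + frechet_derivative (F i) (at \<zeta>) v * G i \<zeta>)" for v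
    by (intro symbol_family_add) (simp_all add: algebra_simps)
  with b show ?case
    using symbol_family_Suc_has_derivative[OF Suc.prems(1)] symbol_family_Suc_has_derivative[OF Suc.prems(2)]
    by (intro symbol_family_SucI[where F' = "\<lambda>v i \<zeta>. F i \<zeta> * frechet_derivative (G i) (at \<zeta>) v
      + frechet_derivative (F i) (at \<zeta>) v * G i \<zeta>"]) (auto intro!: has_derivative_mult)
qed

lemma symbol_family_zero: "symbol_family \<rho> I k \<mu> (\<lambda>i \<zeta>. 0)"
  by (induction k arbitrary: \<mu>) (auto intro!: exI[of _ 1] simp: weight_nonneg)

lemma symbol_family_const: "symbol_family \<rho> I k 0 (\<lambda>i \<zeta>. c)"
proof (cases k)
  case 0
  then show ?thesis by (auto simp: weight_zero intro!: exI[of _ "norm c + 1"] add_nonneg_pos)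
next
  case (Suc j)
  then show ?thesis
    by (auto simp: weight_zero symbol_family_zero intro!: exI[of _ "norm c + 1"] add_nonneg_pos)
qed

lemma symbol_family_inner:
  assumes "\<rho> \<le> 1"
  shows "symbol_family \<rho> I k 1 (\<lambda>i \<zeta>. complex_of_real (a \<bullet> \<zeta>))"
proof -
  have b: "\<exists>C>0. \<forall>i\<in>I. \<forall>\<zeta>. norm (complex_of_real (a \<bullet> \<zeta>)) \<le> C * weight 1 \<zeta>"
  proof (intro exI[of _ "norm a + 1"] conjI ballI allI)
    fix \<zeta>
    have "\<bar>a \<bullet> \<zeta>\<bar> \<le> norm a * norm \<zeta>" by (rule Cauchy_Schwarz_ineq2)
    also have "\<dots> \<le> (norm a + 1) * (1 + norm \<zeta>)" by (intro mult_mono) auto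
    finally show "norm (complex_of_real (a \<bullet> \<zeta>)) \<le> (norm a + 1) * weight 1 \<zeta>"
      using one_plus_norm_pos[of \<zeta>] by (simp add: weight_def)
  qed (simp add: add_nonneg_pos)
  show ?thesis
  proof (cases k)
    case 0
    then show ?thesis using b by (auto intro!: continuous_intros)
  next
    case (Suc j)
    show ?thesis unfolding Suc
      by (rule symbol_family_SucI[OF b, where F' = "\<lambda>v i \<zeta>. complex_of_real (a \<bullet> v)"])
        (use assms in \<open>auto intro!: derivative_eq_intros symbol_family_mono[OF symbol_family_const]\<close>)
  qed
qed

lemma symbol_family_power:
  assumes "symbol_family \<rho> I k \<mu> F"
  shows "symbol_family \<rho> I k (real L * \<mu>) (\<lambda>i \<zeta>. F i \<zeta> ^ L)"
proof (induction L)
  case 0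
  then show ?case using symbol_family_const[of \<rho> I k 1] by simp
next
  case (Suc L)
  then show ?case using symbol_family_mult[OF assms Suc] by (simp add: algebra_simps)
qed

text \<open>Induction from the end of the list, because the last direction is the innermost
  derivative and the one that \<open>symbol_family\<close> peels off.\<close>

lemma symbol_family_dir:
  assumes "symbol_family \<rho> I (length vs + k) \<mu> F"
  shows "symbol_family \<rho> I k (\<mu> - \<rho> * length vs) (\<lambda>i. dir_derivs vs (F i))"
  using assms
proof (induction vs arbitrary: F \<mu> rule: rev_induct)
  case (snoc v vs)
  then have "symbol_family \<rho> I (length vs + k) (\<mu> - \<rho>) (\<lambda>i \<zeta>. frechet_derivative (F i) (at \<zeta>) v)" by simp
  from snoc.IH[OF this] show ?case by (simp add: dir_derivs_append algebra_simps)
qed simp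

text \<open>Only \<open>length vs\<close> derivatives are at hand, so the rule for smooth functions
  does not apply; the family provides just enough differentiability.\<close>

lemma symbol_family_dir_scale:
  assumes "symbol_family \<rho> I (length vs) \<mu> F" "i \<in> I"
  shows "dir_derivs vs (\<lambda>\<zeta>. c * F i \<zeta>) = (\<lambda>\<zeta>. c * dir_derivs vs (F i) \<zeta>)"
  using assms(1)
proof (induction vs arbitrary: F \<mu> rule: rev_induct)
  case (snoc v vs)
  then have f: "symbol_family \<rho> I (length vs) (\<mu> - \<rho>) (\<lambda>i \<zeta>. frechet_derivative (F i) (at \<zeta>) v)"
    and "\<And>\<zeta>. F i differentiable (at \<zeta>)" using assms(2) by simp_all
  then have "frechet_derivative (\<lambda>\<zeta>. c * F i \<zeta>) (at \<zeta>) v = c * frechet_derivative (F i) (at \<zeta>) v" for \<zeta>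
    by (intro fun_cong[OF frechet_derivative_eqI] has_derivative_mult_right differentiableD)
  then show ?case using snoc.IH[OF f] by (simp add: dir_derivs_append)
qed simp

section \<open>Gaussians as symbols\<close>

definition gauss :: "real \<Rightarrow> 'e::euclidean_space \<Rightarrow> complex" where
  "gauss \<epsilon> \<zeta> = complex_of_real (exp (- \<epsilon> * (norm \<zeta>)\<^sup>2))"

lemma gauss_has_derivative:
  "(gauss \<epsilon> has_derivative (\<lambda>v. - 2 * complex_of_real \<epsilon> * (complex_of_real (v \<bullet> \<zeta>) * gauss \<epsilon> \<zeta>))) (at \<zeta>)"
  unfolding gauss_def[abs_def] power2_norm_eq_inner
  by (auto intro!: derivative_eq_intros simp: inner_commute algebra_simps)

lemma norm_gauss: "norm (gauss \<epsilon> \<zeta>) = exp (- \<epsilon> * (norm \<zeta>)\<^sup>2)"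
  by (simp add: gauss_def)

lemma gauss_power_bound:
  "\<exists>C>0. \<forall>\<epsilon>\<in>{0<..1}. \<forall>\<zeta>::'e::euclidean_space.
     norm (complex_of_real (\<epsilon> ^ l) * gauss \<epsilon> \<zeta>) \<le> C * weight (- 2 * real l) \<zeta>"
proof (intro exI[of _ "2 ^ l * real l ^ l"] conjI ballI allI)
  show "0 < (2::real) ^ l * real l ^ l" by (cases "l = 0") auto
  fix \<epsilon> :: real and \<zeta> :: 'e assume "\<epsilon> \<in> {0<..1}"
  then show "norm (complex_of_real (\<epsilon> ^ l) * gauss \<epsilon> \<zeta>) \<le> 2 ^ l * real l ^ l * weight (- 2 * real l) \<zeta>"
    using gaussian_weight_bound[of \<epsilon> "norm \<zeta>" l] by (simp add: norm_mult norm_gauss norm_power weight_def)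
qed

text \<open>A derivative of the member with exponent \<open>l\<close> is
  \<open>-2 * (v \<bullet> \<zeta>)\<close> times the member with exponent \<open>Suc l\<close>; its
  order \<open>1 - 2 * (l + 1)\<close> does not exceed \<open>- 2 * l - \<rho>\<close>, as
  \<open>\<rho> \<le> 1\<close>. Carrying the power of \<open>\<epsilon>\<close> through the
  induction is what keeps the constants uniform.\<close>

lemma symbol_family_gauss_power:
  assumes "\<rho> \<le> 1"
  shows "symbol_family \<rho> {0<..1} k (- 2 * real l) (\<lambda>\<epsilon> \<zeta>. complex_of_real (\<epsilon> ^ l) * gauss \<epsilon> \<zeta>)"
proof (induction k arbitrary: l)
  case (0 l)
  have c: "continuous_on UNIV (gauss \<epsilon> :: 'a \<Rightarrow> complex)" for \<epsilon>
    by (auto simp: continuous_on_eq_continuous_within intro: has_derivative_continuous gauss_has_derivative)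
  show ?case unfolding symbol_family.simps(1)
    by (rule conjI[OF gauss_power_bound]) (auto intro!: continuous_intros c)
next
  case (Suc k)
  have 1: "symbol_family \<rho> {0<..1} k (1 + - 2 * real (Suc l))
      (\<lambda>\<epsilon> \<zeta>. complex_of_real (v \<bullet> \<zeta>) * (complex_of_real (\<epsilon> ^ Suc l) * gauss \<epsilon> \<zeta>))" for v :: 'a
    by (rule symbol_family_mult[OF symbol_family_inner[OF assms] Suc.IH])
  have 2: "symbol_family \<rho> {0<..1} k (- 2 * real l - \<rho>)
      (\<lambda>\<epsilon> \<zeta>. (-2) * (complex_of_real (v \<bullet> \<zeta>) * (complex_of_real (\<epsilon> ^ Suc l) * gauss \<epsilon> \<zeta>)))" for v :: 'a
    by (rule symbol_family_mono[OF symbol_family_scale[OF 1, where B = 2]]) (use assms in auto)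
  show ?case
  proof (rule symbol_family_SucI[OF gauss_power_bound _ 2])
    fix \<epsilon> :: real and \<zeta> :: 'a
    show "((\<lambda>\<zeta>. complex_of_real (\<epsilon> ^ l) * gauss \<epsilon> \<zeta>) has_derivative
      (\<lambda>v. - 2 * (complex_of_real (v \<bullet> \<zeta>) * (complex_of_real (\<epsilon> ^ Suc l) * gauss \<epsilon> \<zeta>)))) (at \<zeta>)"
      using has_derivative_mult_right[OF gauss_has_derivative, of "complex_of_real (\<epsilon> ^ l)" \<epsilon> \<zeta>]
      by (rule has_derivative_eq_rhs) (simp add: fun_eq_iff mult_ac)
  qed
qed

lemma symbol_family_gauss_zero: "\<rho> \<le> 1 \<Longrightarrow> symbol_family \<rho> {0<..1} k 0 gauss"
  using symbol_family_gauss_power[of \<rho> k 0] by simp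

text \<open>The counterpart for a single \<open>\<epsilon>\<close>: the power of
  \<open>\<epsilon>\<close> is divided out again, so every order \<open>\<nu>\<close> is available,
  but not uniformly in \<open>\<epsilon>\<close>.\<close>

lemma symbol_family_gauss_single:
  assumes "\<rho> \<le> 1" "0 < \<epsilon>" "\<epsilon> \<le> 1"
  shows "symbol_family \<rho> I k \<nu> (\<lambda>i. gauss \<epsilon>)"
proof -
  define l where "l = nat \<lceil>\<bar>\<nu>\<bar>\<rceil>"
  have l: "- 2 * real l \<le> \<nu>" unfolding l_def by linarith
  have "symbol_family \<rho> I k (- 2 * real l) (\<lambda>i \<zeta>. complex_of_real (1 / \<epsilon> ^ l) * (complex_of_real (\<epsilon> ^ l) * gauss \<epsilon> \<zeta>))"
    using symbol_family_scale[OF symbol_family_reindex[OF symbol_family_gauss_power[OF assms(1), of k l], of I "\<lambda>_. \<epsilon>"], of "\<lambda>_. complex_of_real (1 / \<epsilon> ^ l)" "norm (complex_of_real (1 / \<epsilon> ^ l))"]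
      assms by simp
  then have "symbol_family \<rho> I k (- 2 * real l) (\<lambda>i \<zeta>. gauss \<epsilon> \<zeta>)" using assms by (simp add: mult.assoc[symmetric])
  then show ?thesis using symbol_family_mono[OF _ l] by blast
qed

lemma symbol_family_one_minus_gauss:
  assumes "\<rho> \<le> 1"
  shows "symbol_family \<rho> {0<..1} k 0 (\<lambda>\<epsilon> \<zeta>. 1 - gauss \<epsilon> \<zeta>)"
  using symbol_family_add[OF symbol_family_const[of _ _ _ 1] symbol_family_scale[OF symbol_family_gauss_zero[OF assms], where c = "\<lambda>_. -1" and B = 1]]
  by simp

text \<open>Since \<open>1 - exp (- t) \<le> t\<close>, division by \<open>\<epsilon>\<close> costs
  two orders but no uniformity, and in the derivatives the denominator cancels. This gives both the
  rate of convergence as \<open>\<epsilon>\<close> tends to 0 and the flatness of the cutoff at the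
  origin.\<close>

lemma symbol_family_one_minus_gauss_quotient:
  assumes "\<rho> \<le> 1"
  shows "symbol_family \<rho> {0<..1} k 2 (\<lambda>\<epsilon> \<zeta>. (1 - gauss \<epsilon> \<zeta>) / complex_of_real \<epsilon>)"
proof -
  have b: "\<exists>C>0. \<forall>\<epsilon>\<in>{0<..1}. \<forall>\<zeta>::'a. norm ((1 - gauss \<epsilon> \<zeta>) / complex_of_real \<epsilon>) \<le> C * weight 2 \<zeta>"
  proof (intro exI[of _ 1] conjI ballI allI)
    fix \<epsilon> :: real and \<zeta> :: 'a assume e: "\<epsilon> \<in> {0<..1}"
    have "norm (1 - gauss \<epsilon> \<zeta>) = \<bar>1 - exp (- \<epsilon> * (norm \<zeta>)\<^sup>2)\<bar>"
      unfolding gauss_def by (metis norm_of_real of_real_1 of_real_diff)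
    also have "\<dots> \<le> \<epsilon> * (norm \<zeta>)\<^sup>2" using exp_ge_add_one_self[of "- \<epsilon> * (norm \<zeta>)\<^sup>2"] e by simp
    also have "\<dots> \<le> \<epsilon> * (1 + norm \<zeta>)\<^sup>2" using e by (intro mult_left_mono power_mono) auto
    also have "(1 + norm \<zeta>)\<^sup>2 = weight 2 \<zeta>" using one_plus_norm_pos[of \<zeta>] by (simp add: weight_def)
    finally show "norm ((1 - gauss \<epsilon> \<zeta>) / complex_of_real \<epsilon>) \<le> 1 * weight 2 \<zeta>"
      using e by (simp add: norm_divide field_simps)
  qed simp
  have der: "((\<lambda>\<zeta>. (1 - gauss \<epsilon> \<zeta>) / complex_of_real \<epsilon>) has_derivative
      (\<lambda>v. 2 * (complex_of_real (v \<bullet> \<zeta>) * gauss \<epsilon> \<zeta>))) (at \<zeta>)"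
    if "\<epsilon> \<in> {0<..1}" for \<epsilon> and \<zeta> :: 'a
    using that by (auto intro!: derivative_eq_intros gauss_has_derivative simp: field_simps)
  show ?thesis
  proof (cases k)
    case 0
    show ?thesis unfolding 0 symbol_family.simps(1)
      by (rule conjI[OF b]) (auto simp: continuous_on_eq_continuous_within intro: has_derivative_continuous der)
  next
    case (Suc j)
    have 1: "symbol_family \<rho> {0<..1} j (1 + 0) (\<lambda>\<epsilon> \<zeta>. complex_of_real (v \<bullet> \<zeta>) * gauss \<epsilon> \<zeta>)" for v :: 'a
      by (rule symbol_family_mult[OF symbol_family_inner[OF assms] symbol_family_gauss_zero[OF assms]])
    show ?thesis unfolding Suc
      by (rule symbol_family_SucI[OF b der]) (use assms in \<open>auto intro!: symbol_family_mono[OF symbol_family_scale[OF 1]]\<close>)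
  qed
qed

section \<open>Oscillatory integrals and integration by parts\<close>

definition wave :: "'e::euclidean_space \<Rightarrow> 'e \<Rightarrow> complex" where
  "wave u \<zeta> = exp (\<i> * complex_of_real (u \<bullet> \<zeta>))"

lemma norm_wave [simp]: "norm (wave u \<zeta>) = 1"
  by (simp add: wave_def)

lemma wave_has_derivative:
  "(wave u has_derivative (\<lambda>v. \<i> * complex_of_real (u \<bullet> v) * wave u \<zeta>)) (at \<zeta>)"
proof -
  have "((\<lambda>\<zeta>. \<i> * complex_of_real (u \<bullet> \<zeta>)) has_derivative (\<lambda>v. \<i> * complex_of_real (u \<bullet> v))) (at \<zeta>)"
    by (auto intro!: derivative_eq_intros)
  from diff_chain_at[OF this has_field_derivative_imp_has_derivative[OF DERIV_exp]] show ?thesis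
    by (simp add: wave_def[abs_def] o_def mult_ac)
qed

lemma continuous_on_wave: "continuous_on S (\<lambda>x. wave (f x) (g x))" if "continuous_on S f" "continuous_on S g"
  unfolding wave_def by (intro continuous_intros that)

lemma borel_measurable_wave [measurable]:
  "f \<in> borel_measurable M \<Longrightarrow> g \<in> borel_measurable M \<Longrightarrow> (\<lambda>x. wave (f x) (g x)) \<in> borel_measurable M"
  unfolding wave_def by measurable

lemma integrable_mult_wave:
  fixes F :: "'e::euclidean_space \<Rightarrow> complex"
  assumes "integrable lborel F" shows "integrable lborel (\<lambda>\<zeta>. F \<zeta> * wave u \<zeta>)"
proof -
  have [measurable]: "F \<in> borel_measurable borel" using assms by auto
  show ?thesis by (rule Bochner_Integration.integrable_bound[OF assms]) (auto simp: norm_mult)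
qed

definition osc :: "('e::euclidean_space \<Rightarrow> complex) \<Rightarrow> 'e \<Rightarrow> complex" where
  "osc F u = (LINT \<zeta>|lborel. F \<zeta> * wave u \<zeta>)"

lemma norm_osc_le: "norm (osc F u) \<le> (LINT \<zeta>|lborel. norm (F \<zeta>))"
  unfolding osc_def by (rule order_trans[OF integral_norm_bound]) (simp add: norm_mult)

lemma osc_add:
  "integrable lborel F \<Longrightarrow> integrable lborel G \<Longrightarrow> osc (\<lambda>\<zeta>. F \<zeta> + G \<zeta>) u = osc F u + osc G u"
  unfolding osc_def distrib_right by (intro Bochner_Integration.integral_add integrable_mult_wave)

text \<open>The integral of the derivative along the segment from \<open>\<zeta>\<close> to
  \<open>\<zeta> + b\<close> is \<open>F (\<zeta> + b) - F \<zeta>\<close>. Integrating over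
  \<open>\<zeta>\<close> and exchanging the integrals gives the claim by translation invariance,
  without boundary terms.\<close>

lemma integral_directional_derivative_zero:
  fixes F :: "'e::euclidean_space \<Rightarrow> complex"
  assumes "\<And>\<zeta>. (F has_derivative F' \<zeta>) (at \<zeta>)" "continuous_on UNIV (\<lambda>\<zeta>. F' \<zeta> b)"
    and "integrable lborel F" "integrable lborel (\<lambda>\<zeta>. F' \<zeta> b)"
  shows "(LINT \<zeta>|lborel. F' \<zeta> b) = 0"
proof -
  let ?G = "\<lambda>\<zeta>. F' \<zeta> b"
  let ?H = "\<lambda>s \<zeta>. indicator {0..1::real} s *\<^sub>R ?G (\<zeta> + s *\<^sub>R b)"
  have [measurable]: "?G \<in> borel_measurable borel" using assms(4) by auto
  have ftc: "(LINT s|lborel. ?H s \<zeta>) = F (\<zeta> + b) - F \<zeta>" for \<zeta>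
  proof -
    have "((\<lambda>s. F (\<zeta> + s *\<^sub>R b)) has_vector_derivative ?G (\<zeta> + s *\<^sub>R b)) (at s within {0..1})" for s
    proof -
      have l: "linear (F' y)" for y using assms(1) has_derivative_linear by blast
      have "((\<lambda>s. \<zeta> + s *\<^sub>R b) has_derivative (\<lambda>t. t *\<^sub>R b)) (at s)" by (auto intro!: derivative_eq_intros)
      from diff_chain_at[OF this assms(1)] show ?thesis
        by - (rule has_vector_derivative_at_within, simp add: has_vector_derivative_def o_def linear_scale[OF l])
    qed
    moreover have "continuous_on {0..1} (\<lambda>s. ?G (\<zeta> + s *\<^sub>R b))"
      by (intro continuous_on_compose2[OF assms(2)] continuous_intros) auto
    ultimately have "has_bochner_integral lborel (\<lambda>s. ?H s \<zeta>) (F (\<zeta> + 1 *\<^sub>R b) - F (\<zeta> + 0 *\<^sub>R b))"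
      by (intro has_bochner_integral_FTC_Icc) auto
    then show ?thesis by (auto dest: has_bochner_integral_integral_eq)
  qed
  have iG: "integrable lborel (\<lambda>\<zeta>. ?G (\<zeta> + t))" for t using integrable_translate[OF assms(4)] .
  have "integrable (lborel \<Otimes>\<^sub>M lborel) (case_prod ?H)"
  proof (rule lborel_pair.Fubini_integrable)
    show "integrable lborel (\<lambda>s. LINT \<zeta>|lborel. norm (case_prod ?H (s, \<zeta>)))"
    proof -
      have e: "(LINT \<zeta>|lborel. norm (case_prod ?H (s, \<zeta>))) = indicator {0..1} s * (LINT \<zeta>|lborel. norm (?G \<zeta>))" for s
        using integral_translate[of "\<lambda>\<zeta>. norm (?G \<zeta>)" "s *\<^sub>R b"] by simp
      show ?thesis unfolding e by (intro integrable_mult_left integrable_real_indicator) auto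
    qed
    show "AE s in lborel. integrable lborel (\<lambda>\<zeta>. case_prod ?H (s, \<zeta>))"
      using iG by (intro AE_I2) (auto intro: integrable_scaleR_right)
    show "case_prod ?H \<in> borel_measurable (lborel \<Otimes>\<^sub>M lborel)"
      by measurable
  qed
  then have "(LINT \<zeta>|lborel. LINT s|lborel. ?H s \<zeta>) = (LINT s|lborel. LINT \<zeta>|lborel. ?H s \<zeta>)"
    by (rule lborel_pair.Fubini_integral)
  also have "\<dots> = (LINT s|lborel. indicator {0..1::real} s *\<^sub>R (LINT \<zeta>|lborel. ?G \<zeta>))"
    by (simp only: integral_scaleR_right integral_translate[of ?G])
  also have "\<dots> = (LINT \<zeta>|lborel. ?G \<zeta>)" by (subst integral_scaleR_left) auto
  finally have "(LINT \<zeta>|lborel. ?G \<zeta>) = (LINT \<zeta>|lborel. F (\<zeta> + b) - F \<zeta>)" by (simp add: ftc)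
  also have "\<dots> = 0"
    by (subst Bochner_Integration.integral_diff)
      (auto simp: integral_translate intro: integrable_translate assms(3))
  finally show ?thesis .
qed

text \<open>The product of \<open>F\<close> with the wave has a directional derivative of integral
  zero, and the product rule splits this integral into the two sides.\<close>

lemma osc_derivative:
  fixes F :: "'e::euclidean_space \<Rightarrow> complex"
  assumes "\<And>\<zeta>. (F has_derivative F' \<zeta>) (at \<zeta>)" "continuous_on UNIV (\<lambda>\<zeta>. F' \<zeta> b)"
    and "integrable lborel F" "integrable lborel (\<lambda>\<zeta>. F' \<zeta> b)"
  shows "osc (\<lambda>\<zeta>. F' \<zeta> b) u = - \<i> * complex_of_real (u \<bullet> b) * osc F u"
proof -
  let ?P = "\<lambda>\<zeta> v. F \<zeta> * (\<i> * complex_of_real (u \<bullet> v) * wave u \<zeta>) + F' \<zeta> v * wave u \<zeta>"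
  have cF: "continuous_on UNIV F"
    using assms(1) by (auto simp: continuous_on_eq_continuous_within intro: has_derivative_continuous)
  have i1: "integrable lborel (\<lambda>\<zeta>. \<i> * complex_of_real (u \<bullet> b) * (F \<zeta> * wave u \<zeta>))"
    by (intro integrable_mult_right integrable_mult_wave assms)
  have i2: "integrable lborel (\<lambda>\<zeta>. F' \<zeta> b * wave u \<zeta>)" by (intro integrable_mult_wave assms)
  have eq: "?P \<zeta> b = \<i> * complex_of_real (u \<bullet> b) * (F \<zeta> * wave u \<zeta>) + F' \<zeta> b * wave u \<zeta>" for \<zeta>
    by (simp add: mult_ac)
  have "(LINT \<zeta>|lborel. ?P \<zeta> b) = 0"
  proof (rule integral_directional_derivative_zero[where F = "\<lambda>\<zeta>. F \<zeta> * wave u \<zeta>" and F' = ?P])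
    show "((\<lambda>\<zeta>. F \<zeta> * wave u \<zeta>) has_derivative ?P \<zeta>) (at \<zeta>)" for \<zeta>
      by (rule has_derivative_mult[OF assms(1) wave_has_derivative])
    show "continuous_on UNIV (\<lambda>\<zeta>. ?P \<zeta> b)"
      by (intro continuous_intros cF assms(2) continuous_on_wave)
    show "integrable lborel (\<lambda>\<zeta>. F \<zeta> * wave u \<zeta>)" by (intro integrable_mult_wave assms)
    show "integrable lborel (\<lambda>\<zeta>. ?P \<zeta> b)" unfolding eq by (intro Bochner_Integration.integrable_add i1 i2)
  qed
  then have "\<i> * complex_of_real (u \<bullet> b) * osc F u + osc (\<lambda>\<zeta>. F' \<zeta> b) u = 0"
    unfolding eq using Bochner_Integration.integral_add[OF i1 i2] by (simp add: osc_def)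
  then show ?thesis by (simp add: add_eq_0_iff)
qed

lemma symbol_family_integrable:
  assumes "symbol_family \<rho> I k \<nu> F" "\<nu> < - real DIM('e::euclidean_space)" "i \<in> I"
  shows "integrable lborel (F i :: 'e \<Rightarrow> complex)"
proof -
  obtain C where C: "C > 0" "\<And>\<zeta>. norm (F i \<zeta>) \<le> C * weight \<nu> \<zeta>"
    using symbol_family_bound[OF assms(1)] assms(3) by blast
  have "integrable lborel (\<lambda>\<zeta>::'e. C * weight \<nu> \<zeta>)" using integrable_weight[OF assms(2)] by simp
  then show ?thesis
  proof (rule Bochner_Integration.integrable_bound)
    show "F i \<in> borel_measurable lborel"
      using borel_measurable_continuous_onI[OF symbol_family_continuous[OF assms(1,3)]] by simp
    show "AE \<zeta> in lborel. norm (F i \<zeta>) \<le> norm (C * weight \<nu> \<zeta>)"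
      using C by (auto intro!: AE_I2 order_trans[OF C(2)] abs_ge_self)
  qed
qed

lemma symbol_family_integral_bound:
  assumes "symbol_family \<rho> I k \<nu> F" "\<nu> < - real DIM('e::euclidean_space)"
  shows "\<exists>C>0. \<forall>i\<in>I. (LINT \<zeta>|lborel. norm (F i (\<zeta>::'e))) \<le> C"
proof -
  obtain C where C: "C > 0" "\<And>i \<zeta>. i \<in> I \<Longrightarrow> norm (F i \<zeta>) \<le> C * weight \<nu> \<zeta>"
    using symbol_family_bound[OF assms(1)] by blast
  let ?J = "LINT \<zeta>::'e|lborel. C * weight \<nu> \<zeta>"
  have "(LINT \<zeta>|lborel. norm (F i (\<zeta>::'e))) \<le> ?J" if "i \<in> I" for i
    by (intro integral_mono integrable_norm symbol_family_integrable[OF assms that] C(2) that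
        integrable_mult_right integrable_weight assms)
  moreover have "?J \<ge> 0" using C by (intro integral_nonneg_AE AE_I2) (auto simp: weight_nonneg)
  ultimately have "?J + 1 > 0" "\<And>i. i \<in> I \<Longrightarrow> (LINT \<zeta>|lborel. norm (F i (\<zeta>::'e))) \<le> ?J + 1"
    by (smt (verit))+
  then show ?thesis by blast
qed

text \<open>The integrable order \<open>\<nu>\<close> justifies each step, while the estimate itself
  refers to the integral of the last derivative only. Its uniform control is left to the
  caller.\<close>

lemma osc_integration_by_parts:
  assumes "symbol_family \<rho> I N \<nu> F" "\<nu> < - real DIM('e::euclidean_space)" "0 \<le> \<rho>" "i \<in> I"
  shows "\<bar>u \<bullet> b\<bar> ^ N * norm (osc (F i) u) \<le> (LINT \<zeta>|lborel. norm (dir_derivs (replicate N b) (F i) (\<zeta>::'e)))"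
  using assms(1,2)
proof (induction N arbitrary: F \<nu>)
  case 0
  then show ?case using norm_osc_le[of "F i" u] by simp
next
  case (Suc N)
  let ?G = "\<lambda>i \<zeta>. frechet_derivative (F i) (at \<zeta>) b"
  have G: "symbol_family \<rho> I N (\<nu> - \<rho>) ?G" using Suc.prems by simp
  have n: "\<nu> - \<rho> < - real DIM('e)" using Suc.prems assms(3) by simp
  have "osc (?G i) u = - \<i> * complex_of_real (u \<bullet> b) * osc (F i) u"
    by (rule osc_derivative) (use symbol_family_Suc_has_derivative[OF Suc.prems(1) assms(4)] symbol_family_continuous[OF G assms(4)]
        symbol_family_integrable[OF G n assms(4)] symbol_family_integrable[OF Suc.prems assms(4)] in auto)
  then have "\<bar>u \<bullet> b\<bar> * norm (osc (F i) u) = norm (osc (?G i) u)" by (simp add: norm_mult)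
  then have "\<bar>u \<bullet> b\<bar> ^ Suc N * norm (osc (F i) u) = \<bar>u \<bullet> b\<bar> ^ N * norm (osc (?G i) u)"
    by (simp only: power_Suc2 mult.assoc)
  also have "\<dots> \<le> (LINT \<zeta>|lborel. norm (dir_derivs (replicate N b) (?G i) \<zeta>))"
    by (rule Suc.IH[OF G n])
  also have "dir_derivs (replicate N b) (?G i) = dir_derivs (replicate (Suc N) b) (F i)"
    using dir_derivs_append[of "replicate N b" "[b]" "F i"] by (simp only: replicate_append_same) simp
  finally show ?case .
qed

text \<open>Two orders are in play: \<open>\<mu>\<close> has uniform constants and may become
  integrable only after \<open>N\<close> derivatives; \<open>\<nu>\<close> belongs to a single
  index, has no uniform constant and only makes the integrals converge.\<close>

lemma osc_decay:
  assumes "symbol_family \<rho> I N \<mu> F" "\<mu> - \<rho> * N < - real DIM('e::euclidean_space)" "0 \<le> \<rho>"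
    and "\<And>i. i \<in> I \<Longrightarrow> \<exists>\<nu> < - real DIM('e). symbol_family \<rho> {i} N \<nu> F"
  shows "\<exists>C>0. \<forall>i\<in>I. \<forall>u. \<bar>u \<bullet> (b::'e)\<bar> ^ N * norm (osc (F i) u) \<le> C"
proof -
  have "symbol_family \<rho> I 0 (\<mu> - \<rho> * N) (\<lambda>i. dir_derivs (replicate N b) (F i))"
    using symbol_family_dir[of \<rho> I "replicate N b" 0 \<mu> F] assms(1) by simp
  then obtain C where C: "C > 0" "\<And>i. i \<in> I \<Longrightarrow> (LINT \<zeta>|lborel. norm (dir_derivs (replicate N b) (F i) \<zeta>)) \<le> C"
    using symbol_family_integral_bound[OF _ assms(2)] by blast
  have "\<bar>u \<bullet> b\<bar> ^ N * norm (osc (F i) u) \<le> C" if i: "i \<in> I" for i u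
  proof -
    obtain \<nu> where "\<nu> < - real DIM('e)" "symbol_family \<rho> {i} N \<nu> F" using assms(4)[OF i] by blast
    from osc_integration_by_parts[OF this(2,1) assms(3), of i u b] C(2)[OF i] show ?thesis by simp
  qed
  with C(1) show ?thesis by blast
qed

lemma one_minus_power_le:
  fixes g :: real assumes "0 \<le> g" "g \<le> 1" shows "1 - (1 - g) ^ L \<le> real L * g"
  using Bernoulli_inequality[of "- g" L] assms by simp

text \<open>Frequencies below \<open>R = |u \<bullet> b| powr (-1/\<rho>)\<close> are estimated by their mass, those above
  by integration by parts. The smooth cutoff is \<open>s = (1 - exp (-|\<zeta>|\<^sup>2/R\<^sup>2))\<^sup>L\<close>; its vanishing to order
  \<open>2 L\<close> at the origin makes up for its lack of compactly supported derivatives.\<close>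

lemma osc_sharp_bound:
  assumes \<rho>: "0 < \<rho>" "\<rho> \<le> 1"
    and F: "\<And>k. symbol_family \<rho> I k \<mu> F"
    and reg: "\<And>i k. i \<in> I \<Longrightarrow> \<exists>\<nu> < - real DIM('e::euclidean_space). symbol_family \<rho> {i} k \<nu> F"
  shows "\<exists>C>0. \<forall>i\<in>I. \<forall>u R. 1 \<le> R \<longrightarrow> \<bar>u \<bullet> (b::'e)\<bar> = R powr (- \<rho>) \<longrightarrow>
     norm (osc (F i) u) \<le> C * (ball_mass TYPE('e) \<mu> R + R powr (\<mu> + real DIM('e)))"
proof -
  \<comment> \<open>Large enough for the order after \<open>N\<close> integrations by parts to be
    both integrable and negative.\<close>
  define N where "N = nat \<lceil>(\<bar>\<mu>\<bar> + real DIM('e) + 1) / \<rho>\<rceil>"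
  define \<nu> where "\<nu> = \<mu> - \<rho> * N"
  have "(\<bar>\<mu>\<bar> + real DIM('e) + 1) / \<rho> \<le> real N" unfolding N_def by linarith
  then have "\<bar>\<mu>\<bar> + real DIM('e) + 1 \<le> \<rho> * N" using \<rho> by (simp add: field_simps)
  then have \<nu>: "\<nu> < - real DIM('e)" "\<nu> < 0" using DIM_positive[where 'a = 'e] unfolding \<nu>_def by linarith+
  define L where "L = nat \<lceil>\<bar>\<nu>\<bar>\<rceil>"
  have L: "\<nu> + 2 * real L \<ge> 0" unfolding L_def by linarith
  \<comment> \<open>The high-frequency part, with the parameter of the cutoff as a second index, so
    that the constants are found before this parameter is tied to \<open>R\<close>.\<close>
  define H where "H = (\<lambda>j \<zeta>. F (fst j) \<zeta> * (1 - gauss (snd j) \<zeta>) ^ L)"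
  let ?J = "I \<times> {0<..1::real}"
  have F1: "symbol_family \<rho> ?J N \<mu> (\<lambda>j. F (fst j))" by (rule symbol_family_reindex[OF F]) auto
  have s0: "symbol_family \<rho> ?J N (real L * 0) (\<lambda>j \<zeta>. (1 - gauss (snd j) \<zeta>) ^ L)"
    by (rule symbol_family_power[OF symbol_family_reindex[OF symbol_family_one_minus_gauss[OF \<rho>(2)]]]) auto
  have s2: "symbol_family \<rho> ?J N (real L * 2) (\<lambda>j \<zeta>. ((1 - gauss (snd j) \<zeta>) / complex_of_real (snd j)) ^ L)"
    by (rule symbol_family_power[OF symbol_family_reindex[OF symbol_family_one_minus_gauss_quotient[OF \<rho>(2)]]]) auto
  have H0: "symbol_family \<rho> ?J N \<mu> H"
    using symbol_family_mult[OF F1 s0] by (simp add: H_def case_prod_beta)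
  \<comment> \<open>Dividing by the \<open>L\<close>-th power of the cutoff parameter exhibits the
    flatness at the origin: the quotient still has a uniform order, now
    \<open>\<mu> + 2 * real L\<close>.\<close>
  have H2: "symbol_family \<rho> ?J N (\<mu> + 2 * real L) (\<lambda>j \<zeta>. (1 / complex_of_real (snd j ^ L)) * H j \<zeta>)"
    using symbol_family_mult[OF F1 s2] by (simp add: H_def case_prod_beta power_divide mult.commute)
  let ?D = "\<lambda>j. dir_derivs (replicate N b) (H j)"
  have "symbol_family \<rho> ?J 0 \<nu> ?D" using symbol_family_dir[of \<rho> ?J "replicate N b" 0 \<mu> H] H0 by (simp add: \<nu>_def)
  then obtain C0 where C0: "C0 > 0" "\<And>j \<zeta>. j \<in> ?J \<Longrightarrow> norm (?D j \<zeta>) \<le> C0 * weight \<nu> \<zeta>"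
    using symbol_family_bound[of \<rho> ?J 0 \<nu> ?D] by blast
  have D2: "symbol_family \<rho> ?J 0 (\<nu> + 2 * real L) (\<lambda>j. dir_derivs (replicate N b) (\<lambda>\<zeta>. (1 / complex_of_real (snd j ^ L)) * H j \<zeta>))"
    using symbol_family_dir[of \<rho> ?J "replicate N b" 0 _ "\<lambda>j \<zeta>. (1 / complex_of_real (snd j ^ L)) * H j \<zeta>"] H2
    by (simp add: \<nu>_def algebra_simps)
  have Dc: "dir_derivs (replicate N b) (\<lambda>\<zeta>. (1 / complex_of_real (snd j ^ L)) * H j \<zeta>)
      = (\<lambda>\<zeta>. (1 / complex_of_real (snd j ^ L)) * ?D j \<zeta>)" if "j \<in> ?J" for j
    by (rule symbol_family_dir_scale[of \<rho> ?J "replicate N b" \<mu> H j]) (use H0 that in simp_all)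
  have "symbol_family \<rho> ?J 0 (\<nu> + 2 * real L) (\<lambda>j \<zeta>. (1 / complex_of_real (snd j ^ L)) * ?D j \<zeta>)"
    by (rule iffD1[OF symbol_family_cong D2]) (rule Dc)
  then obtain C2 where C2: "C2 > 0"
    "\<And>j \<zeta>. j \<in> ?J \<Longrightarrow> norm ((1 / complex_of_real (snd j ^ L)) * ?D j \<zeta>) \<le> C2 * weight (\<nu> + 2 * real L) \<zeta>"
    using symbol_family_bound by blast
  define A where "A = max C0 C2"
  have A: "A > 0" using C0 by (simp add: A_def)
  define B where "B = A * 4 ^ L * 2 powr (- \<nu>)"
  have B: "B > 0" using A by (simp add: B_def)
  define W where "W = (LINT \<zeta>::'e|lborel. weight \<nu> \<zeta>)"
  have W: "W \<ge> 0" unfolding W_def by (intro integral_nonneg_AE AE_I2 weight_nonneg)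
  obtain C1 where C1: "C1 > 0" "\<And>i \<zeta>. i \<in> I \<Longrightarrow> norm (F i \<zeta>) \<le> C1 * weight \<mu> \<zeta>"
    using symbol_family_bound[OF F[of 0]] by blast
  obtain C3 where C3: "C3 > 0"
    "\<And>R. R \<ge> 1 \<Longrightarrow> integrable lborel (\<lambda>\<zeta>::'e. weight \<mu> \<zeta> * exp (- (norm \<zeta>)\<^sup>2 / R\<^sup>2))"
    "\<And>R. R \<ge> 1 \<Longrightarrow> (LINT \<zeta>::'e|lborel. weight \<mu> \<zeta> * exp (- (norm \<zeta>)\<^sup>2 / R\<^sup>2)) \<le>
       ball_mass TYPE('e) \<mu> R + C3 * R powr (\<mu> + real DIM('e))"
    using gaussian_weight_integral[OF \<nu>(1), of \<mu>] by blast
  define C where "C = C1 * real L * (1 + C3) + B * W + 1"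
  have "norm (osc (F i) u) \<le> C * (ball_mass TYPE('e) \<mu> R + R powr (\<mu> + real DIM('e)))"
    if i: "i \<in> I" and R: "1 \<le> R" and u: "\<bar>u \<bullet> b\<bar> = R powr (- \<rho>)" for i u R
  proof -
    \<comment> \<open>The Gaussian inside the cutoff then has width \<open>R\<close>.\<close>
    define \<epsilon> where "\<epsilon> = 1 / R\<^sup>2"
    have \<epsilon>: "0 < \<epsilon>" "\<epsilon> \<le> 1" using R by (auto simp: \<epsilon>_def)
    have j: "(i, \<epsilon>) \<in> ?J" using i \<epsilon> by simp
    obtain \<nu>' where \<nu>': "\<nu>' < - real DIM('e)" "symbol_family \<rho> {i} N \<nu>' F" using reg[OF i] by blast
    have "symbol_family \<rho> {(i, \<epsilon>)} N (real L * 0) (\<lambda>j \<zeta>. (1 - gauss (snd j) \<zeta>) ^ L)"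
      using s0 by (rule symbol_family_reindex[where g = "\<lambda>j. j"]) (use j in auto)
    moreover have "symbol_family \<rho> {(i, \<epsilon>)} N \<nu>' (\<lambda>j. F (fst j))" using \<nu>'(2) by (rule symbol_family_reindex) auto
    ultimately have Hj: "symbol_family \<rho> {(i, \<epsilon>)} N \<nu>' H"
      using symbol_family_mult[of \<rho> "{(i, \<epsilon>)}" N \<nu>' "\<lambda>j. F (fst j)"] by (fastforce simp: H_def case_prod_beta)
    have iF: "integrable lborel (F i)" by (rule symbol_family_integrable[OF \<nu>'(2,1)]) simp
    have iH: "integrable lborel (H (i, \<epsilon>))" by (rule symbol_family_integrable[OF Hj \<nu>'(1)]) simp
    let ?g = "\<lambda>\<zeta>::'e. exp (- (norm \<zeta>)\<^sup>2 / R\<^sup>2)"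
    have low: "norm (F i \<zeta> - H (i, \<epsilon>) \<zeta>) \<le> C1 * real L * (weight \<mu> \<zeta> * ?g \<zeta>)" for \<zeta>
    proof -
      have g: "gauss \<epsilon> \<zeta> = complex_of_real (?g \<zeta>)" by (simp add: gauss_def \<epsilon>_def)
      have "F i \<zeta> - H (i, \<epsilon>) \<zeta> = F i \<zeta> * complex_of_real (1 - (1 - ?g \<zeta>) ^ L)"
        by (simp add: H_def g algebra_simps)
      also have "norm \<dots> = norm (F i \<zeta>) * \<bar>1 - (1 - ?g \<zeta>) ^ L\<bar>" by (simp only: norm_mult norm_of_real)
      also have "\<dots> \<le> (C1 * weight \<mu> \<zeta>) * (real L * ?g \<zeta>)"
      proof (intro mult_mono C1 i)
        have "0 \<le> 1 - ?g \<zeta>" "1 - ?g \<zeta> \<le> 1" by auto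
        then have "(1 - ?g \<zeta>) ^ L \<le> 1" by (simp add: power_le_one)
        then show "\<bar>1 - (1 - ?g \<zeta>) ^ L\<bar> \<le> real L * ?g \<zeta>"
          using one_minus_power_le[of "?g \<zeta>" L] by simp
      qed (use C1(1) in \<open>auto simp: weight_nonneg\<close>)
      finally show ?thesis by (simp add: mult_ac)
    qed
    have "norm (osc (\<lambda>\<zeta>. F i \<zeta> - H (i, \<epsilon>) \<zeta>) u) \<le> (LINT \<zeta>|lborel. norm (F i \<zeta> - H (i, \<epsilon>) \<zeta>))"
      by (rule norm_osc_le)
    also have "\<dots> \<le> (LINT \<zeta>|lborel. C1 * real L * (weight \<mu> \<zeta> * ?g \<zeta>))"
      by (intro integral_mono low integrable_norm Bochner_Integration.integrable_diff iF iH integrable_mult_right C3 R)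
    also have "\<dots> = C1 * real L * (LINT \<zeta>|lborel. weight \<mu> \<zeta> * ?g \<zeta>)" by simp
    also have "\<dots> \<le> C1 * real L * (ball_mass TYPE('e) \<mu> R + C3 * R powr (\<mu> + real DIM('e)))"
      using C1 C3(3)[OF R] by (intro mult_left_mono) auto
    finally have lo: "norm (osc (\<lambda>\<zeta>. F i \<zeta> - H (i, \<epsilon>) \<zeta>) u) \<le>
      C1 * real L * (ball_mass TYPE('e) \<mu> R + C3 * R powr (\<mu> + real DIM('e)))" .
    have pt: "norm (?D (i, \<epsilon>) \<zeta>) \<le> B * R powr \<nu> * weight \<nu> (\<zeta> /\<^sub>R R)" for \<zeta>
      unfolding B_def
    proof (rule high_frequency_pointwise[OF \<nu>(2) L R])
      show "norm (?D (i, \<epsilon>) \<zeta>) \<le> A * weight \<nu> \<zeta>"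
        by (rule order_trans[OF C0(2)[OF j]]) (intro mult_right_mono weight_nonneg, simp add: A_def)
      have "norm (?D (i, \<epsilon>) \<zeta>) = \<epsilon> ^ L * norm ((1 / complex_of_real (snd (i, \<epsilon>) ^ L)) * ?D (i, \<epsilon>) \<zeta>)"
        using \<epsilon> by (simp add: norm_mult norm_divide norm_power)
      also have "\<dots> \<le> \<epsilon> ^ L * (A * weight (\<nu> + 2 * real L) \<zeta>)"
        using \<epsilon> by (intro mult_left_mono order_trans[OF C2(2)[OF j]] mult_right_mono weight_nonneg) (auto simp: A_def)
      finally show "norm (?D (i, \<epsilon>) \<zeta>) \<le> A * (1 / R\<^sup>2) ^ L * weight (\<nu> + 2 * real L) \<zeta>"
        by (simp add: \<epsilon>_def mult_ac)
    qed simp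
    have R0: "R > 0" using R by simp
    have "symbol_family \<rho> {(i, \<epsilon>)} 0 (\<nu>' - \<rho> * N) ?D"
      using symbol_family_dir[of \<rho> "{(i, \<epsilon>)}" "replicate N b" 0 \<nu>' H] Hj by simp
    moreover have "\<nu>' - \<rho> * N < - real DIM('e)" using \<nu>'(1) \<rho> by (smt (verit) mult_nonneg_nonneg of_nat_0_le_iff)
    ultimately have iD: "integrable lborel (?D (i, \<epsilon>))" by (rule symbol_family_integrable) simp
    have "\<bar>u \<bullet> b\<bar> ^ N * norm (osc (H (i, \<epsilon>)) u) \<le> (LINT \<zeta>|lborel. norm (?D (i, \<epsilon>) \<zeta>))"
      by (rule osc_integration_by_parts[OF Hj \<nu>'(1)]) (use \<rho> in auto)
    also have "\<dots> \<le> (LINT \<zeta>::'e|lborel. B * R powr \<nu> * weight \<nu> (\<zeta> /\<^sub>R R))"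
      by (intro integral_mono integrable_norm iD pt integrable_mult_right integral_weight_scale(1)[OF R0 \<nu>(1)])
    also have "\<dots> = B * R powr \<nu> * (R powr real DIM('e) * W)"
      using integral_weight_scale(2)[OF R0 \<nu>(1)] by (simp add: W_def)
    finally have "\<bar>u \<bullet> b\<bar> ^ N * norm (osc (H (i, \<epsilon>)) u) \<le> B * R powr \<nu> * (R powr real DIM('e) * W)" .
    \<comment> \<open>Here the relation between \<open>u\<close> and \<open>R\<close> enters:
      dividing by \<open>N\<close> factors \<open>R powr (- \<rho>)\<close> turns the exponent
      \<open>\<nu>\<close> back into \<open>\<mu>\<close>.\<close>
    moreover have "\<bar>u \<bullet> b\<bar> ^ N = R powr (- (\<rho> * N))"
      using R0 unfolding u by (simp add: powr_realpow[symmetric] powr_powr)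
    ultimately have "R powr (\<rho> * N) * (R powr (- (\<rho> * N)) * norm (osc (H (i, \<epsilon>)) u)) \<le>
        R powr (\<rho> * N) * (B * R powr \<nu> * (R powr real DIM('e) * W))"
      by (intro mult_left_mono) auto
    also have "\<dots> = B * W * (R powr (\<rho> * N) * (R powr \<nu> * R powr real DIM('e)))" by simp
    also have "R powr (\<rho> * N) * (R powr \<nu> * R powr real DIM('e)) = R powr (\<mu> + real DIM('e))"
      by (simp add: powr_add[symmetric] \<nu>_def)
    also have "R powr (\<rho> * N) * (R powr (- (\<rho> * N)) * norm (osc (H (i, \<epsilon>)) u)) = norm (osc (H (i, \<epsilon>)) u)"
      using R0 by (simp add: mult.assoc[symmetric] powr_add[symmetric])
    finally have hi: "norm (osc (H (i, \<epsilon>)) u) \<le> B * W * R powr (\<mu> + real DIM('e))" .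
    have "osc (F i) u = osc (\<lambda>\<zeta>. F i \<zeta> - H (i, \<epsilon>) \<zeta>) u + osc (H (i, \<epsilon>)) u"
      using osc_add[OF Bochner_Integration.integrable_diff[OF iF iH] iH, of u] by simp
    then have "norm (osc (F i) u) \<le> C1 * real L * (ball_mass TYPE('e) \<mu> R + C3 * R powr (\<mu> + real DIM('e)))
        + B * W * R powr (\<mu> + real DIM('e))"
      using norm_triangle_le[OF add_mono[OF lo hi]] by simp
    also have "\<dots> \<le> C * (ball_mass TYPE('e) \<mu> R + R powr (\<mu> + real DIM('e)))"
    proof -
      have m: "0 \<le> ball_mass TYPE('e) \<mu> R" unfolding ball_mass_def
        by (intro integral_nonneg_AE AE_I2) (auto simp: weight_nonneg)
      define P where "P = R powr (\<mu> + real DIM('e))"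
      define M where "M = ball_mass TYPE('e) \<mu> R"
      define K where "K = C1 * real L"
      have p: "P \<ge> 0" "M \<ge> 0" "K \<ge> 0" using C1 m by (auto simp: P_def M_def K_def)
      have "(K * (1 + C3) + B * W + 1) * (M + P) = K * (M + C3 * P) + B * W * P + (K * P + K * C3 * M + B * W * M + M + P)"
        by (simp add: algebra_simps)
      moreover have "K * P + K * C3 * M + B * W * M + M + P \<ge> 0"
        using p C3(1) B W by (intro add_nonneg_nonneg mult_nonneg_nonneg) auto
      ultimately show ?thesis unfolding C_def P_def[symmetric] M_def[symmetric] K_def[symmetric] by simp
    qed
    finally show ?thesis .
  qed
  moreover have "C > 0" unfolding C_def using C1 C3(1) B W
    by (intro add_nonneg_pos add_nonneg_nonneg mult_nonneg_nonneg) auto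
  ultimately show ?thesis by blast
qed

section \<open>Regularized kernels\<close>

lemma linear_norm_bound:
  fixes f :: "'a::euclidean_space \<Rightarrow> 'b::real_normed_vector"
  assumes "linear f"
  shows "norm (f v) \<le> norm v * (\<Sum>b\<in>Basis. norm (f b))"
proof -
  have "f v = f (\<Sum>b\<in>Basis. (v \<bullet> b) *\<^sub>R b)" by (simp add: euclidean_representation)
  also have "\<dots> = (\<Sum>b\<in>Basis. (v \<bullet> b) *\<^sub>R f b)"
    by (simp add: linear_sum[OF assms] linear_scale[OF assms])
  also have "norm \<dots> \<le> (\<Sum>b\<in>Basis. norm ((v \<bullet> b) *\<^sub>R f b))" by (rule norm_sum)
  also have "\<dots> \<le> (\<Sum>b\<in>Basis. norm v * norm (f b))"
    by (intro sum_mono) (auto intro!: mult_right_mono Basis_le_norm)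
  finally show ?thesis by (simp add: sum_distrib_left)
qed

text \<open>On a ball the mean value inequality bounds the remainder, divided by the norm of the
  increment, by \<open>2 * g t\<close>, so dominated convergence applies. That theorem is
  sequential, hence the passage to sequences tending to 0.\<close>

lemma has_derivative_integral:
  fixes f :: "'p::euclidean_space \<Rightarrow> 'c \<Rightarrow> complex"
  assumes "r > 0"
    and der: "\<And>P t. P \<in> ball P0 r \<Longrightarrow> ((\<lambda>P. f P t) has_derivative f' P t) (at P)"
    and bd: "\<And>P t v. P \<in> ball P0 r \<Longrightarrow> norm (f' P t v) \<le> g t * norm v"
    and g: "integrable M g"
    and int: "\<And>P. P \<in> ball P0 r \<Longrightarrow> integrable M (f P)"
    and meas: "\<And>v. (\<lambda>t. f' P0 t v) \<in> borel_measurable M"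
  shows "((\<lambda>P. LINT t|M. f P t) has_derivative (\<lambda>v. LINT t|M. f' P0 t v)) (at P0)"
proof -
  let ?F = "\<lambda>P. LINT t|M. f P t" and ?D = "\<lambda>v. LINT t|M. f' P0 t v"
  have P0: "P0 \<in> ball P0 r" using \<open>r > 0\<close> by simp
  have lin: "linear (f' P0 t)" for t using der[OF P0] has_derivative_linear by blast
  have g0: "g t \<ge> 0" for t
  proof -
    obtain b :: 'p where "b \<in> Basis" using nonempty_Basis by blast
    then show ?thesis using order_trans[OF norm_ge_zero bd[OF P0, of t b]] by simp
  qed
  have i': "integrable M (\<lambda>t. f' P0 t v)" for v
    by (rule Bochner_Integration.integrable_bound[of _ "\<lambda>t. g t * norm v"])
      (use g bd[OF P0] meas g0 in \<open>auto intro!: AE_I2 simp: abs_mult\<close>)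
  have bl: "bounded_linear ?D"
  proof (rule bounded_linear_intro[where K = "LINT t|M. g t"])
    show "?D (v + w) = ?D v + ?D w" for v w
      by (simp add: linear_add[OF lin] Bochner_Integration.integral_add i')
    show "?D (c *\<^sub>R v) = c *\<^sub>R ?D v" for c v
      by (simp add: linear_scale[OF lin])
    show "norm (?D v) \<le> norm v * (LINT t|M. g t)" for v
    proof -
      have "norm (?D v) \<le> (LINT t|M. norm (f' P0 t v))" by (rule integral_norm_bound)
      also have "\<dots> \<le> (LINT t|M. g t * norm v)"
        by (intro integral_mono integrable_norm i' bd P0 integrable_mult_left g)
      finally show ?thesis by (simp add: mult.commute)
    qed
  qed
  have "((\<lambda>h. norm (?F (P0 + h) - ?F P0 - ?D h) / norm h) \<longlongrightarrow> 0) (at 0 within ball 0 r)"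
    unfolding tendsto_at_iff_sequentially
  proof (intro allI impI)
    fix X :: "nat \<Rightarrow> 'p" assume X: "\<forall>i. X i \<in> ball 0 r - {0}" "X \<longlonglongrightarrow> 0"
    have Xb: "P0 + X n \<in> ball P0 r" "X n \<noteq> 0" for n using X(1) by (auto simp: dist_norm)
    let ?q = "\<lambda>n t. (f (P0 + X n) t - f P0 t - f' P0 t (X n)) /\<^sub>R norm (X n)"
    have iq: "integrable M (?q n)" for n
      by (intro integrable_scaleR_right Bochner_Integration.integrable_diff int Xb P0 i')
    have pt: "(\<lambda>n. ?q n t) \<longlonglongrightarrow> 0" for t
    proof -
      have "((\<lambda>h. norm (f (P0 + h) t - f P0 t - f' P0 t h) / norm h) \<longlongrightarrow> 0) (at 0)"
        using der[OF P0] unfolding has_derivative_at by blast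
      then have "(\<lambda>n. norm (f (P0 + X n) t - f P0 t - f' P0 t (X n)) / norm (X n)) \<longlonglongrightarrow> 0"
        unfolding tendsto_at_iff_sequentially comp_def using X by auto
      then show ?thesis by - (rule tendsto_norm_zero_cancel, simp add: divide_inverse mult.commute)
    qed
    have dom: "norm (?q n t) \<le> 2 * g t" for n t
    proof -
      have "norm (f (P0 + X n) t - f P0 t) \<le> g t * norm ((P0 + X n) - P0)"
      proof (rule differentiable_bound[OF convex_ball, where f' = "\<lambda>P. f' P t"])
        fix P assume P: "P \<in> ball P0 r"
        show "((\<lambda>P. f P t) has_derivative f' P t) (at P within ball P0 r)"
          using der[OF P] by (rule has_derivative_at_withinI)
        show "onorm (f' P t) \<le> g t" using bd[OF P, of t] by (intro onorm_le) 
      qed (use Xb P0 in auto)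
      moreover have "norm (f' P0 t (X n)) \<le> g t * norm (X n)" by (rule bd[OF P0])
      ultimately have "norm (f (P0 + X n) t - f P0 t - f' P0 t (X n)) \<le> 2 * g t * norm (X n)"
        using norm_triangle_ineq4[of "f (P0 + X n) t - f P0 t" "f' P0 t (X n)"] by simp
      then have "norm (f (P0 + X n) t - f P0 t - f' P0 t (X n)) / norm (X n) \<le> 2 * g t"
        using Xb(2)[of n] by (simp add: pos_divide_le_eq)
      then show ?thesis by (simp add: divide_inverse mult.commute)
    qed
    have "(\<lambda>n. LINT t|M. ?q n t) \<longlonglongrightarrow> (LINT t|M. 0)"
      by (rule integral_dominated_convergence[where w = "\<lambda>t. 2 * g t"])
        (use g pt dom iq in auto)
    then have "(\<lambda>n. norm (LINT t|M. ?q n t)) \<longlonglongrightarrow> 0" using tendsto_norm_zero by fastforce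
    moreover have "norm (LINT t|M. ?q n t) = norm (?F (P0 + X n) - ?F P0 - ?D (X n)) / norm (X n)" for n
      using Bochner_Integration.integral_diff[OF Bochner_Integration.integrable_diff[OF int[OF Xb(1)[of n]] int[OF P0]] i'[of "X n"]]
        Bochner_Integration.integral_diff[OF int[OF Xb(1)[of n]] int[OF P0]]
      by (simp add: divide_inverse mult.commute)
    ultimately show "((\<lambda>h. norm (?F (P0 + h) - ?F P0 - ?D h) / norm h) \<circ> X) \<longlonglongrightarrow> 0"
      by (simp add: comp_def)
  qed
  then have "((\<lambda>h. norm (?F (P0 + h) - ?F P0 - ?D h) / norm h) \<longlongrightarrow> 0) (at 0)"
    using at_within_open[of "0::'p" "ball 0 r"] \<open>r > 0\<close> by simp
  then show ?thesis using bl by (simp add: has_derivative_at)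
qed

section \<open>Symbols and their regularized kernels\<close>

definition phase :: "'a::euclidean_space \<times> 'a \<times> 'a \<Rightarrow> 'a \<times> 'a" where
  "phase P = (fst P - fst (snd P), fst P - snd (snd P))"

lemma bounded_linear_phase: "bounded_linear phase"
  unfolding phase_def[abs_def]
  by (intro bounded_linear_Pair bounded_linear_sub bounded_linear_fst
      bounded_linear_fst_comp bounded_linear_snd_comp bounded_linear_snd)

lemma continuous_on_phase: "continuous_on S phase"
  by (rule linear_continuous_on[OF bounded_linear_phase])

text \<open>Derivatives in \<open>x\<close> may raise the order by \<open>1\<close> instead of \<open>\<delta>\<close>: this is no more than what
  they contribute when they hit the exponential.\<close>

definition symbol :: "real \<Rightarrow> real \<Rightarrow> ('a::euclidean_space \<times> 'a \<times> 'a \<Rightarrow> complex) \<Rightarrow> bool" where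
  "symbol \<rho> \<mu> q \<longleftrightarrow> Cinf_on UNIV q \<and>
     (\<forall>as k. symbol_family \<rho> UNIV k (\<mu> + real (length as)) (\<lambda>x \<zeta>. dir_derivs (map (\<lambda>a. (a, 0)) as) q (x, \<zeta>)))"

lemma symbol_Cinf: "symbol \<rho> \<mu> q \<Longrightarrow> Cinf_on UNIV q"
  by (simp add: symbol_def)

lemma symbol_fam_derivs:
  "symbol \<rho> \<mu> q \<Longrightarrow> symbol_family \<rho> UNIV k (\<mu> + real (length as)) (\<lambda>x \<zeta>. dir_derivs (map (\<lambda>a. (a, 0)) as) q (x, \<zeta>))"
  unfolding symbol_def by blast

lemma symbolI:
  "Cinf_on UNIV q \<Longrightarrow>
    (\<And>as k. symbol_family \<rho> UNIV k (\<mu> + real (length as)) (\<lambda>x \<zeta>. dir_derivs (map (\<lambda>a. (a, 0)) as) q (x, \<zeta>))) \<Longrightarrow>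
    symbol \<rho> \<mu> q"
  unfolding symbol_def by blast

lemma symbol_fam: "symbol \<rho> \<mu> q \<Longrightarrow> symbol_family \<rho> UNIV k \<mu> (\<lambda>x \<zeta>. q (x, \<zeta>))"
  using symbol_fam_derivs[of \<rho> \<mu> q k "[]"] by simp

lemma symbol_x_derivative:
  assumes "symbol \<rho> \<mu> q"
  shows "symbol \<rho> (\<mu> + 1) (\<lambda>p. frechet_derivative q (at p) (a, 0))"
proof -
  have "symbol_family \<rho> UNIV k (\<mu> + real (length (as @ [a]))) (\<lambda>x \<zeta>. dir_derivs (map (\<lambda>a. (a, 0)) (as @ [a])) q (x, \<zeta>))" for as k
    using assms unfolding symbol_def by blast
  then have "symbol_family \<rho> UNIV k (\<mu> + 1 + real (length as))
      (\<lambda>x \<zeta>. dir_derivs (map (\<lambda>a. (a, 0)) as) (\<lambda>p. frechet_derivative q (at p) (a, 0)) (x, \<zeta>))" for as k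
    by (simp add: dir_derivs_append add_ac)
  with assms show ?thesis unfolding symbol_def by (blast intro: Cinf_on_deriv)
qed

lemma symbol_add:
  assumes "symbol \<rho> \<mu> p" "symbol \<rho> \<mu> q"
  shows "symbol \<rho> \<mu> (\<lambda>w. p w + q w)"
  by (rule symbolI)
    (use assms in \<open>auto simp: dir_derivs_add symbol_Cinf intro!: Cinf_on_add symbol_family_add symbol_fam_derivs\<close>)

lemma symbol_scale:
  assumes "symbol \<rho> \<mu> q"
  shows "symbol \<rho> \<mu> (\<lambda>w. c * q w)"
  by (rule symbolI)
    (use assms in \<open>auto simp: dir_derivs_cmult symbol_Cinf
        intro!: Cinf_on_mult Cinf_on_const symbol_family_scale[where B = "norm c"] symbol_fam_derivs\<close>)

lemma symbol_mult_inner: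
  assumes "symbol \<rho> \<mu> q" "\<rho> \<le> 1"
  shows "symbol \<rho> (\<mu> + 1) (\<lambda>w. complex_of_real (l \<bullet> snd w) * q w)"
proof -
  have bl: "bounded_linear (\<lambda>w::'a \<times> 'a \<times> 'a. complex_of_real (l \<bullet> snd w))"
    by (intro bounded_linear_compose[OF bounded_linear_of_real] bounded_linear_inner_right_comp bounded_linear_snd)
  have d: "dir_derivs (map (\<lambda>a. (a, 0)) as) (\<lambda>w. complex_of_real (l \<bullet> snd w) * q w)
    = (\<lambda>w. complex_of_real (l \<bullet> snd w) * dir_derivs (map (\<lambda>a. (a, 0)) as) q w)" for as
  proof (induction as)
    case (Cons a as)
    let ?g = "dir_derivs (map (\<lambda>a. (a, 0)) as) q"
    have "((\<lambda>w. complex_of_real (l \<bullet> snd w) * ?g w) has_derivative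
        (\<lambda>v. complex_of_real (l \<bullet> snd w) * frechet_derivative ?g (at w) v + complex_of_real (l \<bullet> snd v) * ?g w)) (at w)" for w
      by (rule has_derivative_mult[OF bounded_linear_imp_has_derivative[OF bl]
            Cinf_on_has_derivative[OF Cinf_dir_derivs[OF symbol_Cinf[OF assms(1)]] UNIV_I]])
    from frechet_derivative_eqI[OF this] show ?case by (simp add: Cons)
  qed simp
  have "symbol_family \<rho> UNIV k (1 + (\<mu> + real (length as))) (\<lambda>x \<zeta>. complex_of_real (l \<bullet> \<zeta>) *
      dir_derivs (map (\<lambda>a. (a, 0)) as) q (x, \<zeta>))" for as k
    by (intro symbol_family_mult symbol_family_inner assms symbol_fam_derivs)
  then have "symbol_family \<rho> UNIV k (\<mu> + 1 + real (length as)) (\<lambda>x \<zeta>. complex_of_real (l \<bullet> \<zeta>) *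
      dir_derivs (map (\<lambda>a. (a, 0)) as) q (x, \<zeta>))" for as k
    by (simp add: add_ac)
  then show ?thesis
    by (intro symbolI) (simp_all add: d Cinf_on_mult[OF Cinf_on_bounded_linear[OF bl] symbol_Cinf[OF assms(1)]])
qed

text \<open>The amplitude of the derivative, in direction \<open>v\<close>, of
  \<open>q (fst P, \<zeta>) * wave (phase P) \<zeta>\<close>: the first term differentiates the
  symbol in \<open>x\<close>, the second comes from the wave, as \<open>phase\<close> is
  linear.\<close>

definition deriv_symbol :: "'a::euclidean_space \<times> 'a \<times> 'a \<Rightarrow> ('a \<times> 'a \<times> 'a \<Rightarrow> complex) \<Rightarrow> 'a \<times> 'a \<times> 'a \<Rightarrow> complex" where
  "deriv_symbol v q w = frechet_derivative q (at w) (fst v, 0) + \<i> * (complex_of_real (phase v \<bullet> snd w) * q w)"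

lemma symbol_deriv_symbol:
  "symbol \<rho> \<mu> q \<Longrightarrow> \<rho> \<le> 1 \<Longrightarrow> symbol \<rho> (\<mu> + 1) (deriv_symbol v q)"
  unfolding deriv_symbol_def[abs_def]
  by (intro symbol_add symbol_x_derivative symbol_scale symbol_mult_inner)

lemma linear_deriv_symbol:
  assumes "Cinf_on UNIV q" shows "linear (\<lambda>v. deriv_symbol v q w)"
proof -
  have l: "linear (frechet_derivative q (at w))"
    using Cinf_on_has_derivative[OF assms UNIV_I] has_derivative_linear by blast
  have p: "linear (phase :: 'a \<times> 'a \<times> 'a \<Rightarrow> _)" using bounded_linear_phase bounded_linear.linear by blast
  show ?thesis
  proof (rule linearI)
    fix u v :: "'a \<times> 'a \<times> 'a" and c :: real
    have e: "(fst (u + v), 0) = (fst u, 0 :: 'a \<times> 'a) + (fst v, 0)" "(fst (c *\<^sub>R u), 0) = c *\<^sub>R (fst u, 0 :: 'a \<times> 'a)"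
      for u v :: "'a \<times> 'a \<times> 'a" by auto
    show "deriv_symbol (u + v) q w = deriv_symbol u q w + deriv_symbol v q w"
      unfolding deriv_symbol_def e(1) linear_add[OF l] linear_add[OF p] by (simp add: inner_add_left algebra_simps)
    show "deriv_symbol (c *\<^sub>R u) q w = c *\<^sub>R deriv_symbol u q w"
      unfolding deriv_symbol_def e(2) linear_scale[OF l] linear_scale[OF p] by (simp add: scaleR_conv_of_real algebra_simps)
  qed
qed

text \<open>A sequence rather than a real parameter, because the limit theorems are applied along
  sequences; its values stay where the Gaussian estimates are uniform.\<close>

definition eps :: "nat \<Rightarrow> real" where "eps j = 1 / (1 + real j)"

lemma eps_bounds: "0 < eps j" "eps j \<le> 1"
  by (auto simp: eps_def)

definition kernel_seq :: "nat \<Rightarrow> ('a::euclidean_space \<times> 'a \<times> 'a \<Rightarrow> complex) \<Rightarrow> 'a \<times> 'a \<times> 'a \<Rightarrow> complex" where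
  "kernel_seq j q P = osc (\<lambda>\<zeta>. q (fst P, \<zeta>) * gauss (eps j) \<zeta>) (phase P)"

text \<open>The limit exists off the diagonal for every order, and everywhere if the symbol is integrable
  in \<open>\<zeta>\<close>, so that one definition serves all parts of the theorem.\<close>

definition symbol_kernel :: "('a::euclidean_space \<times> 'a \<times> 'a \<Rightarrow> complex) \<Rightarrow> 'a \<times> 'a \<times> 'a \<Rightarrow> complex" where
  "symbol_kernel q P = lim (\<lambda>j. kernel_seq j q P)"

text \<open>The index is the pair of \<open>j\<close> and \<open>x\<close>. This uniform estimate,
  of the same order as \<open>q\<close>, is the one that survives the limit.\<close>

lemma symbol_family_kernel_seq:
  assumes "symbol \<rho> \<mu> q" "\<rho> \<le> 1"
  shows "symbol_family \<rho> UNIV k \<mu> (\<lambda>i \<zeta>. q (snd i, \<zeta>) * gauss (eps (fst i)) \<zeta>)"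
proof -
  have 1: "symbol_family \<rho> UNIV k \<mu> (\<lambda>i \<zeta>. q (snd i, \<zeta>))" by (rule symbol_family_reindex[OF symbol_fam[OF assms(1)]]) auto
  have 2: "symbol_family \<rho> UNIV k 0 (\<lambda>i. gauss (eps (fst i)))"
    by (rule symbol_family_reindex[OF symbol_family_gauss_zero[OF assms(2)]]) (use eps_bounds in auto)
  show ?thesis using symbol_family_mult[OF 1 2] by simp
qed

text \<open>For fixed \<open>j\<close>, in contrast, every order \<open>\<nu>\<close> is attained;
  this provides the integrability of the single members.\<close>

lemma symbol_family_regularized:
  assumes "symbol \<rho> \<mu> q" "\<rho> \<le> 1"
  shows "symbol_family \<rho> I k \<nu> (\<lambda>i \<zeta>. q (x i, \<zeta>) * gauss (eps j) \<zeta>)"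
proof -
  have 1: "symbol_family \<rho> I k \<mu> (\<lambda>i \<zeta>. q (x i, \<zeta>))" by (rule symbol_family_reindex[OF symbol_fam[OF assms(1)]]) auto
  have 2: "symbol_family \<rho> I k (\<nu> - \<mu>) (\<lambda>i. gauss (eps j))"
    by (rule symbol_family_gauss_single[OF assms(2) eps_bounds])
  show ?thesis using symbol_family_mult[OF 1 2] by simp
qed

lemma integrable_regularized:
  assumes "symbol \<rho> \<mu> q" "\<rho> \<le> 1"
  shows "integrable lborel (\<lambda>\<zeta>. q (x, \<zeta>) * gauss (eps j) \<zeta>)"
  by (rule symbol_family_integrable[OF symbol_family_regularized[OF assms, of UNIV 0 "- real DIM('a \<times> 'a) - 1" "\<lambda>_. x" j], where i = "()"]) auto

text \<open>The Gaussian makes the differentiated amplitude integrable whatever its order. Linearity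
  in \<open>v\<close> leaves finitely many basis directions, whose constants are added up in the
  majorant.\<close>

lemma kernel_seq_has_derivative:
  assumes "symbol \<rho> \<mu> q" "\<rho> \<le> 1"
  shows "(kernel_seq j q has_derivative (\<lambda>v. kernel_seq j (deriv_symbol v q) P)) (at P)"
proof -
  let ?f = "\<lambda>P \<zeta>. q (fst P, \<zeta>) * gauss (eps j) \<zeta> * wave (phase P) \<zeta>"
  let ?f' = "\<lambda>P \<zeta> v. deriv_symbol v q (fst P, \<zeta>) * gauss (eps j) \<zeta> * wave (phase P) \<zeta>"
  let ?n = "- real DIM('a \<times> 'a) - 1"
  have sy: "symbol \<rho> (\<mu> + 1) (deriv_symbol v q)" for v by (rule symbol_deriv_symbol[OF assms])
  have "\<exists>C>0. \<forall>x \<zeta>. norm (deriv_symbol v q (x, \<zeta>) * gauss (eps j) \<zeta>) \<le> C * weight ?n \<zeta>" for v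
    using symbol_family_bound[OF symbol_family_regularized[OF sy assms(2), where I = UNIV and k = 0 and \<nu> = ?n and x = "\<lambda>x. x" and j = j]]
    by simp
  then obtain C where C: "\<And>v. C v > 0"
    "\<And>v x \<zeta>. norm (deriv_symbol v q (x, \<zeta>) * gauss (eps j) \<zeta>) \<le> C v * weight ?n \<zeta>" by metis
  define g where "g \<zeta> = (\<Sum>b\<in>Basis. C b) * weight ?n \<zeta>" for \<zeta> :: "'a \<times> 'a"
  have "((\<lambda>P. LINT \<zeta>|lborel. ?f P \<zeta>) has_derivative (\<lambda>v. LINT \<zeta>|lborel. ?f' P \<zeta> v)) (at P)"
  proof (rule has_derivative_integral[where r = 1 and g = g])
    fix P :: "'a \<times> 'a \<times> 'a" and \<zeta> :: "'a \<times> 'a"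
    have w: "((\<lambda>P. wave (phase P) \<zeta>) has_derivative (\<lambda>v. \<i> * complex_of_real (phase v \<bullet> \<zeta>) * wave (phase P) \<zeta>)) (at P)"
    proof -
      have "(\<lambda>P. wave (phase P) \<zeta>) = wave \<zeta> \<circ> phase" by (auto simp: wave_def inner_commute)
      moreover have "(wave \<zeta> \<circ> phase has_derivative (\<lambda>v. \<i> * complex_of_real (\<zeta> \<bullet> v) * wave \<zeta> (phase P)) \<circ> phase) (at P)"
        by (rule diff_chain_at[OF bounded_linear_imp_has_derivative[OF bounded_linear_phase] wave_has_derivative])
      ultimately show ?thesis by (simp add: o_def wave_def inner_commute)
    qed
    have "((\<lambda>P. (fst P, \<zeta>)) has_derivative (\<lambda>v. (fst v, 0))) (at P)" by (auto intro!: derivative_eq_intros)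
    from diff_chain_at[OF this Cinf_on_has_derivative[OF symbol_Cinf[OF assms(1)] UNIV_I]]
    have q: "((\<lambda>P. q (fst P, \<zeta>)) has_derivative (\<lambda>v. frechet_derivative q (at (fst P, \<zeta>)) (fst v, 0))) (at P)"
      by (simp add: o_def)
    show "((\<lambda>P. ?f P \<zeta>) has_derivative ?f' P \<zeta>) (at P)"
      by (rule has_derivative_eq_rhs[OF has_derivative_mult[OF has_derivative_mult_left[OF q] w]])
        (simp add: fun_eq_iff deriv_symbol_def algebra_simps)
    show "norm (?f' P \<zeta> v) \<le> g \<zeta> * norm v" for v
    proof -
      have "linear (?f' P \<zeta>)"
        using linear_deriv_symbol[OF symbol_Cinf[OF assms(1)]]
        by (auto simp: linear_iff algebra_simps)
      then have "norm (?f' P \<zeta> v) \<le> norm v * (\<Sum>b\<in>Basis. norm (?f' P \<zeta> b))" by (rule linear_norm_bound)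
      also have "\<dots> \<le> norm v * (\<Sum>b\<in>Basis. C b * weight ?n \<zeta>)"
        using C(2) by (intro mult_left_mono sum_mono) (auto simp: norm_mult)
      finally show ?thesis by (simp add: g_def sum_distrib_right mult.commute)
    qed
  next
    show "integrable lborel g" unfolding g_def by (intro integrable_mult_right integrable_weight) simp
    show "integrable lborel (?f P)" for P :: "'a \<times> 'a \<times> 'a"
      by (intro integrable_mult_wave integrable_regularized[OF assms])
    show "(\<lambda>\<zeta>. ?f' P \<zeta> v) \<in> borel_measurable lborel" for v
      by (rule borel_measurable_integrable, intro integrable_mult_wave integrable_regularized[OF sy assms(2)])
  qed simp
  then show ?thesis by (simp add: kernel_seq_def[abs_def] osc_def)
qed

text \<open>Integration by parts in direction \<open>b\<close> controls powers of the component
  \<open>u \<bullet> b\<close> only; a largest component recovers the norm up to the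
  dimension.\<close>

lemma large_component:
  fixes u :: "'e::euclidean_space"
  obtains b where "b \<in> Basis" "norm u \<le> real DIM('e) * \<bar>u \<bullet> b\<bar>" "\<bar>u \<bullet> b\<bar> \<le> norm u"
proof -
  let ?A = "(\<lambda>c. \<bar>u \<bullet> c\<bar>) ` (Basis :: 'e set)"
  have "Max ?A \<in> ?A" by (intro Max_in) auto
  then obtain b where bB: "Max ?A = \<bar>u \<bullet> b\<bar>" "b \<in> Basis" by (rule imageE)
  have "\<bar>u \<bullet> c\<bar> \<le> Max ?A" if "c \<in> Basis" for c using that by (intro Max_ge) auto
  with bB have b: "b \<in> Basis" "\<And>c. c \<in> Basis \<Longrightarrow> \<bar>u \<bullet> c\<bar> \<le> \<bar>u \<bullet> b\<bar>" by auto
  have "norm u \<le> (\<Sum>c\<in>Basis. \<bar>u \<bullet> c\<bar>)" by (rule norm_le_l1)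
  also have "\<dots> \<le> (\<Sum>c\<in>(Basis::'e set). \<bar>u \<bullet> b\<bar>)" by (intro sum_mono b)
  finally show ?thesis using b Basis_le_norm[OF b(1), of u] that by simp
qed

text \<open>Adds up constants that depend on the direction \<open>b\<close>. The predicate
  \<open>f\<close> leaves room for a side condition, and \<open>h\<close> for a bound that varies
  with the point.\<close>

lemma uniform_over_Basis:
  assumes "\<And>b::'e::euclidean_space. b \<in> Basis \<Longrightarrow> \<exists>C>0::real. \<forall>i\<in>I. \<forall>x. f b i x \<longrightarrow> g b i x \<le> C * h b i x"
    and "\<And>b i x. i \<in> I \<Longrightarrow> f b i x \<Longrightarrow> 0 \<le> h b i x"
  shows "\<exists>C>0. \<forall>b\<in>Basis. \<forall>i\<in>I. \<forall>x. f b i x \<longrightarrow> g b i x \<le> C * h b i x"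
proof -
  obtain C where C: "\<And>b. b \<in> Basis \<Longrightarrow> C b > 0"
    "\<And>b i x. b \<in> Basis \<Longrightarrow> i \<in> I \<Longrightarrow> f b i x \<Longrightarrow> g b i x \<le> C b * h b i x" using assms(1) by metis
  have "g b i x \<le> (\<Sum>b\<in>Basis. C b) * h b i x" if "b \<in> Basis" "i \<in> I" "f b i x" for b i x
  proof -
    have "C b \<le> (\<Sum>b\<in>Basis. C b)" using that C(1) by (intro member_le_sum) (auto intro: less_imp_le)
    then show ?thesis using C(2)[OF that] assms(2)[OF that(2,3)] by (meson mult_right_mono order_trans)
  qed
  moreover have "(\<Sum>b\<in>(Basis::'e set). C b) > 0" using C(1) by (intro sum_pos) auto
  ultimately show ?thesis by blast
qed

lemma osc_decay_norm:
  assumes "symbol_family \<rho> I N \<mu> F" "\<mu> - \<rho> * N < - real DIM('e::euclidean_space)" "0 \<le> \<rho>"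
    and "\<And>i. i \<in> I \<Longrightarrow> \<exists>\<nu> < - real DIM('e). symbol_family \<rho> {i} N \<nu> F"
  shows "\<exists>C>0. \<forall>i\<in>I. \<forall>u::'e. norm u ^ N * norm (osc (F i) u) \<le> C"
proof -
  have "\<exists>C>0. \<forall>b\<in>Basis. \<forall>i\<in>I. \<forall>u. True \<longrightarrow> \<bar>u \<bullet> (b::'e)\<bar> ^ N * norm (osc (F i) u) \<le> C * 1"
    using osc_decay[OF assms] by (intro uniform_over_Basis) simp_all
  then obtain C where C: "C > 0" "\<And>b i u. b \<in> Basis \<Longrightarrow> i \<in> I \<Longrightarrow> \<bar>u \<bullet> (b::'e)\<bar> ^ N * norm (osc (F i) u) \<le> C"
    by auto
  have "norm u ^ N * norm (osc (F i) u) \<le> real DIM('e) ^ N * C" if "i \<in> I" for i u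
  proof -
    obtain b where b: "b \<in> Basis" "norm u \<le> real DIM('e) * \<bar>u \<bullet> b\<bar>" by (rule large_component)
    have "norm u ^ N * norm (osc (F i) u) \<le> (real DIM('e) * \<bar>u \<bullet> b\<bar>) ^ N * norm (osc (F i) u)"
      using b by (intro mult_right_mono power_mono) auto
    also have "\<dots> = real DIM('e) ^ N * (\<bar>u \<bullet> b\<bar> ^ N * norm (osc (F i) u))" by (simp add: power_mult_distrib)
    also have "\<dots> \<le> real DIM('e) ^ N * C" using C(2)[OF b(1) that] by (intro mult_left_mono) auto
    finally show ?thesis .
  qed
  moreover have "real DIM('e) ^ N * C > 0" using C by simp
  ultimately show ?thesis by blast
qed

lemma kernel_seq_decay:
  assumes "symbol \<rho> \<mu> q" "0 \<le> \<rho>" "\<rho> \<le> 1" "\<mu> - \<rho> * N < - real DIM('a \<times> 'a)"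
  shows "\<exists>C>0. \<forall>j. \<forall>P::'a::euclidean_space \<times> 'a \<times> 'a. norm (phase P) ^ N * norm (kernel_seq j q P) \<le> C"
proof -
  have "\<exists>\<nu> < - real DIM('a \<times> 'a). symbol_family \<rho> {i} N \<nu> (\<lambda>i \<zeta>. q (snd i, \<zeta>) * gauss (eps (fst i)) \<zeta>)"
    for i :: "nat \<times> 'a"
    using symbol_family_regularized[OF assms(1,3), of "{i}" N "- real DIM('a \<times> 'a) - 1" snd "fst i"]
      symbol_family_cong[of "{i}" "\<lambda>k \<zeta>. q (snd k, \<zeta>) * gauss (eps (fst i)) \<zeta>" "\<lambda>k \<zeta>. q (snd k, \<zeta>) * gauss (eps (fst k)) \<zeta>"]
    by (intro exI[of _ "- real DIM('a \<times> 'a) - 1"]) auto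
  from osc_decay_norm[OF symbol_family_kernel_seq[OF assms(1,3)] assms(4,2) this]
  obtain C where C: "C > 0" "\<And>i u. norm u ^ N * norm (osc (\<lambda>\<zeta>. q (snd i, \<zeta>) * gauss (eps (fst i)) \<zeta>) u) \<le> C"
    by auto
  show ?thesis using C(1) C(2)[of "phase P" "(j, fst P)" for j P] by (auto simp: kernel_seq_def)
qed

text \<open>The difference of two Gaussians, divided by \<open>eps j + eps l\<close>, is a
  combination of the quotients \<open>(1 - gauss \<epsilon> \<zeta>) / \<epsilon>\<close> with
  coefficients of modulus at most 1, hence uniformly of order 2. Two orders are given away in return
  for a rate of convergence.\<close>

lemma kernel_seq_difference:
  assumes "symbol \<rho> \<mu> q" "0 \<le> \<rho>" "\<rho> \<le> 1" "\<mu> + 2 - \<rho> * N < - real DIM('a \<times> 'a)"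
  shows "\<exists>C>0. \<forall>j l. \<forall>P::'a::euclidean_space \<times> 'a \<times> 'a.
    norm (phase P) ^ N * norm (kernel_seq j q P - kernel_seq l q P) \<le> C * (eps j + eps l)"
proof -
  let ?c = "\<lambda>j l. complex_of_real (eps j / (eps j + eps l))"
  let ?Q = "\<lambda>j (\<zeta>::'a \<times> 'a). (1 - gauss (eps j) \<zeta>) / complex_of_real (eps j)"
  define F where "F = (\<lambda>(i::nat \<times> nat \<times> 'a) \<zeta>. q (snd (snd i), \<zeta>) * (?c (fst (snd i)) (fst i) * ?Q (fst (snd i)) \<zeta>
      + - ?c (fst i) (fst (snd i)) * ?Q (fst i) \<zeta>))"
  have F_eq: "F (j, l, x) \<zeta> = complex_of_real (1 / (eps j + eps l)) * (q (x, \<zeta>) * gauss (eps j) \<zeta> - q (x, \<zeta>) * gauss (eps l) \<zeta>)"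
    for j l x \<zeta>
  proof -
    have "?c l j * ?Q l \<zeta> = complex_of_real (1 / (eps j + eps l)) * (1 - gauss (eps l) \<zeta>)"
      "?c j l * ?Q j \<zeta> = complex_of_real (1 / (eps j + eps l)) * (1 - gauss (eps j) \<zeta>)" 
      using eps_bounds[of j] eps_bounds[of l] by (auto simp: add.commute)
    then have "F (j, l, x) \<zeta> = q (x, \<zeta>) * (complex_of_real (1 / (eps j + eps l)) * (1 - gauss (eps l) \<zeta>)
        - complex_of_real (1 / (eps j + eps l)) * (1 - gauss (eps j) \<zeta>))"
      unfolding F_def by (simp only: fst_conv snd_conv mult_minus_left) simp
    then show ?thesis by (simp only: right_diff_distrib) (simp add: algebra_simps del: of_real_divide of_real_add)
  qed
  have Q: "symbol_family \<rho> UNIV N 2 (\<lambda>i. ?Q (h i))" for h :: "nat \<times> nat \<times> 'a \<Rightarrow> nat"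
    by (rule symbol_family_reindex[OF symbol_family_one_minus_gauss_quotient[OF assms(3)]]) (use eps_bounds in auto)
  have c1: "norm (?c j l) \<le> 1" for j l
  proof -
    have "eps j > 0" "eps l > 0" using eps_bounds by auto
    then show ?thesis by (simp add: norm_divide del: of_real_divide of_real_add)
  qed
  have "symbol_family \<rho> UNIV N 2 (\<lambda>(i::nat \<times> nat \<times> 'a) \<zeta>. ?c (fst (snd i)) (fst i) * ?Q (fst (snd i)) \<zeta>
      + - ?c (fst i) (fst (snd i)) * ?Q (fst i) \<zeta>)"
  proof (rule symbol_family_add)
    show "symbol_family \<rho> UNIV N 2 (\<lambda>(i::nat \<times> nat \<times> 'a) \<zeta>. ?c (fst (snd i)) (fst i) * ?Q (fst (snd i)) \<zeta>)"
      by (rule symbol_family_scale[OF Q[of "\<lambda>i. fst (snd i)"], where B = 1 and c = "\<lambda>i. ?c (fst (snd i)) (fst i)"]) (rule c1)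
    show "symbol_family \<rho> UNIV N 2 (\<lambda>(i::nat \<times> nat \<times> 'a) \<zeta>. - ?c (fst i) (fst (snd i)) * ?Q (fst i) \<zeta>)"
      by (rule symbol_family_scale[OF Q[of "\<lambda>i. fst i"], where B = 1 and c = "\<lambda>i. - ?c (fst i) (fst (snd i))"])
        (unfold norm_minus_cancel, rule c1)
  qed
  moreover have "symbol_family \<rho> UNIV N \<mu> (\<lambda>i::nat \<times> nat \<times> 'a. \<lambda>\<zeta>. q (snd (snd i), \<zeta>))"
    by (rule symbol_family_reindex[OF symbol_fam[OF assms(1)]]) auto
  ultimately have F: "symbol_family \<rho> UNIV N (\<mu> + 2) F" unfolding F_def using symbol_family_mult by blast
  have "\<exists>\<nu> < - real DIM('a \<times> 'a). symbol_family \<rho> {i} N \<nu> F" for i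
  proof (intro exI[of _ "- real DIM('a \<times> 'a) - 1"] conjI)
    obtain j l x where i: "i = (j, l, x)" by (metis prod_cases3)
    let ?n = "- real DIM('a \<times> 'a) - 1"
    let ?B = "norm (complex_of_real (1 / (eps j + eps l)))"
    have "symbol_family \<rho> {i} N ?n (\<lambda>i \<zeta>. complex_of_real (1 / (eps j + eps l)) *
        (q (x, \<zeta>) * gauss (eps j) \<zeta> + (-1) * (q (x, \<zeta>) * gauss (eps l) \<zeta>)))"
      by (intro symbol_family_scale[where B = ?B] symbol_family_add symbol_family_scale[where B = 1 and c = "\<lambda>_. -1"]
          symbol_family_regularized[OF assms(1,3)]) auto
    then show "symbol_family \<rho> {i} N ?n F" by (rule iffD1[OF symbol_family_cong, rotated]) (auto simp: i F_eq)
  qed simp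
  from osc_decay_norm[OF F assms(4,2) this]
  obtain C where C: "C > 0" "\<And>i u. norm u ^ N * norm (osc (F i) u) \<le> C" by auto
  have "norm (phase P) ^ N * norm (kernel_seq j q P - kernel_seq l q P) \<le> C * (eps j + eps l)" for j l P
  proof -
    have e: "eps j + eps l > 0" using eps_bounds[of j] eps_bounds[of l] by simp
    let ?g = "\<lambda>j \<zeta>. q (fst P, \<zeta>) * gauss (eps j) \<zeta>"
    have i: "integrable lborel (?g j)" for j by (rule integrable_regularized[OF assms(1,3)])
    have "osc (F (j, l, fst P)) u = complex_of_real (1 / (eps j + eps l)) * (osc (?g j) u - osc (?g l) u)" for u
    proof -
      have "osc (F (j, l, fst P)) u = (LINT \<zeta>|lborel. complex_of_real (1 / (eps j + eps l)) * (?g j \<zeta> * wave u \<zeta> - ?g l \<zeta> * wave u \<zeta>))"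
        unfolding osc_def F_eq by (simp add: algebra_simps)
      also have "\<dots> = complex_of_real (1 / (eps j + eps l)) * (osc (?g j) u - osc (?g l) u)"
        unfolding osc_def integral_mult_right_zero
        by (subst Bochner_Integration.integral_diff) (auto intro: integrable_mult_wave i)
      finally show ?thesis .
    qed
    then have "norm (osc (F (j, l, fst P)) (phase P)) = norm (kernel_seq j q P - kernel_seq l q P) / (eps j + eps l)"
      using e by (simp add: kernel_seq_def norm_mult norm_divide del: of_real_divide of_real_add)
    then have "norm (kernel_seq j q P - kernel_seq l q P) = norm (osc (F (j, l, fst P)) (phase P)) * (eps j + eps l)"
      using e by simp
    then show ?thesis using mult_right_mono[OF C(2)[of "phase P" "(j, l, fst P)"], of "eps j + eps l"] e
      by (simp add: mult.assoc)
  qed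
  with C(1) show ?thesis by blast
qed

lemma eps_tendsto_0: "eps \<longlonglongrightarrow> 0"
  using LIMSEQ_inverse_real_of_nat by (simp add: eps_def[abs_def] divide_inverse add.commute)

text \<open>The two orders lost in the difference estimate are recovered by further integrations by
  parts, which is possible because \<open>norm (phase P)\<close> stays away from 0.\<close>

lemma kernel_seq_convergent_off_diag:
  assumes "symbol \<rho> \<mu> q" "0 < \<rho>" "\<rho> \<le> 1" "c > 0"
  shows "uniformly_convergent_on {P. c \<le> norm (phase P)} (\<lambda>j. kernel_seq j q)"
proof -
  define N where "N = nat \<lceil>(\<mu> + 3 + real DIM('a \<times> 'a)) / \<rho>\<rceil>"
  have "(\<mu> + 3 + real DIM('a \<times> 'a)) / \<rho> \<le> real N" unfolding N_def by linarith
  then have N: "\<mu> + 2 - \<rho> * N < - real DIM('a \<times> 'a)" using assms(2) by (simp add: field_simps)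
  obtain C where C: "C > 0" "\<And>j l (P::'a \<times> 'a \<times> 'a).
    norm (phase P) ^ N * norm (kernel_seq j q P - kernel_seq l q P) \<le> C * (eps j + eps l)"
    using kernel_seq_difference[OF assms(1) less_imp_le[OF assms(2)] assms(3) N] by blast
  show ?thesis unfolding uniformly_convergent_eq_Cauchy uniformly_Cauchy_on_def
  proof (intro allI impI)
    fix e :: real assume e: "e > 0"
    then have "e * c ^ N / (2 * C) > 0" using assms(4) C by simp
    then obtain M where M: "\<And>j. j \<ge> M \<Longrightarrow> eps j < e * c ^ N / (2 * C)"
      using order_tendstoD(2)[OF eps_tendsto_0] unfolding eventually_sequentially by blast
    have "dist (kernel_seq j q P) (kernel_seq l q P) < e"
      if P: "c \<le> norm (phase P)" and jl: "j \<ge> M" "l \<ge> M" for P j l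
    proof -
      have "c ^ N * norm (kernel_seq j q P - kernel_seq l q P) \<le> norm (phase P) ^ N * norm (kernel_seq j q P - kernel_seq l q P)"
        using P assms(4) by (intro mult_right_mono power_mono) auto
      also have "\<dots> \<le> C * (eps j + eps l)" by (rule C)
      also have "\<dots> < C * (e * c ^ N / (2 * C) + e * c ^ N / (2 * C))"
        using M jl C(1) by (intro mult_strict_left_mono add_strict_mono) auto
      also have "\<dots> = c ^ N * e" using C(1) by (simp add: field_simps)
      finally show ?thesis using assms(4) by (simp add: dist_norm)
    qed
    then show "\<exists>M. \<forall>x\<in>{P. c \<le> norm (phase P)}. \<forall>m\<ge>M. \<forall>n\<ge>M. dist (kernel_seq m q x) (kernel_seq n q x) < e"
      by blast
  qed
qed

text \<open>The majorant \<open>A j + A l\<close> of the differences is independent of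
  \<open>P\<close> and tends to 0 by dominated convergence. No oscillation is used, so the diagonal
  is included.\<close>

lemma kernel_seq_convergent_UNIV:
  assumes "symbol \<rho> \<mu> q" "\<rho> \<le> 1" "\<mu> < - real DIM('a \<times> 'a)"
  shows "uniformly_convergent_on (UNIV :: ('a::euclidean_space \<times> 'a \<times> 'a) set) (\<lambda>j. kernel_seq j q)"
proof -
  obtain C where C: "C > 0" "\<And>x \<zeta>. norm (q (x, \<zeta>)) \<le> C * weight \<mu> \<zeta>"
    using symbol_family_bound[OF symbol_fam[OF assms(1), of 0]] by auto
  let ?r = "\<lambda>j (\<zeta>::'a \<times> 'a). 1 - exp (- eps j * (norm \<zeta>)\<^sup>2)"
  have r: "0 \<le> ?r j \<zeta>" "?r j \<zeta> \<le> 1" for j \<zeta> using eps_bounds[of j] by auto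
  define A where "A j = (LINT \<zeta>|lborel. C * weight \<mu> \<zeta> * ?r j \<zeta>)" for j
  have iw: "integrable lborel (\<lambda>\<zeta>::'a \<times> 'a. C * weight \<mu> \<zeta>)"
    by (intro integrable_mult_right integrable_weight assms)
  have m: "(\<lambda>\<zeta>. C * weight \<mu> \<zeta> * ?r j \<zeta>) \<in> borel_measurable lborel" for j by measurable
  have iA: "integrable lborel (\<lambda>\<zeta>. C * weight \<mu> \<zeta> * ?r j \<zeta>)" for j
  proof (rule Bochner_Integration.integrable_bound[OF iw m])
    show "AE \<zeta> in lborel. norm (C * weight \<mu> \<zeta> * ?r j \<zeta>) \<le> norm (C * weight \<mu> \<zeta>)"
      using C(1) r[of j] by (intro AE_I2) (simp add: abs_mult mult_left_le)
  qed
  have "A \<longlonglongrightarrow> (LINT \<zeta>::'a \<times> 'a|lborel. 0)" unfolding A_def[abs_def]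
  proof (rule integral_dominated_convergence[OF _ m iw])
    show "AE \<zeta> in lborel. (\<lambda>j. C * weight \<mu> \<zeta> * ?r j \<zeta>) \<longlonglongrightarrow> 0"
    proof (intro AE_I2)
      fix \<zeta> :: "'a \<times> 'a"
      have "(\<lambda>j. C * weight \<mu> \<zeta> * (1 - exp (- eps j * (norm \<zeta>)\<^sup>2))) \<longlonglongrightarrow> C * weight \<mu> \<zeta> * (1 - exp (- 0 * (norm \<zeta>)\<^sup>2))"
        by (intro tendsto_intros eps_tendsto_0)
      then show "(\<lambda>j. C * weight \<mu> \<zeta> * ?r j \<zeta>) \<longlonglongrightarrow> 0" by simp
    qed
    show "AE \<zeta> in lborel. norm (C * weight \<mu> \<zeta> * ?r j \<zeta>) \<le> C * weight \<mu> \<zeta>" for j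
      using C(1) r[of j] by (intro AE_I2) (simp add: abs_mult mult_left_le weight_nonneg)
  qed simp
  then have A0: "A \<longlonglongrightarrow> 0" by simp
  have diff: "norm (kernel_seq j q P - kernel_seq l q P) \<le> A j + A l" for j l P
  proof -
    let ?g = "\<lambda>j \<zeta>. q (fst P, \<zeta>) * gauss (eps j) \<zeta>"
    have i: "integrable lborel (?g j)" for j by (rule integrable_regularized[OF assms(1,2)])
    have "kernel_seq j q P - kernel_seq l q P = osc (\<lambda>\<zeta>. ?g j \<zeta> - ?g l \<zeta>) (phase P)"
      unfolding kernel_seq_def osc_def left_diff_distrib
      by (subst Bochner_Integration.integral_diff) (auto intro: integrable_mult_wave i)
    also have "norm \<dots> \<le> (LINT \<zeta>|lborel. norm (?g j \<zeta> - ?g l \<zeta>))" by (rule norm_osc_le)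
    also have "\<dots> \<le> (LINT \<zeta>|lborel. C * weight \<mu> \<zeta> * ?r j \<zeta> + C * weight \<mu> \<zeta> * ?r l \<zeta>)"
    proof (intro integral_mono integrable_norm Bochner_Integration.integrable_diff i Bochner_Integration.integrable_add iA)
      fix \<zeta>
      have "?g j \<zeta> - ?g l \<zeta> = q (fst P, \<zeta>) * complex_of_real (?r l \<zeta> - ?r j \<zeta>)"
        by (simp add: gauss_def algebra_simps)
      then have "norm (?g j \<zeta> - ?g l \<zeta>) = norm (q (fst P, \<zeta>)) * \<bar>?r l \<zeta> - ?r j \<zeta>\<bar>"
        by (simp only: norm_mult norm_of_real)
      also have "\<dots> \<le> C * weight \<mu> \<zeta> * (?r j \<zeta> + ?r l \<zeta>)"
      proof (intro mult_mono C)
        show "\<bar>?r l \<zeta> - ?r j \<zeta>\<bar> \<le> ?r j \<zeta> + ?r l \<zeta>" using r[of j \<zeta>] r[of l \<zeta>] by linarith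
      qed (use C(1) in \<open>auto simp: weight_nonneg\<close>)
      finally show "norm (?g j \<zeta> - ?g l \<zeta>) \<le> C * weight \<mu> \<zeta> * ?r j \<zeta> + C * weight \<mu> \<zeta> * ?r l \<zeta>"
        by (simp only: distrib_left)
    qed
    also have "\<dots> = A j + A l" unfolding A_def by (intro Bochner_Integration.integral_add iA)
    finally show ?thesis .
  qed
  show ?thesis unfolding uniformly_convergent_eq_Cauchy uniformly_Cauchy_on_def
  proof (intro allI impI)
    fix e :: real assume "e > 0"
    then obtain M where M: "\<And>j. j \<ge> M \<Longrightarrow> A j < e / 2"
      using order_tendstoD(2)[OF A0, of "e / 2"] unfolding eventually_sequentially by auto
    have "dist (kernel_seq j q P) (kernel_seq l q P) < e" if "j \<ge> M" "l \<ge> M" for P j l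
      using diff[of j P l] M[OF that(1)] M[OF that(2)] by (simp add: dist_norm)
    then show "\<exists>M. \<forall>x\<in>UNIV. \<forall>m\<ge>M. \<forall>n\<ge>M. dist (kernel_seq m q x) (kernel_seq n q x) < e" by blast
  qed
qed

section \<open>Convergence domains and differentiation of the limit kernel\<close>

definition off_axis :: "('a::euclidean_space \<times> 'a \<times> 'a) set" where
  "off_axis = {P. phase P \<noteq> 0}"

lemma open_off_axis: "open (off_axis :: ('a::euclidean_space \<times> 'a \<times> 'a) set)"
proof -
  have "off_axis = phase -` (- {0} :: ('a \<times> 'a) set)" by (auto simp: off_axis_def)
  then show ?thesis
    using open_vimage[OF open_Compl[OF closed_singleton[of 0]] continuous_on_phase[of UNIV]] by (rule ssubst)
qed

lemma kernel_uniform_limit: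
  "uniformly_convergent_on T (\<lambda>j. kernel_seq j q) \<Longrightarrow> uniform_limit T (\<lambda>j. kernel_seq j q) (symbol_kernel q) sequentially"
  by (simp add: uniformly_convergent_uniform_limit_iff symbol_kernel_def[abs_def])

lemma kernel_tendsto:
  "uniformly_convergent_on T (\<lambda>j. kernel_seq j q) \<Longrightarrow> P \<in> T \<Longrightarrow> (\<lambda>j. kernel_seq j q P) \<longlonglongrightarrow> symbol_kernel q P"
  by (rule tendsto_uniform_limitI[OF kernel_uniform_limit])

text \<open>The set \<open>S\<close> is \<open>off_axis\<close>, or the whole space if the orders are small.\<close>

definition convergence_domain :: "real \<Rightarrow> real \<Rightarrow> ('a::euclidean_space \<times> 'a \<times> 'a) set \<Rightarrow> bool" where
  "convergence_domain \<rho> \<mu> S \<longleftrightarrow> open S \<and> (\<forall>q. symbol \<rho> \<mu> q \<longrightarrow>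
     (\<forall>P\<in>S. \<exists>r>0. ball P r \<subseteq> S \<and> uniformly_convergent_on (ball P r) (\<lambda>j. kernel_seq j q)))"

lemma uniformly_convergent_on_mono:
  "uniformly_convergent_on S f \<Longrightarrow> T \<subseteq> S \<Longrightarrow> uniformly_convergent_on T f"
  unfolding uniformly_convergent_on_def by (meson uniform_limit_on_subset)

text \<open>By continuity each point has a ball on which the phase keeps at least half of its norm,
  and there convergence is uniform.\<close>

lemma convergence_domain_off_axis:
  assumes "0 < \<rho>" "\<rho> \<le> 1"
  shows "convergence_domain \<rho> \<mu> (off_axis :: ('a::euclidean_space \<times> 'a \<times> 'a) set)"
  unfolding convergence_domain_def
proof (intro conjI allI impI ballI open_off_axis)
  fix q :: "'a \<times> 'a \<times> 'a \<Rightarrow> complex" and P :: "'a \<times> 'a \<times> 'a"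
  assume q: "symbol \<rho> \<mu> q" and P: "P \<in> off_axis"
  define c where "c = norm (phase P) / 2"
  have c: "c > 0" using P by (simp add: c_def off_axis_def)
  have "continuous (at P) phase" by (rule linear_continuous_at[OF bounded_linear_phase])
  then obtain r where r: "r > 0" "\<And>Q. dist Q P < r \<Longrightarrow> dist (phase Q) (phase P) < c"
    using c unfolding continuous_at_eps_delta by blast
  have sub: "c \<le> norm (phase Q)" if "Q \<in> ball P r" for Q
    using r(2)[of Q] that norm_triangle_ineq2[of "phase P" "phase Q"]
    by (auto simp: dist_norm norm_minus_commute c_def)
  show "\<exists>r>0. ball P r \<subseteq> off_axis \<and> uniformly_convergent_on (ball P r) (\<lambda>j. kernel_seq j q)"
  proof (intro exI[of _ r] conjI)
    show "ball P r \<subseteq> off_axis" using sub c by (force simp: off_axis_def)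
    show "uniformly_convergent_on (ball P r) (\<lambda>j. kernel_seq j q)"
      by (rule uniformly_convergent_on_mono[OF kernel_seq_convergent_off_diag[OF q assms c]]) (use sub in auto)
  qed (rule r)
qed

lemma convergence_domain_UNIV:
  assumes "\<rho> \<le> 1" "\<mu> < - real DIM('a \<times> 'a)"
  shows "convergence_domain \<rho> \<mu> (UNIV :: ('a::euclidean_space \<times> 'a \<times> 'a) set)"
  unfolding convergence_domain_def
  using kernel_seq_convergent_UNIV[OF _ assms] uniformly_convergent_on_mono[OF _ subset_UNIV]
  by (auto intro!: exI[of _ 1])

lemma kernel_seq_linear:
  assumes "symbol \<rho> \<mu> q" "\<rho> \<le> 1"
  shows "linear (\<lambda>v. kernel_seq j (deriv_symbol v q) P)"
  using kernel_seq_has_derivative[OF assms] has_derivative_linear by blast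

text \<open>Termwise differentiation of a sequence: the derivatives of \<open>kernel_seq j q\<close>
  are the kernels of \<open>deriv_symbol v q\<close>, and they converge uniformly near
  \<open>P\<close> because the order \<open>\<mu> + 1\<close> is covered as well.\<close>

lemma kernel_has_derivative:
  assumes q: "symbol \<rho> \<mu> q" and \<rho>: "\<rho> \<le> 1"
    and cd: "convergence_domain \<rho> \<mu> S" "convergence_domain \<rho> (\<mu> + 1) S" and P: "P \<in> S"
  shows "(symbol_kernel q has_derivative (\<lambda>v. symbol_kernel (deriv_symbol v q) P)) (at P)"
proof -
  have sy: "symbol \<rho> (\<mu> + 1) (deriv_symbol v q)" for v by (rule symbol_deriv_symbol[OF q \<rho>])
  have "\<exists>r>0. ball P r \<subseteq> S \<and> uniformly_convergent_on (ball P r) (\<lambda>j. kernel_seq j (deriv_symbol v q))" for v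
    using cd(2) sy P unfolding convergence_domain_def by blast
  then obtain rv where rv: "\<And>v. rv v > 0" "\<And>v. ball P (rv v) \<subseteq> S"
    "\<And>v. uniformly_convergent_on (ball P (rv v)) (\<lambda>j. kernel_seq j (deriv_symbol v q))" by metis
  obtain r0 where r0: "r0 > 0" "ball P r0 \<subseteq> S" "uniformly_convergent_on (ball P r0) (\<lambda>j. kernel_seq j q)"
    using cd(1) q P unfolding convergence_domain_def by blast
  \<comment> \<open>Convergence is known for one direction at a time. By linearity the finitely many
    basis directions suffice, and these have a common radius.\<close>
  define r where "r = Min (insert r0 (rv ` Basis))"
  have r: "r > 0" "r \<le> r0" using r0 rv by (auto simp: r_def)
  have rb: "r \<le> rv b" if "b \<in> Basis" for b unfolding r_def using that by (intro Min_le) auto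
  let ?B = "ball P r"
  have ub: "uniform_limit ?B (\<lambda>j. kernel_seq j (deriv_symbol b q)) (symbol_kernel (deriv_symbol b q)) sequentially"
    if "b \<in> Basis" for b
    by (rule kernel_uniform_limit, rule uniformly_convergent_on_mono[OF rv(3)]) (use rb[OF that] in auto)
  have u0: "uniformly_convergent_on ?B (\<lambda>j. kernel_seq j q)"
    by (rule uniformly_convergent_on_mono[OF r0(3)]) (use r(2) in auto)
  define g where "g Q h = (\<Sum>b\<in>Basis. (h \<bullet> b) *\<^sub>R symbol_kernel (deriv_symbol b q) Q)" for Q h
  have exp: "kernel_seq j (deriv_symbol h q) Q = (\<Sum>b\<in>Basis. (h \<bullet> b) *\<^sub>R kernel_seq j (deriv_symbol b q) Q)" for j h Q
  proof -
    note l = kernel_seq_linear[OF q \<rho>, of j Q]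
    show ?thesis
      using linear_sum[OF l, of "\<lambda>b. (h \<bullet> b) *\<^sub>R b" Basis] by (simp add: euclidean_representation linear_scale[OF l])
  qed
  have "\<exists>f. \<forall>Q\<in>?B. (\<lambda>j. kernel_seq j q Q) \<longlonglongrightarrow> f Q \<and> (f has_derivative g Q) (at Q within ?B)"
  proof (rule has_derivative_sequence[where f' = "\<lambda>j Q h. kernel_seq j (deriv_symbol h q) Q" and ?x0.0 = P])
    show "convex ?B" by simp
    show "(kernel_seq j q has_derivative (\<lambda>h. kernel_seq j (deriv_symbol h q) Q)) (at Q within ?B)" for j Q
      by (rule has_derivative_at_withinI[OF kernel_seq_has_derivative[OF q \<rho>]])
    show "P \<in> ?B" using r by simp
    then show "(\<lambda>j. kernel_seq j q P) \<longlonglongrightarrow> symbol_kernel q P" by (rule kernel_tendsto[OF u0])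
    fix e :: real assume e: "e > 0"
    define e' where "e' = e / real DIM('a \<times> 'a \<times> 'a)"
    have e': "e' > 0" using e by (simp add: e'_def)
    have "\<forall>\<^sub>F j in sequentially. \<forall>b\<in>Basis. \<forall>Q\<in>?B. dist (kernel_seq j (deriv_symbol b q) Q) (symbol_kernel (deriv_symbol b q) Q) < e'"
      using ub e' unfolding uniform_limit_iff by (intro eventually_ball_finite) auto
    then show "\<forall>\<^sub>F j in sequentially. \<forall>Q\<in>?B. \<forall>h. norm (kernel_seq j (deriv_symbol h q) Q - g Q h) \<le> e * norm h"
    proof eventually_elim
      case (elim j)
      show ?case
      proof (intro ballI allI)
        fix Q h assume Q: "Q \<in> ?B"
        have "kernel_seq j (deriv_symbol h q) Q - g Q h =
            (\<Sum>b\<in>Basis. (h \<bullet> b) *\<^sub>R (kernel_seq j (deriv_symbol b q) Q - symbol_kernel (deriv_symbol b q) Q))"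
          by (simp add: exp[of j h Q] g_def sum_subtractf scaleR_diff_right)
        also have "norm \<dots> \<le> (\<Sum>b\<in>Basis. norm ((h \<bullet> b) *\<^sub>R (kernel_seq j (deriv_symbol b q) Q - symbol_kernel (deriv_symbol b q) Q)))"
          by (rule norm_sum)
        also have "\<dots> \<le> (\<Sum>b\<in>(Basis :: ('a \<times> 'a \<times> 'a) set). norm h * e')"
        proof (intro sum_mono)
          fix b :: "'a \<times> 'a \<times> 'a" assume b: "b \<in> Basis"
          have "norm (kernel_seq j (deriv_symbol b q) Q - symbol_kernel (deriv_symbol b q) Q) \<le> e'"
            using elim b Q by (auto simp: dist_norm intro: less_imp_le)
          then show "norm ((h \<bullet> b) *\<^sub>R (kernel_seq j (deriv_symbol b q) Q - symbol_kernel (deriv_symbol b q) Q)) \<le> norm h * e'"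
            unfolding norm_scaleR using Basis_le_norm[OF b, of h] by (intro mult_mono) auto
        qed
        also have "\<dots> = e * norm h" by (simp add: e'_def)
        finally show "norm (kernel_seq j (deriv_symbol h q) Q - g Q h) \<le> e * norm h" .
      qed
    qed
  qed
  then obtain f where f: "\<And>Q. Q \<in> ?B \<Longrightarrow> (\<lambda>j. kernel_seq j q Q) \<longlonglongrightarrow> f Q"
    "\<And>Q. Q \<in> ?B \<Longrightarrow> (f has_derivative g Q) (at Q within ?B)" by blast
  have fk: "f Q = symbol_kernel q Q" if "Q \<in> ?B" for Q
    using LIMSEQ_unique[OF f(1)[OF that] kernel_tendsto[OF u0 that]] .
  have PB: "P \<in> ?B" using r by simp
  have "(f has_derivative g P) (at P)" using f(2)[OF PB] at_within_open[OF PB open_ball] by simp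
  then have "(symbol_kernel q has_derivative g P) (at P)"
    by (rule has_derivative_transform_within_open[OF _ open_ball PB]) (rule fk)
  \<comment> \<open>For a general direction the limit is computed in two ways, directly and through
    the basis expansion.\<close>
  moreover have "g P = (\<lambda>v. symbol_kernel (deriv_symbol v q) P)"
  proof
    fix v
    have "(\<lambda>j. kernel_seq j (deriv_symbol v q) P) \<longlonglongrightarrow> symbol_kernel (deriv_symbol v q) P"
      by (rule kernel_tendsto[OF rv(3)]) (use rv(1) in auto)
    moreover have "(\<lambda>j. kernel_seq j (deriv_symbol v q) P) \<longlonglongrightarrow> g P v"
      unfolding exp[of _ v P] g_def by (intro tendsto_sum tendsto_scaleR tendsto_const tendsto_uniform_limitI[OF ub] PB)
    ultimately show "g P v = symbol_kernel (deriv_symbol v q) P" using LIMSEQ_unique by blast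
  qed
  ultimately show ?thesis by simp
qed

lemma continuous_on_kernel_seq:
  assumes "symbol \<rho> \<mu> q" "\<rho> \<le> 1" shows "continuous_on T (kernel_seq j q)"
  using has_derivative_continuous_on[OF has_derivative_at_withinI[OF kernel_seq_has_derivative[OF assms]]] .

lemma continuous_on_kernel:
  assumes "symbol \<rho> \<mu> q" "\<rho> \<le> 1" "convergence_domain \<rho> \<mu> S"
  shows "continuous_on S (symbol_kernel q)"
proof -
  have "continuous (at P) (symbol_kernel q)" if P: "P \<in> S" for P
  proof -
    obtain r where r: "r > 0" "uniformly_convergent_on (ball P r) (\<lambda>j. kernel_seq j q)"
      using assms(1,3) P unfolding convergence_domain_def by blast
    have "continuous_on (ball P r) (symbol_kernel q)"
      by (rule uniform_limit_theorem[OF _ kernel_uniform_limit[OF r(2)]])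
        (auto intro!: always_eventually continuous_on_kernel_seq[OF assms(1,2)])
    then show ?thesis using r(1) by (simp add: continuous_on_eq_continuous_at)
  qed
  then show ?thesis by (simp add: continuous_at_imp_continuous_on)
qed

text \<open>Each derivative raises the order by one, so \<open>k\<close> derivatives call for
  convergence at all orders from \<open>\<mu>\<close> to \<open>\<mu> + k\<close>. On the whole
  space this is what limits \<open>k\<close>.\<close>

lemma Ck_on_kernel:
  assumes "\<rho> \<le> 1" "\<And>i. i \<le> k \<Longrightarrow> convergence_domain \<rho> (\<mu> + real i) S" "symbol \<rho> \<mu> q"
  shows "Ck_on k S (symbol_kernel q)"
  using assms(2,3)
proof (induction k arbitrary: \<mu> q)
  case 0
  then show ?case using continuous_on_kernel[OF 0(2) assms(1)] by simp
next
  case (Suc k)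
  have cd: "convergence_domain \<rho> \<mu> S" "convergence_domain \<rho> (\<mu> + 1) S"
    using Suc.prems(1)[of 0] Suc.prems(1)[of 1] by simp_all
  show ?case
  proof (rule Ck_on_SucI[where f' = "\<lambda>v. symbol_kernel (deriv_symbol v q)"])
    show "open S" using cd by (simp add: convergence_domain_def)
    show "(symbol_kernel q has_derivative (\<lambda>v. symbol_kernel (deriv_symbol v q) P)) (at P)" if "P \<in> S" for P
      by (rule kernel_has_derivative[OF Suc.prems(2) assms(1) cd that])
    show "Ck_on k S (symbol_kernel (deriv_symbol v q))" for v
    proof (rule Suc.IH)
      show "convergence_domain \<rho> (\<mu> + 1 + real i) S" if "i \<le> k" for i
        using Suc.prems(1)[of "Suc i"] that by (simp add: add_ac)
    qed (rule symbol_deriv_symbol[OF Suc.prems(2) assms(1)])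
  qed
qed

lemma symbol_deriv_symbols:
  assumes "symbol \<rho> \<mu> q" "\<rho> \<le> 1"
  shows "symbol \<rho> (\<mu> + real (length vs)) (foldr deriv_symbol vs q)"
proof (induction vs)
  case (Cons v vs)
  then show ?case using symbol_deriv_symbol[OF Cons assms(2), of v] by (simp add: add_ac)
qed (use assms in simp)

lemma dir_derivs_kernel:
  assumes "\<rho> \<le> 1" "\<And>i. i \<le> length vs \<Longrightarrow> convergence_domain \<rho> (\<mu> + real i) S" "symbol \<rho> \<mu> q" "P \<in> S"
  shows "dir_derivs vs (symbol_kernel q) P = symbol_kernel (foldr deriv_symbol vs q) P"
  using assms(2,4)
proof (induction vs arbitrary: P)
  case (Cons v vs)
  have op: "open S" using Cons.prems(1)[of 0] by (simp add: convergence_domain_def)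
  have eq: "dir_derivs vs (symbol_kernel q) Q = symbol_kernel (foldr deriv_symbol vs q) Q" if "Q \<in> S" for Q
    using Cons.IH[OF _ that] Cons.prems(1) by simp
  have "(symbol_kernel (foldr deriv_symbol vs q) has_derivative (\<lambda>v. symbol_kernel (deriv_symbol v (foldr deriv_symbol vs q)) P)) (at P)"
    using Cons.prems(1)[of "length vs"] Cons.prems(1)[of "Suc (length vs)"] Cons.prems(2)
    by (intro kernel_has_derivative[OF symbol_deriv_symbols[OF assms(3,1)] assms(1)]) (simp_all add: add_ac)
  then show ?case
    using frechet_derivative_cong_open[OF op Cons.prems(2) eq] frechet_derivative_eqI by fastforce
qed simp

section \<open>Bounds for the limit kernel\<close>

lemma kernel_limit_bound:
  assumes "convergence_domain \<rho> \<mu> S" "symbol \<rho> \<mu> q" "P \<in> S" "\<And>j. norm (kernel_seq j q P) \<le> B"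
  shows "norm (symbol_kernel q P) \<le> B"
proof -
  obtain r where r: "r > 0" "uniformly_convergent_on (ball P r) (\<lambda>j. kernel_seq j q)"
    using assms(1-3) unfolding convergence_domain_def by blast
  have "(\<lambda>j. kernel_seq j q P) \<longlonglongrightarrow> symbol_kernel q P" by (rule kernel_tendsto[OF r(2)]) (use r in simp)
  then show ?thesis by (rule Lim_norm_ubound[OF sequentially_bot]) (simp add: assms(4))
qed

lemma kernel_decay:
  assumes "symbol \<rho> \<mu> q" "0 < \<rho>" "\<rho> \<le> 1" "\<mu> - \<rho> * N < - real DIM('a \<times> 'a)"
  shows "\<exists>C>0. \<forall>P \<in> (off_axis :: ('a::euclidean_space \<times> 'a \<times> 'a) set). norm (phase P) ^ N * norm (symbol_kernel q P) \<le> C"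
proof -
  obtain C where C: "C > 0" "\<And>j (P :: 'a \<times> 'a \<times> 'a). norm (phase P) ^ N * norm (kernel_seq j q P) \<le> C"
    using kernel_seq_decay[OF assms(1) less_imp_le[OF assms(2)] assms(3,4)] by blast
  have "norm (phase P) ^ N * norm (symbol_kernel q P) \<le> C" if P: "P \<in> off_axis" for P :: "'a \<times> 'a \<times> 'a"
  proof -
    have p: "norm (phase P) ^ N > 0" using P by (simp add: off_axis_def)
    have "norm (symbol_kernel q P) \<le> C / norm (phase P) ^ N"
      by (rule kernel_limit_bound[OF convergence_domain_off_axis[OF assms(2,3)] assms(1) P])
        (use C(2)[of P] p in \<open>simp add: field_simps\<close>)
    then show ?thesis using p by (simp add: field_simps)
  qed
  with C(1) show ?thesis by blast
qed

lemma kernel_bounded: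
  assumes "symbol \<rho> \<mu> q" "0 \<le> \<rho>" "\<rho> \<le> 1" "\<mu> < - real DIM('a \<times> 'a)"
  shows "\<exists>C>0. \<forall>P :: 'a::euclidean_space \<times> 'a \<times> 'a. norm (symbol_kernel q P) \<le> C"
proof -
  have "\<mu> - \<rho> * real 0 < - real DIM('a \<times> 'a)" using assms by simp
  from kernel_seq_decay[OF assms(1-3) this]
  obtain C where C: "C > 0" "\<And>j (P :: 'a \<times> 'a \<times> 'a). norm (kernel_seq j q P) \<le> C" by auto
  then show ?thesis
    using kernel_limit_bound[OF convergence_domain_UNIV[OF assms(3,4)] assms(1)] by blast
qed

text \<open>The constant does not depend on \<open>j\<close>, so the bound passes to the limit. The
  condition on \<open>R\<close> refers to one component of the phase; a largest one is inserted
  afterwards.\<close>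

lemma kernel_sharp_bound:
  assumes q: "symbol \<rho> \<mu> q" and \<rho>: "0 < \<rho>" "\<rho> \<le> 1"
  shows "\<exists>C>0. \<forall>P \<in> (off_axis :: ('a::euclidean_space \<times> 'a \<times> 'a) set). \<forall>b\<in>Basis. \<forall>R\<ge>1. \<bar>phase P \<bullet> b\<bar> = R powr (- \<rho>) \<longrightarrow>
     norm (symbol_kernel q P) \<le> C * (ball_mass TYPE('a \<times> 'a) \<mu> R + R powr (\<mu> + real DIM('a \<times> 'a)))"
proof -
  let ?F = "\<lambda>i \<zeta>. q (snd i, \<zeta>) * gauss (eps (fst i)) \<zeta>"
  let ?V = "\<lambda>R. ball_mass TYPE('a \<times> 'a) \<mu> R + R powr (\<mu> + real DIM('a \<times> 'a))"
  have V: "?V R \<ge> 0" for R unfolding ball_mass_def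
    by (intro add_nonneg_nonneg integral_nonneg_AE AE_I2) (auto simp: weight_nonneg)
  have reg: "\<exists>\<nu> < - real DIM('a \<times> 'a). symbol_family \<rho> {i} k \<nu> ?F" for i :: "nat \<times> 'a" and k
    using symbol_family_regularized[OF q \<rho>(2), of "{i}" k "- real DIM('a \<times> 'a) - 1" snd "fst i"]
      symbol_family_cong[of "{i}" "\<lambda>k \<zeta>. q (snd k, \<zeta>) * gauss (eps (fst i)) \<zeta>" ?F]
    by (intro exI[of _ "- real DIM('a \<times> 'a) - 1"]) auto
  have "\<exists>C>0. \<forall>b\<in>Basis. \<forall>i\<in>UNIV. \<forall>x. 1 \<le> snd x \<and> \<bar>fst x \<bullet> (b :: 'a \<times> 'a)\<bar> = snd x powr (- \<rho>) \<longrightarrow>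
     norm (osc (?F i) (fst x)) \<le> C * ?V (snd x)"
  proof (rule uniform_over_Basis[OF _ V])
    fix b :: "'a \<times> 'a"
    show "\<exists>C>0. \<forall>i\<in>UNIV. \<forall>x. 1 \<le> snd x \<and> \<bar>fst x \<bullet> (b :: 'a \<times> 'a)\<bar> = snd x powr (- \<rho>) \<longrightarrow>
     norm (osc (?F i) (fst x)) \<le> C * ?V (snd x)"
      using osc_sharp_bound[OF \<rho> symbol_family_kernel_seq[OF q \<rho>(2)] reg, of b] by (auto simp: split_paired_all)
  qed
  then obtain C where C: "C > 0" "\<And>b i u R. b \<in> Basis \<Longrightarrow> 1 \<le> R \<Longrightarrow> \<bar>u \<bullet> (b :: 'a \<times> 'a)\<bar> = R powr (- \<rho>) \<Longrightarrow>
     norm (osc (?F i) u) \<le> C * ?V R" by auto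
  have "norm (symbol_kernel q P) \<le> C * ?V R"
    if P: "P \<in> off_axis" and b: "b \<in> Basis" "1 \<le> R" "\<bar>phase P \<bullet> b\<bar> = R powr (- \<rho>)" for P b R
  proof (rule kernel_limit_bound[OF convergence_domain_off_axis[OF \<rho>] q P])
    show "norm (kernel_seq j q P) \<le> C * ?V R" for j
      using C(2)[OF b, of "(j, fst P)"] by (simp add: kernel_seq_def)
  qed
  with C(1) show ?thesis by blast
qed

text \<open>For a largest component \<open>t \<le> 1\<close> the choice
  \<open>R = t powr (- 1 / \<rho>)\<close> bounds both the mass of the ball and the remainder by
  multiples of \<open>t powr (- a)\<close>. For \<open>t > 1\<close> this radius would be below 1;
  there decay of an order \<open>N \<ge> a\<close> is strong enough.\<close>

lemma kernel_bound_positive_order: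
  assumes q: "symbol \<rho> \<mu> q" and \<rho>: "0 < \<rho>" "\<rho> \<le> 1" and pos: "\<mu> + real DIM('a \<times> 'a) > 0"
  shows "\<exists>C>0. \<forall>P \<in> (off_axis :: ('a::euclidean_space \<times> 'a \<times> 'a) set).
    norm (symbol_kernel q P) \<le> C * norm (phase P) powr (- (\<mu> + real DIM('a \<times> 'a)) / \<rho>)"
proof -
  let ?d = "real DIM('a \<times> 'a)"
  define a where "a = (\<mu> + ?d) / \<rho>"
  have a: "a > 0" using pos \<rho> by (simp add: a_def)
  obtain C1 where C1: "C1 > 0" "\<And>(P :: 'a \<times> 'a \<times> 'a) b R. P \<in> off_axis \<Longrightarrow> b \<in> Basis \<Longrightarrow> R \<ge> 1 \<Longrightarrow>
     \<bar>phase P \<bullet> b\<bar> = R powr (- \<rho>) \<Longrightarrow> norm (symbol_kernel q P) \<le> C1 * (ball_mass TYPE('a \<times> 'a) \<mu> R + R powr (\<mu> + ?d))"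
    using kernel_sharp_bound[OF q \<rho>] by blast
  obtain C2 where C2: "C2 > 0" "\<And>R. R \<ge> 1 \<Longrightarrow> ball_mass TYPE('a \<times> 'a) \<mu> R \<le> C2 * R powr (\<mu> + ?d)"
    using ball_mass_pos_order[OF pos] by blast
  define N where "N = nat \<lceil>(\<bar>\<mu>\<bar> + ?d + 1) / \<rho>\<rceil>"
  have "(\<bar>\<mu>\<bar> + ?d + 1) / \<rho> \<le> real N" unfolding N_def by linarith
  then have "\<bar>\<mu>\<bar> + ?d + 1 \<le> \<rho> * N" using \<rho> by (simp add: field_simps)
  then have N: "\<mu> - \<rho> * N < - ?d" "a \<le> real N" using \<rho> by (auto simp: a_def field_simps)
  obtain C3 where C3: "C3 > 0" "\<And>P :: 'a \<times> 'a \<times> 'a. P \<in> off_axis \<Longrightarrow> norm (phase P) ^ N * norm (symbol_kernel q P) \<le> C3"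
    using kernel_decay[OF q \<rho> N(1)] by blast
  \<comment> \<open>The factor \<open>?d powr a\<close> converts the component \<open>t\<close> back
    into the norm.\<close>
  define C where "C = (C1 * (C2 + 1) + C3) * ?d powr a"
  have "norm (symbol_kernel q P) \<le> C * norm (phase P) powr (- a)" if P: "P \<in> off_axis" for P :: "'a \<times> 'a \<times> 'a"
  proof -
    have p: "norm (phase P) > 0" using P by (simp add: off_axis_def)
    obtain b where b: "b \<in> Basis" "norm (phase P) \<le> ?d * \<bar>phase P \<bullet> b\<bar>" "\<bar>phase P \<bullet> b\<bar> \<le> norm (phase P)"
      by (rule large_component)
    define t where "t = \<bar>phase P \<bullet> b\<bar>"
    have d: "?d > 0" by simp
    have t: "t > 0" using b(2) p d by (smt (verit) t_def mult_nonneg_nonpos)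
    have "norm (symbol_kernel q P) \<le> (C1 * (C2 + 1) + C3) * t powr (- a)"
    proof (cases "t \<le> 1")
      case True
      define R where "R = t powr (- 1 / \<rho>)"
      have R: "R \<ge> 1" using t True \<rho> powr_le1[of "1 / \<rho>" t] by (simp add: R_def powr_minus_divide)
      have Rt: "R powr (- \<rho>) = t" using t \<rho> by (simp add: R_def powr_powr)
      have Ra: "R powr (\<mu> + ?d) = t powr (- a)" by (simp add: R_def powr_powr a_def)
      have "norm (symbol_kernel q P) \<le> C1 * (ball_mass TYPE('a \<times> 'a) \<mu> R + R powr (\<mu> + ?d))"
        by (rule C1(2)[OF P b(1) R]) (simp add: Rt t_def)
      also have "\<dots> \<le> C1 * (C2 * R powr (\<mu> + ?d) + R powr (\<mu> + ?d))"
        using C1(1) C2(2)[OF R] by (intro mult_left_mono) auto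
      also have "\<dots> = (C1 * (C2 + 1)) * t powr (- a)" unfolding Ra by (simp add: algebra_simps)
      also have "\<dots> \<le> (C1 * (C2 + 1) + C3) * t powr (- a)" using C3(1) by (intro mult_right_mono) auto
      finally show ?thesis .
    next
      case False
      have "t ^ N * norm (symbol_kernel q P) \<le> norm (phase P) ^ N * norm (symbol_kernel q P)"
        using b(3) t by (intro mult_right_mono power_mono) (auto simp: t_def)
      also have "\<dots> \<le> C3" by (rule C3(2)[OF P])
      finally have "norm (symbol_kernel q P) \<le> C3 * t powr (- real N)"
        using t by (simp add: powr_minus powr_realpow field_simps)
      also have "\<dots> \<le> C3 * t powr (- a)" using False N C3(1) by (intro mult_left_mono powr_mono) auto
      also have "\<dots> \<le> (C1 * (C2 + 1) + C3) * t powr (- a)" using C1(1) C2(1) by (intro mult_right_mono) auto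
      finally show ?thesis .
    qed
    also have "t powr (- a) \<le> (norm (phase P) / ?d) powr (- a)"
    proof (rule powr_mono2')
      show "0 < norm (phase P) / ?d" using p d by (rule divide_pos_pos)
      show "norm (phase P) / ?d \<le> t" using b(2) d by (simp only: t_def pos_divide_le_eq mult.commute)
    qed (use a in simp)
    also have "(norm (phase P) / ?d) powr (- a) = ?d powr a * norm (phase P) powr (- a)"
    proof -
      have "(x / D) powr (- a) = D powr a * x powr (- a)" for x D :: real
        by (simp add: powr_divide powr_minus_divide)
      then show ?thesis .
    qed
    finally have "norm (symbol_kernel q P) \<le> (C1 * (C2 + 1) + C3) * (?d powr a * norm (phase P) powr (- a))"
      using C1(1) C2(1) C3(1) by (simp only: mult_left_mono add_nonneg_nonneg mult_nonneg_nonneg less_imp_le zero_le_one)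
    then show ?thesis by (simp only: C_def mult.assoc)
  qed
  moreover have "C > 0" using C1(1) C2(1) C3(1) by (auto simp: C_def intro!: add_pos_pos mult_pos_pos)
  ultimately show ?thesis unfolding a_def minus_divide_left by blast
qed

text \<open>The power of \<open>R\<close> is now 1 and the mass of the ball is bounded by a multiple
  of \<open>1 + ln R\<close>, where \<open>ln R = - ln t / \<rho>\<close> for a largest component
  \<open>t \<le> 1\<close>. For \<open>t > 1\<close> the kernel is bounded, which the summand 1
  accounts for.\<close>

lemma kernel_bound_zero_order:
  assumes q: "symbol \<rho> \<mu> q" and \<rho>: "0 < \<rho>" "\<rho> \<le> 1" and zero: "\<mu> + real DIM('a \<times> 'a) = 0"
  shows "\<exists>C>0. \<forall>P \<in> (off_axis :: ('a::euclidean_space \<times> 'a \<times> 'a) set).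
    norm (symbol_kernel q P) \<le> C * (1 + \<bar>ln (norm (phase P))\<bar>)"
proof -
  let ?d = "real DIM('a \<times> 'a)"
  obtain C1 where C1: "C1 > 0" "\<And>(P :: 'a \<times> 'a \<times> 'a) b R. P \<in> off_axis \<Longrightarrow> b \<in> Basis \<Longrightarrow> R \<ge> 1 \<Longrightarrow>
     \<bar>phase P \<bullet> b\<bar> = R powr (- \<rho>) \<Longrightarrow> norm (symbol_kernel q P) \<le> C1 * (ball_mass TYPE('a \<times> 'a) \<mu> R + R powr (\<mu> + ?d))"
    using kernel_sharp_bound[OF q \<rho>] by blast
  obtain C2 where C2: "C2 > 0" "\<And>R. R \<ge> 1 \<Longrightarrow> ball_mass TYPE('a \<times> 'a) \<mu> R \<le> C2 * (1 + ln R)"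
    using ball_mass_zero_order[OF zero] by blast
  define N where "N = nat \<lceil>(\<bar>\<mu>\<bar> + ?d + 1) / \<rho>\<rceil>"
  have "(\<bar>\<mu>\<bar> + ?d + 1) / \<rho> \<le> real N" unfolding N_def by linarith
  then have "\<bar>\<mu>\<bar> + ?d + 1 \<le> \<rho> * N" using \<rho> by (simp add: field_simps)
  then have N: "\<mu> - \<rho> * N < - ?d" by auto
  obtain C3 where C3: "C3 > 0" "\<And>P :: 'a \<times> 'a \<times> 'a. P \<in> off_axis \<Longrightarrow> norm (phase P) ^ N * norm (symbol_kernel q P) \<le> C3"
    using kernel_decay[OF q \<rho> N] by blast
  have d: "?d \<ge> 1" using DIM_positive[where 'a = "'a \<times> 'a"] by linarith
  define A where "A = C1 * (C2 + 1) + C3"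
  have A: "A > 0" "C3 \<le> A" "C1 * (C2 + 1) \<le> A" using C1(1) C2(1) C3(1) by (auto simp: A_def intro!: add_pos_pos mult_pos_pos)
  \<comment> \<open>Absorbs the loss \<open>ln ?d\<close> between component and norm and the
    division by \<open>\<rho>\<close>.\<close>
  define B where "B = 1 + (1 + ln ?d) / \<rho>"
  have B: "B > 0" using d \<rho> by (auto simp: B_def intro!: add_pos_nonneg divide_nonneg_nonneg)
  have "norm (symbol_kernel q P) \<le> A * B * (1 + \<bar>ln (norm (phase P))\<bar>)" if P: "P \<in> off_axis" for P :: "'a \<times> 'a \<times> 'a"
  proof -
    have p: "norm (phase P) > 0" using P by (simp add: off_axis_def)
    obtain b where b: "b \<in> Basis" "norm (phase P) \<le> ?d * \<bar>phase P \<bullet> b\<bar>" "\<bar>phase P \<bullet> b\<bar> \<le> norm (phase P)"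
      by (rule large_component)
    define t where "t = \<bar>phase P \<bullet> b\<bar>"
    define L where "L = \<bar>ln (norm (phase P))\<bar>"
    have L: "L \<ge> 0" by (simp add: L_def)
    have t: "t > 0" using b(2) p d by (smt (verit) t_def mult_nonneg_nonpos)
    have BL: "1 \<le> B * (1 + L)" "(1 + ln ?d + L) / \<rho> \<le> B * (1 + L)"
    proof -
      have "0 \<le> (1 + ln ?d) / \<rho>" using d \<rho> by (intro divide_nonneg_nonneg) auto
      then have "1 * 1 \<le> B * (1 + L)" using L by (intro mult_mono) (auto simp: B_def)
      then show "1 \<le> B * (1 + L)" by simp
      have "1 + ln ?d + L \<le> (1 + ln ?d) * (1 + L)" using d L by (simp add: algebra_simps)
      then have "(1 + ln ?d + L) / \<rho> \<le> (1 + ln ?d) * (1 + L) / \<rho>" using \<rho> by (intro divide_right_mono) auto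
      also have "\<dots> = (1 + ln ?d) / \<rho> * (1 + L)" by simp
      also have "\<dots> \<le> B * (1 + L)" using L by (intro mult_right_mono) (auto simp: B_def)
      finally show "(1 + ln ?d + L) / \<rho> \<le> B * (1 + L)" .
    qed
    show ?thesis
    proof (cases "t \<le> 1")
      case True
      define R where "R = t powr (- 1 / \<rho>)"
      have R: "R \<ge> 1" using t True \<rho> powr_le1[of "1 / \<rho>" t] by (simp add: R_def powr_minus_divide)
      have Rt: "R powr (- \<rho>) = t" using t \<rho> by (simp add: R_def powr_powr)
      have "- ln t \<le> ln ?d + L"
      proof -
        have "ln (norm (phase P)) \<le> ln (?d * t)"
          using b(2) p mult_pos_pos[of ?d t] d t by (subst ln_le_cancel_iff) (auto simp only: t_def)
        also have "\<dots> = ln ?d + ln t" using t d by (simp add: ln_mult)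
        finally show ?thesis by (simp add: L_def)
      qed
      then have "ln R \<le> (ln ?d + L) / \<rho>" using t \<rho> by (simp add: R_def ln_powr field_simps)
      moreover have "1 \<le> 1 / \<rho>" using \<rho> by simp
      ultimately have lnR: "1 + ln R \<le> (1 + ln ?d + L) / \<rho>" by (simp add: add_divide_distrib)
      have "norm (symbol_kernel q P) \<le> C1 * (ball_mass TYPE('a \<times> 'a) \<mu> R + R powr (\<mu> + ?d))"
        by (rule C1(2)[OF P b(1) R]) (simp add: Rt t_def)
      also have "\<dots> \<le> C1 * (C2 * (1 + ln R) + (1 + ln R))"
        using C1(1) C2(2)[OF R] R zero by (intro mult_left_mono add_mono) auto
      also have "\<dots> = C1 * (C2 + 1) * (1 + ln R)" by (simp add: algebra_simps)
      also have "\<dots> \<le> A * (B * (1 + L))"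
        using A R order_trans[OF lnR BL(2)] by (intro mult_mono) auto
      finally show ?thesis by (simp add: L_def)
    next
      case False
      have "1 * norm (symbol_kernel q P) \<le> norm (phase P) ^ N * norm (symbol_kernel q P)"
        using b(3) False by (intro mult_right_mono one_le_power) (auto simp: t_def)
      also have "\<dots> \<le> C3" by (rule C3(2)[OF P])
      also have "\<dots> \<le> A * 1" using A by simp
      also have "\<dots> \<le> A * (B * (1 + L))" using A BL(1) by (intro mult_left_mono) auto
      finally show ?thesis by (simp add: L_def)
    qed
  qed
  moreover have "A * B > 0" using A B by simp
  ultimately show ?thesis by blast
qed

section \<open>Symbol estimates from the bilinear class\<close>

lemma distinct_coords: "distinct (coords :: 'n::finite list)" and set_coords: "set (coords :: 'n list) = UNIV"
proof -
  obtain xs :: "'n list" where "distinct xs \<and> set xs = UNIV" using finite_distinct_list[of "UNIV :: 'n set"] by auto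
  then have "distinct (coords :: 'n list) \<and> set (coords :: 'n list) = UNIV" unfolding coords_def by (rule someI)
  then show "distinct (coords :: 'n list)" "set (coords :: 'n list) = UNIV" by auto
qed

text \<open>A description free of the enumeration \<open>coords\<close>, of which only distinctness
  and exhaustiveness are used.\<close>

lemma mset_mi_dirs: "mset (mi_dirs \<alpha>) = (\<Sum>i\<in>UNIV. replicate_mset (\<alpha> i) (axis i 1))"
proof -
  have "mset (concat (map (\<lambda>i. replicate (\<alpha> i) (axis i 1)) is)) = (\<Sum>i\<in>set is. replicate_mset (\<alpha> i) (axis i 1))"
    if "distinct is" for "is"
    using that by (induction "is") auto
  from this[OF distinct_coords] show ?thesis by (simp add: mi_dirs_def set_coords)
qed

lemma length_mi_dirs: "length (mi_dirs \<alpha>) = mi_order \<alpha>"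
  using arg_cong[OF mset_mi_dirs[of \<alpha>], of size] by (simp add: mi_order_def size_multiset_sum)

text \<open>Together with \<open>dir_derivs_perm\<close>, this turns every iterated coordinate
  derivative into a multi-index derivative.\<close>

lemma mi_dirs_exists:
  assumes "set as \<subseteq> (Basis :: (real ^ 'n::finite) set)"
  shows "\<exists>\<alpha>. mset (mi_dirs \<alpha>) = mset as"
  using assms
proof (induction as)
  case Nil
  show ?case by (rule exI[of _ "\<lambda>_. 0"]) (simp add: mset_mi_dirs del: mset.simps)
next
  case (Cons a as)
  then obtain \<alpha> where \<alpha>: "mset (mi_dirs \<alpha>) = mset as" by auto
  obtain i where i: "a = axis i 1" using Cons.prems by (auto simp: Basis_vec_def)
  let ?\<alpha> = "\<lambda>j. \<alpha> j + (if j = i then 1 else 0)"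
  have "replicate_mset (?\<alpha> j) (axis j 1) = replicate_mset (\<alpha> j) (axis j 1) + (if j = i then {#axis i 1 :: real ^ 'n#} else {#})" for j
    by (cases "j = i") auto
  then have "mset (mi_dirs ?\<alpha>) = add_mset a (mset as)"
    unfolding mset_mi_dirs using \<alpha> by (simp add: sum.distrib mset_mi_dirs i)
  then show ?case by auto
qed

definition bounded_order :: "real \<Rightarrow> ('a::euclidean_space \<times> 'a \<times> 'a \<Rightarrow> complex) \<Rightarrow> bool" where
  "bounded_order \<mu> f \<longleftrightarrow> (\<exists>C>0. \<forall>x \<zeta>. norm (f (x, \<zeta>)) \<le> C * weight \<mu> \<zeta>)"

lemma bounded_order_sum:
  assumes "finite A" "\<And>i. i \<in> A \<Longrightarrow> bounded_order \<mu> (f i)"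
  shows "bounded_order \<mu> (\<lambda>w. \<Sum>i\<in>A. complex_of_real (c i) * f i w)"
proof -
  obtain C where C: "\<And>i. i \<in> A \<Longrightarrow> C i > 0" "\<And>i x \<zeta>. i \<in> A \<Longrightarrow> norm (f i (x, \<zeta>)) \<le> C i * weight \<mu> \<zeta>"
    using assms(2) unfolding bounded_order_def by metis
  have "norm (\<Sum>i\<in>A. complex_of_real (c i) * f i (x, \<zeta>)) \<le> ((\<Sum>i\<in>A. \<bar>c i\<bar> * C i) + 1) * weight \<mu> \<zeta>" for x \<zeta>
  proof -
    have "norm (\<Sum>i\<in>A. complex_of_real (c i) * f i (x, \<zeta>)) \<le> (\<Sum>i\<in>A. \<bar>c i\<bar> * (C i * weight \<mu> \<zeta>))"
      by (rule order_trans[OF norm_sum]) (auto simp: norm_mult intro!: sum_mono mult_left_mono C(2))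
    also have "\<dots> = (\<Sum>i\<in>A. \<bar>c i\<bar> * C i) * weight \<mu> \<zeta>" by (simp add: sum_distrib_right mult.assoc)
    finally show ?thesis using weight_nonneg[of \<mu> \<zeta>] by (simp add: distrib_right)
  qed
  moreover have "(\<Sum>i\<in>A. \<bar>c i\<bar> * C i) + 1 > 0"
    using C(1) by (intro add_nonneg_pos sum_nonneg mult_nonneg_nonneg) (auto intro: less_imp_le)
  ultimately show ?thesis unfolding bounded_order_def by blast
qed

lemma dir_derivs_expand:
  fixes f :: "'b::real_normed_vector \<Rightarrow> complex" and J :: "'a::euclidean_space \<Rightarrow> 'b"
  assumes "Cinf_on UNIV f" "linear J"
  shows "dir_derivs (us @ J v # vs) f = (\<lambda>w. \<Sum>b\<in>Basis. complex_of_real (v \<bullet> b) * dir_derivs (us @ J b # vs) f w)"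
proof -
  let ?g = "dir_derivs vs f"
  have g: "Cinf_on UNIV ?g" by (rule Cinf_dir_derivs[OF assms(1)])
  have "dir_derivs (J v # vs) f w = (\<Sum>b\<in>Basis. complex_of_real (v \<bullet> b) * dir_derivs (J b # vs) f w)" for w
  proof -
    have l: "linear (\<lambda>v. frechet_derivative ?g (at w) (J v))"
      using linear_compose[OF assms(2) has_derivative_linear[OF Cinf_on_has_derivative[OF g UNIV_I]]] by (simp add: o_def)
    show ?thesis
      using linear_sum[OF l, of "\<lambda>b. (v \<bullet> b) *\<^sub>R b" Basis]
      by (simp add: euclidean_representation linear_scale[OF l] scaleR_conv_of_real)
  qed
  then have "dir_derivs (J v # vs) f = (\<lambda>w. \<Sum>b\<in>Basis. complex_of_real (v \<bullet> b) * dir_derivs (J b # vs) f w)" by blast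
  then have "dir_derivs (us @ J v # vs) f = dir_derivs us (\<lambda>w. \<Sum>b\<in>Basis. complex_of_real (v \<bullet> b) * dir_derivs (J b # vs) f w)"
    by (simp only: dir_derivs_append)
  also have "\<dots> = (\<lambda>w. \<Sum>b\<in>Basis. dir_derivs us (\<lambda>w. complex_of_real (v \<bullet> b) * dir_derivs (J b # vs) f w) w)"
    by (intro dir_derivs_sum Cinf_on_mult Cinf_on_const Cinf_dir_derivs assms(1) open_UNIV)
  also have "\<dots> = (\<lambda>w. \<Sum>b\<in>Basis. complex_of_real (v \<bullet> b) * dir_derivs (us @ J b # vs) f w)"
    by (simp only: dir_derivs_cmult[OF Cinf_dir_derivs[OF assms(1)]] dir_derivs_append)
  finally show ?thesis .
qed

text \<open>The class \<open>BS\<close> bounds coordinate derivatives, whereas symbols are tested in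
  arbitrary directions. Multilinearity bridges the gap: the directions in one block of the list are
  expanded in the basis one by one. The function \<open>e\<close> gives the order in terms of the
  length of this block.\<close>

lemma bounded_order_multilinear:
  fixes J :: "'v::euclidean_space \<Rightarrow> 'a::euclidean_space \<times> 'a \<times> 'a"
  assumes "Cinf_on UNIV f" "linear J"
    and "\<And>vs. set vs \<subseteq> Basis \<Longrightarrow> bounded_order (e (length vs)) (dir_derivs (pre @ map J vs @ post) f)"
  shows "bounded_order (e (length us)) (dir_derivs (pre @ map J us @ post) f)"
proof -
  \<comment> \<open>The generalization for the induction: \<open>us\<close> is still arbitrary,
    \<open>vs\<close> is the part already replaced by basis vectors, and the last entry of
    \<open>us\<close> moves over.\<close>
  have "bounded_order (e (length us + length vs)) (dir_derivs (pre @ map J (us @ vs) @ post) f)"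
    if "set vs \<subseteq> Basis" for us vs
    using that
  proof (induction us arbitrary: vs rule: rev_induct)
    case Nil
    then show ?case using assms(3) by simp
  next
    case (snoc u us)
    have "bounded_order (e (length us + length (b # vs))) (dir_derivs (pre @ map J (us @ b # vs) @ post) f)"
      if "b \<in> Basis" for b
      by (rule snoc.IH) (use snoc.prems that in auto)
    then have "bounded_order (e (length us + length (u # vs)))
       (\<lambda>w. \<Sum>b\<in>Basis. complex_of_real (u \<bullet> b) * dir_derivs ((pre @ map J us) @ J b # (map J vs @ post)) f w)"
      by (intro bounded_order_sum) simp_all
    then show ?case unfolding dir_derivs_expand[OF assms(1,2), symmetric] by simp
  qed
  from this[of "[]" us] show ?thesis by simp
qed

lemma Basis_pair_split:
  assumes "set bs \<subseteq> (Basis :: ('a::euclidean_space \<times> 'a) set)"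
  shows "\<exists>cs ds. set cs \<subseteq> Basis \<and> set ds \<subseteq> Basis \<and> mset bs = mset (map (\<lambda>c. (c, 0)) cs @ map (\<lambda>d. (0, d)) ds)"
  using assms
proof (induction bs)
  case (Cons b bs)
  then obtain cs ds where cd: "set cs \<subseteq> Basis" "set ds \<subseteq> (Basis :: 'a set)"
    "mset bs = mset (map (\<lambda>c. (c, 0)) cs @ map (\<lambda>d. (0, d)) ds)" by auto
  have "(\<exists>c\<in>Basis. b = (c, 0)) \<or> (\<exists>d\<in>Basis. b = (0, d))" using Cons.prems by (auto simp: Basis_prod_def)
  then show ?case
  proof
    assume "\<exists>c\<in>Basis. b = (c, 0)"
    then obtain c where "c \<in> Basis" "b = (c, 0)" by blast
    with cd show ?case by (intro exI[of _ "c # cs"] exI[of _ ds]) simp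
  next
    assume "\<exists>d\<in>Basis. b = (0, d)"
    then obtain d where "d \<in> Basis" "b = (0, d)" by blast
    with cd show ?case by (intro exI[of _ cs] exI[of _ "d # ds"]) simp
  qed
qed (auto intro: exI[of _ "[]"])

text \<open>The class is defined with the sum of the norms, the weights with the Euclidean norm of
  the pair; the bases differ by a factor of at most 2.\<close>

lemma BS_weight_comparison:
  "(1 + norm \<xi> + norm \<eta>) powr e \<le> 2 powr \<bar>e\<bar> * weight e (\<xi>, \<eta>)"
  unfolding weight_def
proof (rule powr_le_of_comparable)
  show "1 + norm (\<xi>, \<eta>) \<le> 1 + norm \<xi> + norm \<eta>" using norm_Pair_le[of \<xi> \<eta>] by simp
  show "1 + norm \<xi> + norm \<eta> \<le> 2 * (1 + norm (\<xi>, \<eta>))"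
    using norm_fst_le[of \<xi> \<eta>] norm_snd_le[of \<eta> \<xi>] by simp
qed (use one_plus_norm_pos in auto)

text \<open>Coordinate directions in the frequency pair split into those of \<open>\<xi>\<close> and
  those of \<open>\<eta>\<close>, which after reordering gives a \<open>pd3\<close>. The growth
  \<open>\<delta>\<close> per derivative in \<open>x\<close> is rounded up to 1.\<close>

lemma BS_bounded_order:
  fixes p :: "'n::finite triple \<Rightarrow> complex"
  assumes p: "p \<in> BS m \<rho> \<delta>" and "\<delta> \<le> 1"
  shows "bounded_order (m + real (length as) - \<rho> * real (length bs)) (dir_derivs (map (\<lambda>b. (0, b)) bs @ map (\<lambda>a. (a, 0)) as) p)"
proof -
  have C: "Cinf_on UNIV p" using p by (simp add: BS_def)
  let ?Z = "\<lambda>b. (0 :: real ^ 'n, b :: (real ^ 'n) \<times> (real ^ 'n))" and ?X = "\<lambda>a. (a :: real ^ 'n, 0 :: (real ^ 'n) \<times> (real ^ 'n))"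
  have lin: "linear ?Z" "linear ?X" by (auto simp: linear_iff)
  have basis: "bounded_order (m + real (length as) - \<rho> * real (length bs)) (dir_derivs (map ?Z bs @ map ?X as) p)"
    if as: "set as \<subseteq> Basis" and bs: "set bs \<subseteq> Basis" for as bs
  proof -
    obtain cs ds where cd: "set cs \<subseteq> Basis" "set ds \<subseteq> Basis"
      "mset bs = mset (map (\<lambda>c. (c, 0)) cs @ map (\<lambda>d. (0, d)) ds)" using Basis_pair_split[OF bs] by blast
    obtain \<alpha> \<beta> \<gamma> where mi: "mset (mi_dirs \<alpha>) = mset as" "mset (mi_dirs \<beta>) = mset cs" "mset (mi_dirs \<gamma>) = mset ds"
      using mi_dirs_exists[OF as] mi_dirs_exists[OF cd(1)] mi_dirs_exists[OF cd(2)] by blast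
    have len: "mi_order \<alpha> = length as" "mi_order \<beta> + mi_order \<gamma> = length bs"
      using arg_cong[OF mi(1), of size] arg_cong[OF mi(2), of size] arg_cong[OF mi(3), of size] arg_cong[OF cd(3), of size]
      by (simp_all add: length_mi_dirs)
    have pd: "pd3 \<alpha> \<beta> \<gamma> p = dir_derivs (map ?Z bs @ map ?X as) p"
      unfolding pd3_def
    proof (rule dir_derivs_perm[OF C])
      have "mset (map ?Z bs) = image_mset ?Z (mset bs)" by simp
      also have "\<dots> = mset (map (\<lambda>v. (0, v, 0)) cs) + mset (map (\<lambda>w. (0, 0, w)) ds)"
        unfolding cd(3) by (simp add: multiset.map_comp o_def)
      finally show "mset (map (\<lambda>u. (u, 0, 0)) (mi_dirs \<alpha>) @ map (\<lambda>v. (0, v, 0)) (mi_dirs \<beta>) @ map (\<lambda>w. (0, 0, w)) (mi_dirs \<gamma>))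
        = mset (map ?Z bs @ map ?X as)"
        using mi by (simp add: zero_prod_def)
    qed
    obtain K where K: "K > 0" "\<And>x \<xi> \<eta>. norm (pd3 \<alpha> \<beta> \<gamma> p (x, \<xi>, \<eta>)) \<le> K * (1 + norm \<xi> + norm \<eta>) powr
          (m + \<delta> * real (mi_order \<alpha>) - \<rho> * (real (mi_order \<beta>) + real (mi_order \<gamma>)))"
      using p unfolding BS_def by blast
    have cmp: "(1 + norm \<xi> + norm \<eta>) powr (m + \<delta> * real (mi_order \<alpha>) - \<rho> * (real (mi_order \<beta>) + real (mi_order \<gamma>)))
      \<le> 2 powr \<bar>m + real (length as) - \<rho> * real (length bs)\<bar> * weight (m + real (length as) - \<rho> * real (length bs)) (\<xi>, \<eta>)"
      for \<xi> \<eta> :: "real ^ 'n"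
    proof -
      have l: "real (mi_order \<beta>) + real (mi_order \<gamma>) = real (length bs)" using len(2) by linarith
      have "(1 + norm \<xi> + norm \<eta>) powr (m + \<delta> * real (mi_order \<alpha>) - \<rho> * (real (mi_order \<beta>) + real (mi_order \<gamma>)))
        \<le> (1 + norm \<xi> + norm \<eta>) powr (m + real (length as) - \<rho> * real (length bs))"
        unfolding l len(1) using assms(2) mult_right_mono[of \<delta> 1 "real (length as)"] by (intro powr_mono) auto
      also have "\<dots> \<le> 2 powr \<bar>m + real (length as) - \<rho> * real (length bs)\<bar> * weight (m + real (length as) - \<rho> * real (length bs)) (\<xi>, \<eta>)"
        by (rule BS_weight_comparison)
      finally show ?thesis .
    qed
    have "norm (dir_derivs (map ?Z bs @ map ?X as) p (x, \<zeta>)) \<le>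
      (K * 2 powr \<bar>m + real (length as) - \<rho> * real (length bs)\<bar>) * weight (m + real (length as) - \<rho> * real (length bs)) \<zeta>" for x \<zeta>
    proof -
      obtain \<xi> \<eta> where \<zeta>: "\<zeta> = (\<xi>, \<eta>)" by (rule prod.exhaust)
      show ?thesis unfolding pd[symmetric] \<zeta> mult.assoc
        by (rule order_trans[OF K(2)]) (rule mult_left_mono[OF cmp less_imp_le[OF K(1)]])
    qed
    moreover have "K * 2 powr \<bar>m + real (length as) - \<rho> * real (length bs)\<bar> > 0" using K(1) by simp
    ultimately show ?thesis unfolding bounded_order_def by blast
  qed
  have 1: "bounded_order (m + real (length as) - \<rho> * real (length bs)) (dir_derivs (map ?Z bs @ map ?X as) p)"
    if bs: "set bs \<subseteq> Basis" for bs
    using bounded_order_multilinear[OF C lin(2), where e = "\<lambda>l. m + real l - \<rho> * real (length bs)" and pre = "map ?Z bs" and post = "[]" and us = as]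
      basis[OF _ bs] by simp
  show ?thesis
    using bounded_order_multilinear[OF C lin(1), where e = "\<lambda>l. m + real (length as) - \<rho> * real l" and pre = "[]" and post = "map ?X as" and us = bs]
      1 by simp
qed

text \<open>The induction runs over all lists \<open>bs\<close> of frequency directions already
  applied, as each further derivative extends this list.\<close>

lemma BS_symbol:
  fixes p :: "'n::finite triple \<Rightarrow> complex"
  assumes p: "p \<in> BS m \<rho> \<delta>" and "\<delta> \<le> 1"
  shows "symbol \<rho> m p"
proof (rule symbolI)
  show C: "Cinf_on UNIV p" using p by (simp add: BS_def)
  fix as :: "(real ^ 'n) list" and k
  let ?D = "\<lambda>bs. dir_derivs (map (\<lambda>b. (0, b)) bs @ map (\<lambda>a. (a, 0)) as) p"
  have "symbol_family \<rho> UNIV k (m + real (length as) - \<rho> * real (length bs)) (\<lambda>x \<zeta>. ?D bs (x, \<zeta>))" for bs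
  proof (induction k arbitrary: bs)
    case 0
    have "continuous_on UNIV (\<lambda>\<zeta>. ?D bs (x, \<zeta>))" for x
      by (rule continuous_on_compose2[OF Cinf_on_continuous[OF Cinf_dir_derivs[OF C]]]) (auto intro!: continuous_intros)
    then show ?case using BS_bounded_order[OF assms, of as bs] by (auto simp: bounded_order_def)
  next
    case (Suc k)
    show ?case
    proof (rule symbol_family_SucI[where F' = "\<lambda>v x \<zeta>. ?D (v # bs) (x, \<zeta>)"])
      show "\<exists>C>0. \<forall>x\<in>UNIV. \<forall>\<zeta>. norm (?D bs (x, \<zeta>)) \<le> C * weight (m + real (length as) - \<rho> * real (length bs)) \<zeta>"
        using BS_bounded_order[OF assms, of as bs] by (auto simp: bounded_order_def)
      show "((\<lambda>\<zeta>. ?D bs (x, \<zeta>)) has_derivative (\<lambda>v. ?D (v # bs) (x, \<zeta>))) (at \<zeta>)" for x \<zeta>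
      proof -
        have "((\<lambda>\<zeta>. (x, \<zeta>)) has_derivative (\<lambda>v. (0, v))) (at \<zeta>)" by (auto intro!: derivative_eq_intros)
        from diff_chain_at[OF this Cinf_on_has_derivative[OF Cinf_dir_derivs[OF C] UNIV_I]]
        show ?thesis by (simp add: o_def)
      qed
      show "symbol_family \<rho> UNIV k (m + real (length as) - \<rho> * real (length bs) - \<rho>) (\<lambda>x \<zeta>. ?D (v # bs) (x, \<zeta>))" for v
        using Suc[of "v # bs"] by (simp add: algebra_simps)
    qed
  qed
  from this[of "[]"] show "symbol_family \<rho> UNIV k (m + real (length as)) (\<lambda>x \<zeta>. dir_derivs (map (\<lambda>a. (a, 0)) as) p (x, \<zeta>))"
    by simp
qed

text \<open>At frequencies outside \<open>A\<close> all derivatives vanish, because the complement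
  is open. On \<open>A\<close> the base \<open>1 + norm \<xi> + norm \<eta>\<close> stays between 1
  and \<open>1 + 2 * R\<close>, so its powers are comparable. Such a symbol therefore has every
  order.\<close>

lemma BS_compact_support:
  fixes p :: "'n::finite triple \<Rightarrow> complex"
  assumes p: "p \<in> BS m \<rho> \<delta>" and A: "compact A" "\<And>x \<xi> \<eta>. (\<xi>, \<eta>) \<notin> A \<Longrightarrow> p (x, \<xi>, \<eta>) = 0"
  shows "p \<in> BS m' \<rho> \<delta>"
proof -
  obtain R where R: "R > 0" "\<And>\<zeta>. \<zeta> \<in> A \<Longrightarrow> norm \<zeta> \<le> R"
    using compact_imp_bounded[OF A(1)] bounded_pos by blast
  have "\<exists>C>0. \<forall>x \<xi> \<eta>. norm (pd3 \<alpha> \<beta> \<gamma> p (x, \<xi>, \<eta>)) \<le> C * (1 + norm \<xi> + norm \<eta>) powr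
          (m' + \<delta> * real (mi_order \<alpha>) - \<rho> * (real (mi_order \<beta>) + real (mi_order \<gamma>)))" for \<alpha> \<beta> \<gamma>
  proof -
    define e where "e = \<delta> * real (mi_order \<alpha>) - \<rho> * (real (mi_order \<beta>) + real (mi_order \<gamma>))"
    have me: "x + \<delta> * real (mi_order \<alpha>) - \<rho> * (real (mi_order \<beta>) + real (mi_order \<gamma>)) = x + e" for x
      by (simp add: e_def)
    obtain C where "C > 0" and C0: "\<And>x \<xi> \<eta>. norm (pd3 \<alpha> \<beta> \<gamma> p (x, \<xi>, \<eta>)) \<le> C * (1 + norm \<xi> + norm \<eta>) powr
        (m + \<delta> * real (mi_order \<alpha>) - \<rho> * (real (mi_order \<beta>) + real (mi_order \<gamma>)))"
      using p unfolding BS_def by blast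
    note C = \<open>C > 0\<close> C0[unfolded me]
    have "norm (pd3 \<alpha> \<beta> \<gamma> p (x, \<xi>, \<eta>)) \<le> (C * (1 + 2 * R) powr \<bar>m - m'\<bar>) * (1 + norm \<xi> + norm \<eta>) powr (m' + e)" for x \<xi> \<eta>
    proof (cases "(\<xi>, \<eta>) \<in> A")
      case False
      have "pd3 \<alpha> \<beta> \<gamma> p (x, \<xi>, \<eta>) = pd3 \<alpha> \<beta> \<gamma> (\<lambda>_. 0) (x, \<xi>, \<eta>)"
        unfolding pd3_def
      proof (rule dir_derivs_cong_open)
        show "open ((UNIV :: (real ^ 'n) set) \<times> - A)" using A(1) by (intro open_Times open_Compl compact_imp_closed) auto
      qed (use False A(2) in auto)
      also have "\<dots> = 0" by (simp add: pd3_def dir_derivs_zero)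
      finally show ?thesis using C(1) R(1) by simp
    next
      case True
      define s where "s = 1 + norm \<xi> + norm \<eta>"
      have s: "1 \<le> s" "s \<le> 1 + 2 * R"
        using R(2)[OF True] norm_fst_le[of \<xi> \<eta>] norm_snd_le[of \<eta> \<xi>] by (simp_all add: s_def)
      have "s powr (m + e) = s powr (m - m') * s powr (m' + e)" by (simp add: powr_add[symmetric])
      also have "s powr (m - m') \<le> (1 + 2 * R) powr \<bar>m - m'\<bar>"
        using s powr_mono[OF abs_ge_self[of "m - m'"], of s] powr_mono2[of "\<bar>m - m'\<bar>" s "1 + 2 * R"] by simp
      finally have "s powr (m + e) \<le> (1 + 2 * R) powr \<bar>m - m'\<bar> * s powr (m' + e)" by (simp add: mult_right_mono)
      then have "C * s powr (m + e) \<le> C * ((1 + 2 * R) powr \<bar>m - m'\<bar> * s powr (m' + e))"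
        using C(1) by (intro mult_left_mono) auto
      with C(2)[of x \<xi> \<eta>] show ?thesis by (simp add: s_def mult.assoc)
    qed
    moreover have "C * (1 + 2 * R) powr \<bar>m - m'\<bar> > 0" using C(1) R(1) by simp
    ultimately show ?thesis unfolding me by blast
  qed
  then show ?thesis using p unfolding BS_def by blast
qed

section \<open>Test functions and mollification\<close>

lemma not_in_tsupp: "x \<notin> tsupp f \<Longrightarrow> f x = 0"
  unfolding tsupp_def using closure_subset[of "{x. f x \<noteq> 0}"] by blast

lemma tsupp_subsetI: "closed K \<Longrightarrow> (\<And>x. f x \<noteq> 0 \<Longrightarrow> x \<in> K) \<Longrightarrow> tsupp f \<subseteq> K"
  unfolding tsupp_def by (rule closure_minimal) auto

lemma test_funI:
  fixes f :: "'a::euclidean_space \<Rightarrow> complex"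
  assumes "Cinf_on UNIV f" "compact K" "\<And>x. f x \<noteq> 0 \<Longrightarrow> x \<in> K"
  shows "test_fun f"
proof -
  have "tsupp f \<subseteq> K" using assms by (intro tsupp_subsetI compact_imp_closed)
  moreover have "closed (tsupp f)" by (simp add: tsupp_def)
  ultimately have "compact (tsupp f)" using compact_Int_closed[OF assms(2)] by (metis inf.absorb_iff2)
  with assms(1) show ?thesis by (simp add: test_fun_def)
qed

lemma test_fun_Cinf: "test_fun f \<Longrightarrow> Cinf_on UNIV f"
  by (simp add: test_fun_def)

lemma test_fun_compact: "test_fun f \<Longrightarrow> compact (tsupp f)"
  by (simp add: test_fun_def)

lemma test_fun_continuous: "test_fun f \<Longrightarrow> continuous_on S f"
  using Cinf_on_continuous[OF test_fun_Cinf] continuous_on_subset by blast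

lemma integrable_compact_support:
  fixes f :: "'a::euclidean_space \<Rightarrow> complex"
  assumes "continuous_on K f" "compact K" "\<And>x. x \<notin> K \<Longrightarrow> f x = 0"
  shows "integrable lborel f"
proof -
  have "integrable lborel (\<lambda>x. indicator K x *\<^sub>R f x)" by (rule borel_integrable_compact[OF assms(2,1)])
  moreover have "(\<lambda>x. indicator K x *\<^sub>R f x) = f" using assms(3) by (auto simp: indicator_def fun_eq_iff)
  ultimately show ?thesis by simp
qed

lemma test_fun_integrable: "test_fun f \<Longrightarrow> integrable lborel f"
  by (rule integrable_compact_support[OF test_fun_continuous test_fun_compact not_in_tsupp])

lemma tsupp_dir_derivs:
  fixes f :: "'a::euclidean_space \<Rightarrow> complex"
  shows "tsupp (dir_derivs vs f) \<subseteq> tsupp f"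
proof (rule tsupp_subsetI)
  show "closed (tsupp f)" by (simp add: tsupp_def)
  fix x assume x: "dir_derivs vs f x \<noteq> 0"
  show "x \<in> tsupp f"
  proof (rule ccontr)
    assume "x \<notin> tsupp f"
    moreover have "open (- tsupp f)" by (simp add: tsupp_def open_Compl)
    ultimately have "dir_derivs vs f x = dir_derivs vs (\<lambda>_. 0) x"
      by (intro dir_derivs_cong_open[of "- tsupp f"]) (auto simp: not_in_tsupp)
    with x show False by (simp add: dir_derivs_zero)
  qed
qed

lemma test_fun_dir_derivs:
  assumes "test_fun f" shows "test_fun (dir_derivs vs f)"
proof (rule test_funI[OF Cinf_dir_derivs[OF test_fun_Cinf[OF assms]] test_fun_compact[OF assms]])
  fix x assume "dir_derivs vs f x \<noteq> 0"
  then show "x \<in> tsupp f" using tsupp_dir_derivs not_in_tsupp by blast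
qed

lemma test_fun_add:
  assumes "test_fun f" "test_fun g" shows "test_fun (\<lambda>u. f u + g u)" "tsupp (\<lambda>u. f u + g u) \<subseteq> tsupp f \<union> tsupp g"
proof -
  have s: "u \<in> tsupp f \<union> tsupp g" if "f u + g u \<noteq> 0" for u
    by (rule ccontr) (use that not_in_tsupp[of u f] not_in_tsupp[of u g] in simp)
  show "test_fun (\<lambda>u. f u + g u)"
    by (rule test_funI[OF Cinf_on_add[OF test_fun_Cinf test_fun_Cinf open_UNIV], where K = "tsupp f \<union> tsupp g"])
      (use assms s in \<open>auto intro: compact_Un test_fun_compact\<close>)
  show "tsupp (\<lambda>u. f u + g u) \<subseteq> tsupp f \<union> tsupp g"
    using s by (intro tsupp_subsetI closed_Un) (auto simp: tsupp_def)
qed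

lemma test_fun_mult:
  assumes "test_fun f" "Cinf_on UNIV g" shows "test_fun (\<lambda>u. g u * f u)" "tsupp (\<lambda>u. g u * f u) \<subseteq> tsupp f"
proof -
  have s: "u \<in> tsupp f" if "g u * f u \<noteq> 0" for u using that not_in_tsupp[of u f] by auto
  show "test_fun (\<lambda>u. g u * f u)"
    by (rule test_funI[OF Cinf_on_mult[OF assms(2) test_fun_Cinf open_UNIV]])
      (use assms s in \<open>auto intro: test_fun_compact\<close>)
  show "tsupp (\<lambda>u. g u * f u) \<subseteq> tsupp f" using s by (intro tsupp_subsetI) (auto simp: tsupp_def)
qed

text \<open>Uniform continuity holds on the compact unit neighbourhood \<open>K\<close> of the
  support; two points closer than 1 either both lie in \<open>K\<close> or both give the value
  0.\<close>

lemma test_fun_uniformly_continuous: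
  fixes f :: "'a::euclidean_space \<Rightarrow> complex"
  assumes "test_fun f" "e > 0"
  shows "\<exists>d>0. \<forall>u v. norm (u - v) < d \<longrightarrow> norm (f u - f v) < e"
proof -
  define K where "K = {x + y |x y. x \<in> tsupp f \<and> y \<in> cball 0 1}"
  have "compact K" unfolding K_def by (intro compact_sums test_fun_compact assms compact_cball)
  then have "uniformly_continuous_on K f"
    by (intro compact_uniformly_continuous test_fun_continuous assms)
  then obtain d where d: "d > 0" "\<And>u v. u \<in> K \<Longrightarrow> v \<in> K \<Longrightarrow> dist v u < d \<Longrightarrow> dist (f v) (f u) < e"
    using assms(2) unfolding uniformly_continuous_on_def by blast
  have K: "v \<in> K" if "u \<in> tsupp f" "norm (u - v) < 1" for u v
    unfolding K_def using that by (intro CollectI exI[of _ u] exI[of _ "v - u"]) (auto simp: norm_minus_commute)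
  have "norm (f u - f v) < e" if uv: "norm (u - v) < min d 1" for u v
  proof (cases "u \<in> tsupp f \<or> v \<in> tsupp f")
    case True
    then have "u \<in> K" "v \<in> K" using K[of u u] K[of u v] K[of v u] K[of v v] uv by (auto simp: norm_minus_commute)
    then show ?thesis using d(2)[of v u] uv by (auto simp: dist_norm)
  qed (use not_in_tsupp[of u f] not_in_tsupp[of v f] assms(2) in simp)
  with d(1) show ?thesis by (intro exI[of _ "min d 1"]) auto
qed

lemma finite_family_modulus:
  assumes "finite L" "\<And>l. l \<in> L \<Longrightarrow> \<exists>d>0::real. \<forall>u v. norm (u - v) < d \<longrightarrow> P l u v"
  shows "\<exists>d>0. \<forall>l\<in>L. \<forall>u v. norm (u - v) < d \<longrightarrow> P l u v"
  using assms
proof (induction L rule: finite_induct)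
  case (insert l L)
  then obtain d d' where "d > 0" "\<forall>l\<in>L. \<forall>u v. norm (u - v) < d \<longrightarrow> P l u v" "d' > 0" "\<forall>u v. norm (u - v) < d' \<longrightarrow> P l u v"
    by (metis insertI1 insertI2)
  then show ?case by (intro exI[of _ "min d d'"]) auto
qed (auto intro: exI[of _ 1])

lemma test_fun_translate:
  fixes f :: "'a::euclidean_space \<Rightarrow> complex"
  assumes "test_fun f" shows "test_fun (\<lambda>u. f (u - c))"
proof (rule test_funI)
  show "Cinf_on UNIV (\<lambda>u. f (u - c))"
    using Cinf_on_affine[OF bounded_linear_ident test_fun_Cinf[OF assms], of "- c"] by simp
  show "compact ((\<lambda>x. c + x) ` tsupp f)" by (intro compact_translation test_fun_compact assms)
  show "u \<in> (\<lambda>x. c + x) ` tsupp f" if "f (u - c) \<noteq> 0" for u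
    using that not_in_tsupp[of "u - c" f] by (intro image_eqI[of _ _ "u - c"]) auto
qed

lemma dir_derivs_translate_minus:
  fixes f :: "'a::euclidean_space \<Rightarrow> complex"
  assumes "test_fun f" shows "dir_derivs vs (\<lambda>u. f (u - c)) = (\<lambda>u. dir_derivs vs f (u - c))"
  using dir_derivs_translate[OF test_fun_Cinf[OF assms], of vs "- c"] by simp

section \<open>Convolution and mollifiers\<close>

lemma integral_reflect:
  fixes f :: "'e::euclidean_space \<Rightarrow> complex"
  assumes "f \<in> borel_measurable borel"
  shows "(LINT t|lborel. f (u - t)) = (LINT t|lborel. f t)"
proof -
  have "(LINT t|lborel. f (u - t)) = (LINT t|lborel. (\<lambda>t. f (- t)) (t + - u))" by simp
  also have "\<dots> = (LINT t|lborel. f (- t))" by (rule integral_translate)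
  also have "\<dots> = (LINT t|distr lborel borel uminus. f t)" using assms by (subst integral_distr) auto
  also have "distr lborel borel uminus = (lborel :: 'e measure)"
    using lborel_affine[of "-1" "0 :: 'e"] by (simp add: density_1)
  finally show ?thesis .
qed

text \<open>The derivative of \<open>\<phi> (u - t) * \<theta> t\<close> in \<open>t\<close>
  integrates to zero, and the sign from the reflected argument cancels the one from integration by
  parts. Directions are moved one at a time; \<open>dir_derivs_perm\<close> restores the order of
  the list.\<close>

lemma convolution_move_derivs:
  fixes \<phi> \<theta> :: "'e::euclidean_space \<Rightarrow> complex"
  assumes "test_fun \<phi>" "test_fun \<theta>"
  shows "(LINT t|lborel. dir_derivs vs \<phi> (u - t) * \<theta> t) = (LINT t|lborel. \<phi> (u - t) * dir_derivs vs \<theta> t)"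
  using assms(2)
proof (induction vs arbitrary: \<theta>)
  case (Cons v vs)
  let ?g = "dir_derivs vs \<phi>"
  let ?dg = "\<lambda>t. frechet_derivative ?g (at t)" and ?dt = "\<lambda>t. frechet_derivative \<theta> (at t)"
  have tg: "test_fun ?g" by (rule test_fun_dir_derivs[OF assms(1)])
  have tdg: "test_fun (\<lambda>t. ?dg t v)" using test_fun_dir_derivs[OF assms(1), of "v # vs"] by simp
  have tdt: "test_fun (\<lambda>t. ?dt t v)" using test_fun_dir_derivs[OF Cons.prems, of "[v]"] by simp
  have cs: "continuous_on UNIV (\<lambda>t. f (u - t) * g t)" "integrable lborel (\<lambda>t. f (u - t) * g t)"
    if "test_fun f" "test_fun g" for f g :: "'e \<Rightarrow> complex"
  proof -
    show c: "continuous_on UNIV (\<lambda>t. f (u - t) * g t)"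
      by (intro continuous_intros test_fun_continuous[OF that(2)]
          continuous_on_compose2[OF test_fun_continuous[OF that(1), of UNIV]]) auto
    show "integrable lborel (\<lambda>t. f (u - t) * g t)"
      by (rule integrable_compact_support[OF continuous_on_subset[OF c] test_fun_compact[OF that(2)]])
        (auto simp: not_in_tsupp)
  qed
  have i1: "integrable lborel (\<lambda>t. ?g (u - t) * ?dt t v)" by (rule cs(2)[OF tg tdt])
  have i2: "integrable lborel (\<lambda>t. ?dg (u - t) v * \<theta> t)" by (rule cs(2)[OF tdg Cons.prems])
  have n: "?dg t (- v) = - ?dg t v" for t
    by (rule linear_neg[OF has_derivative_linear[OF Cinf_on_has_derivative[OF test_fun_Cinf[OF tg] UNIV_I]]])
  have "(LINT t|lborel. ?g (u - t) * ?dt t v + ?dg (u - t) (- v) * \<theta> t) = 0"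
  proof (rule integral_directional_derivative_zero[where F = "\<lambda>t. ?g (u - t) * \<theta> t"
        and F' = "\<lambda>t v. ?g (u - t) * ?dt t v + ?dg (u - t) (- v) * \<theta> t"])
    fix t
    have "((\<lambda>t. u - t) has_derivative (\<lambda>v. - v)) (at t)" by (auto intro!: derivative_eq_intros)
    from diff_chain_at[OF this Cinf_on_has_derivative[OF test_fun_Cinf[OF tg] UNIV_I]]
    have "((\<lambda>t. ?g (u - t)) has_derivative (\<lambda>v. ?dg (u - t) (- v))) (at t)" by (simp add: o_def)
    then show "((\<lambda>t. ?g (u - t) * \<theta> t) has_derivative (\<lambda>v. ?g (u - t) * ?dt t v + ?dg (u - t) (- v) * \<theta> t)) (at t)"
      by (rule has_derivative_mult[OF _ Cinf_on_has_derivative[OF test_fun_Cinf[OF Cons.prems] UNIV_I]])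
  next
    show "integrable lborel (\<lambda>t. ?g (u - t) * \<theta> t)" by (rule cs(2)[OF tg Cons.prems])
    show "continuous_on UNIV (\<lambda>t. ?g (u - t) * ?dt t v + ?dg (u - t) (- v) * \<theta> t)"
      unfolding n mult_minus_left by (intro continuous_intros cs(1) tg tdt tdg Cons.prems)
    show "integrable lborel (\<lambda>t. ?g (u - t) * ?dt t v + ?dg (u - t) (- v) * \<theta> t)"
      unfolding n mult_minus_left
      by (intro Bochner_Integration.integrable_add Bochner_Integration.integrable_minus i1 i2)
  qed
  then have "(LINT t|lborel. ?dg (u - t) v * \<theta> t) = (LINT t|lborel. ?g (u - t) * ?dt t v)"
    using Bochner_Integration.integral_diff[OF i1 i2] by (simp add: n)
  also have "\<dots> = (LINT t|lborel. \<phi> (u - t) * dir_derivs vs (\<lambda>t. ?dt t v) t)"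
    by (rule Cons.IH[OF tdt])
  also have "dir_derivs vs (\<lambda>t. ?dt t v) = dir_derivs (v # vs) \<theta>"
  proof -
    have "dir_derivs vs (\<lambda>t. ?dt t v) = dir_derivs (vs @ [v]) \<theta>" by (simp add: dir_derivs_append)
    also have "\<dots> = dir_derivs (v # vs) \<theta>" by (rule dir_derivs_perm[OF test_fun_Cinf[OF Cons.prems]]) simp
    finally show ?thesis .
  qed
  finally show ?case by simp
qed simp

text \<open>Values are complex in order to stay within test functions; the second clause says that
  they are real and nonnegative.\<close>

definition mollifier :: "real \<Rightarrow> ('e::euclidean_space \<Rightarrow> complex) \<Rightarrow> bool" where
  "mollifier \<epsilon> \<theta> \<longleftrightarrow> test_fun \<theta> \<and> (\<forall>u. \<theta> u = complex_of_real (norm (\<theta> u))) \<and>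
     (LINT u|lborel. \<theta> u) = 1 \<and> (\<forall>u. \<theta> u \<noteq> 0 \<longrightarrow> norm u \<le> \<epsilon>)"

text \<open>Nonnegativity and total mass 1 make the convolution an average of values of
  \<open>\<phi>\<close> within distance \<open>\<epsilon>\<close> of \<open>u\<close>.\<close>

lemma mollifier_error:
  assumes "mollifier \<epsilon> \<theta>" "test_fun \<phi>" "\<And>v. norm (u - v) \<le> \<epsilon> \<Longrightarrow> norm (\<phi> u - \<phi> v) \<le> e"
  shows "norm (\<phi> u - (LINT t|lborel. \<phi> (u - t) * \<theta> t)) \<le> e"
proof -
  have \<theta>: "test_fun \<theta>" "\<And>u. \<theta> u = complex_of_real (norm (\<theta> u))" "(LINT u|lborel. \<theta> u) = 1" "\<And>u. \<theta> u \<noteq> 0 \<Longrightarrow> norm u \<le> \<epsilon>"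
    using assms(1) unfolding mollifier_def by blast+
  have c: "continuous_on UNIV (\<lambda>t. \<phi> (u - t) * \<theta> t)"
    by (intro continuous_intros test_fun_continuous[OF \<theta>(1)]
        continuous_on_compose2[OF test_fun_continuous[OF assms(2), of UNIV]]) auto
  have i: "integrable lborel (\<lambda>t. \<phi> (u - t) * \<theta> t)"
    by (rule integrable_compact_support[OF continuous_on_subset[OF c] test_fun_compact[OF \<theta>(1)]])
      (auto simp: not_in_tsupp)
  have i\<theta>: "integrable lborel \<theta>" by (rule test_fun_integrable[OF \<theta>(1)])
  have n1: "(LINT t|lborel. norm (\<theta> t)) = 1"
  proof -
    have "complex_of_real (LINT t|lborel. norm (\<theta> t)) = (LINT t|lborel. complex_of_real (norm (\<theta> t)))" by simp
    also have "\<dots> = 1" using \<theta>(2,3) by simp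
    finally show ?thesis by (metis of_real_eq_1_iff)
  qed
  have "\<phi> u - (LINT t|lborel. \<phi> (u - t) * \<theta> t) = (LINT t|lborel. \<phi> u * \<theta> t - \<phi> (u - t) * \<theta> t)"
    by (subst Bochner_Integration.integral_diff) (auto simp: \<theta>(3) intro: i integrable_mult_right i\<theta>)
  also have "norm \<dots> \<le> (LINT t|lborel. norm (\<phi> u * \<theta> t - \<phi> (u - t) * \<theta> t))" by (rule integral_norm_bound)
  also have "\<dots> \<le> (LINT t|lborel. e * norm (\<theta> t))"
  proof (intro integral_mono integrable_norm Bochner_Integration.integrable_diff integrable_mult_right i i\<theta>)
    fix t
    have "norm (\<phi> u * \<theta> t - \<phi> (u - t) * \<theta> t) = norm (\<phi> u - \<phi> (u - t)) * norm (\<theta> t)"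
      by (simp add: norm_mult[symmetric] left_diff_distrib)
    also have "\<dots> \<le> e * norm (\<theta> t)"
      using assms(3)[of "u - t"] \<theta>(4)[of t] by (cases "\<theta> t = 0") (auto intro: mult_right_mono)
    finally show "norm (\<phi> u * \<theta> t - \<phi> (u - t) * \<theta> t) \<le> e * norm (\<theta> t)" .
  qed
  also have "\<dots> = e" using n1 by simp
  finally show ?thesis .
qed

text \<open>The points \<open>t i\<close> and coefficients \<open>c i\<close> depend on
  \<open>\<phi>\<close> and \<open>d\<close> but not on \<open>\<theta>\<close>. The same sum can
  thus be used for all derivatives of a mollifier at once, each entering only through its modulus of
  continuity.\<close>

lemma Riemann_sum_convolution:
  fixes \<phi> :: "'e::euclidean_space \<Rightarrow> complex"
  assumes "test_fun \<phi>" "d > 0"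
  shows "\<exists>n t c. (\<forall>i<n. t i \<in> tsupp \<phi>) \<and> (\<forall>(\<theta> :: 'e \<Rightarrow> complex) e. test_fun \<theta> \<longrightarrow>
    (\<forall>u v. norm (u - v) < d \<longrightarrow> norm (\<theta> u - \<theta> v) \<le> e) \<longrightarrow>
    (\<forall>u. norm ((LINT s|lborel. \<phi> (u - s) * \<theta> s) - (\<Sum>i<(n::nat). c i * \<theta> (u - t i)))
       \<le> e * (LINT s|lborel. norm (\<phi> s))))"
proof -
  let ?A = "tsupp \<phi>"
  obtain T where T: "finite T" "T \<subseteq> ?A" "?A \<subseteq> (\<Union>x\<in>T. ball x d)"
    by (rule compactE_image[OF test_fun_compact[OF assms(1)], of ?A "\<lambda>x. ball x d"]) (use assms(2) in auto)
  obtain t n where t: "T = t ` {i::nat. i < n}" using finite_imp_nat_seg_image_inj_on[OF T(1)] by metis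
  \<comment> \<open>The cells of the Riemann sum: a finite cover by balls made disjoint, so that
    each point of the support lies in exactly one cell.\<close>
  define B where "B = disjointed (\<lambda>i. ball (t i) d)"
  have "{i. i < n} = {0..<n}" by auto
  then have cover: "?A \<subseteq> (\<Union>i<n. B i)"
    using T(3) finite_UN_disjointed_eq[of "\<lambda>i. ball (t i) d" n] unfolding t B_def by (auto simp: lessThan_atLeast0)
  have disj: "i = j" if "s \<in> B i" "s \<in> B j" for s i j
    using that disjoint_family_disjointed[of "\<lambda>i. ball (t i) d"] unfolding B_def disjoint_family_on_def by blast
  have Bsub: "B i \<subseteq> ball (t i) d" for i unfolding B_def by (rule disjointed_subset)
  have Bm[measurable]: "B i \<in> sets borel" for i unfolding B_def disjointed_def by auto
  define c where "c i = (LINT s|lborel. indicator (B i) s *\<^sub>R \<phi> s)" for i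
  have i\<phi>: "integrable lborel \<phi>" by (rule test_fun_integrable[OF assms(1)])
  have ic: "integrable lborel (\<lambda>s. indicator (B i) s *\<^sub>R \<phi> s)" for i
    using i\<phi> Bm by (intro integrable_mult_indicator) auto
  show ?thesis
  proof (intro exI[of _ n] exI[of _ t] exI[of _ c] conjI allI impI)
    show "t i \<in> ?A" if "i < n" for i using that T(2) t by auto
    fix \<theta> :: "'e \<Rightarrow> complex" and e u
    assume \<theta>: "test_fun \<theta>" and e: "\<forall>u v. norm (u - v) < d \<longrightarrow> norm (\<theta> u - \<theta> v) \<le> e"
    have c1: "continuous_on UNIV (\<lambda>s. \<phi> s * \<theta> (u - s))"
      by (intro continuous_intros test_fun_continuous[OF assms(1)]
          continuous_on_compose2[OF test_fun_continuous[OF \<theta>, of UNIV]]) auto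
    have i1: "integrable lborel (\<lambda>s. \<phi> s * \<theta> (u - s))"
      by (rule integrable_compact_support[OF continuous_on_subset[OF c1] test_fun_compact[OF assms(1)]])
        (auto simp: not_in_tsupp)
    let ?R = "\<lambda>s. \<Sum>i<n. (indicator (B i) s *\<^sub>R \<phi> s) * \<theta> (u - t i)"
    have iR: "integrable lborel ?R" by (intro Bochner_Integration.integrable_sum integrable_mult_left ic)
    have "(LINT s|lborel. \<phi> (u - s) * \<theta> s) = (LINT s|lborel. \<phi> s * \<theta> (u - s))"
      using integral_reflect[OF borel_measurable_continuous_onI[OF c1], of u] by simp
    moreover have "(\<Sum>i<n. c i * \<theta> (u - t i)) = (LINT s|lborel. ?R s)"
    proof -
      have "(LINT s|lborel. ?R s) = (\<Sum>i<n. LINT s|lborel. (indicator (B i) s *\<^sub>R \<phi> s) * \<theta> (u - t i))"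
        by (intro Bochner_Integration.integral_sum integrable_mult_left ic)
      also have "\<dots> = (\<Sum>i<n. c i * \<theta> (u - t i))" by (simp only: c_def integral_mult_left_zero)
      finally show ?thesis by simp
    qed
    ultimately have "norm ((LINT s|lborel. \<phi> (u - s) * \<theta> s) - (\<Sum>i<n. c i * \<theta> (u - t i)))
        = norm (LINT s|lborel. \<phi> s * \<theta> (u - s) - ?R s)"
      using Bochner_Integration.integral_diff[OF i1 iR] by simp
    also have "\<dots> \<le> (LINT s|lborel. norm (\<phi> s * \<theta> (u - s) - ?R s))" by (rule integral_norm_bound)
    also have "\<dots> \<le> (LINT s|lborel. e * norm (\<phi> s))"
    proof (intro integral_mono integrable_norm Bochner_Integration.integrable_diff i1 iR integrable_mult_right i\<phi>)
      fix s
      show "norm (\<phi> s * \<theta> (u - s) - ?R s) \<le> e * norm (\<phi> s)"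
      proof (cases "s \<in> ?A")
        case False
        then show ?thesis by (simp add: not_in_tsupp)
      next
        case True
        then obtain i where i: "i < n" "s \<in> B i" using cover by auto
        have "?R s = (\<Sum>j<n. if j = i then \<phi> s * \<theta> (u - t i) else 0)"
          using disj i(2) by (intro sum.cong) (auto simp: indicator_def)
        also have "\<dots> = \<phi> s * \<theta> (u - t i)" using i(1) by simp
        finally have A: "norm (\<phi> s * \<theta> (u - s) - ?R s) = norm (\<phi> s) * norm (\<theta> (u - s) - \<theta> (u - t i))"
          by (simp add: norm_mult[symmetric] right_diff_distrib)
        have "norm (\<theta> (u - s) - \<theta> (u - t i)) \<le> e"
        proof -
          have "norm ((u - s) - (u - t i)) < d" using i(2) Bsub[of i] by (auto simp: dist_norm)
          then show ?thesis using e by blast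
        qed
        then have "norm (\<phi> s) * norm (\<theta> (u - s) - \<theta> (u - t i)) \<le> norm (\<phi> s) * e"
          by (rule mult_left_mono) simp
        then show ?thesis unfolding A by (simp only: mult.commute)
      qed
    qed
    also have "\<dots> = e * (LINT s|lborel. norm (\<phi> s))" by simp
    finally show "norm ((LINT s|lborel. \<phi> (u - s) * \<theta> s) - (\<Sum>i<n. c i * \<theta> (u - t i))) \<le> e * (LINT s|lborel. norm (\<phi> s))" .
  qed
qed

lemma functional_sum:
  assumes "\<And>\<phi> \<psi>. test_fun \<phi> \<Longrightarrow> test_fun \<psi> \<Longrightarrow> tsupp \<phi> \<subseteq> S \<Longrightarrow> tsupp \<psi> \<subseteq> S \<Longrightarrow> D (\<lambda>u. \<phi> u + \<psi> u) = D \<phi> + (D \<psi> :: complex)"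
    and "\<And>c \<phi>. test_fun \<phi> \<Longrightarrow> tsupp \<phi> \<subseteq> S \<Longrightarrow> D (\<lambda>u. c * \<phi> u) = c * D \<phi>"
    and "\<And>i. i < (n::nat) \<Longrightarrow> test_fun (f i) \<and> tsupp (f i) \<subseteq> S \<and> D (f i) = 0"
    and "test_fun f0" "tsupp f0 \<subseteq> S"
  shows "test_fun (\<lambda>u. f0 u + (\<Sum>i<n. c i * f i u)) \<and> tsupp (\<lambda>u. f0 u + (\<Sum>i<n. c i * f i u)) \<subseteq> S \<and>
    D (\<lambda>u. f0 u + (\<Sum>i<n. c i * f i u)) = D f0"
  using assms(3)
proof (induction n)
  case 0
  then show ?case using assms(4,5) by simp
next
  case (Suc n)
  let ?g = "\<lambda>u. f0 u + (\<Sum>i<n. c i * f i u)"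
  have g: "test_fun ?g" "tsupp ?g \<subseteq> S" "D ?g = D f0" using Suc by auto
  have f: "test_fun (f n)" "tsupp (f n) \<subseteq> S" "D (f n) = 0" using Suc.prems by auto
  have cf: "test_fun (\<lambda>u. c n * f n u)" "tsupp (\<lambda>u. c n * f n u) \<subseteq> S"
    using test_fun_mult[OF f(1) Cinf_on_const] f(2) by blast+
  have "(\<lambda>u. f0 u + (\<Sum>i<Suc n. c i * f i u)) = (\<lambda>u. ?g u + c n * f n u)" by (simp add: add.assoc)
  then show ?case
    using test_fun_add[OF g(1) cf(1)] g cf assms(1)[OF g(1) cf(1) g(2) cf(2)] assms(2)[OF f(1,2), of "c n"] f(3) by auto
qed

text \<open>A test function is approximated, with all its derivatives, by Riemann sums of its convolution
  with a mollifier, that is by linear combinations of translates of the mollifier.\<close>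

lemma functional_vanishes:
  fixes D :: "('e::euclidean_space \<Rightarrow> complex) \<Rightarrow> complex"
  assumes S: "open S"
    and add: "\<And>\<phi> \<psi>. test_fun \<phi> \<Longrightarrow> test_fun \<psi> \<Longrightarrow> tsupp \<phi> \<subseteq> S \<Longrightarrow> tsupp \<psi> \<subseteq> S \<Longrightarrow> D (\<lambda>u. \<phi> u + \<psi> u) = D \<phi> + D \<psi>"
    and scale: "\<And>c \<phi>. test_fun \<phi> \<Longrightarrow> tsupp \<phi> \<subseteq> S \<Longrightarrow> D (\<lambda>u. c * \<phi> u) = c * D \<phi>"
    and est: "\<And>A. compact A \<Longrightarrow> A \<subseteq> S \<Longrightarrow> \<exists>C N. \<forall>\<phi> e. test_fun \<phi> \<longrightarrow> tsupp \<phi> \<subseteq> A \<longrightarrow>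
        (\<forall>vs. set vs \<subseteq> Basis \<longrightarrow> length vs \<le> N \<longrightarrow> (\<forall>u. norm (dir_derivs vs \<phi> u) \<le> e)) \<longrightarrow> norm (D \<phi>) \<le> C * e"
    and moll: "\<And>\<epsilon>. \<epsilon> > 0 \<Longrightarrow> \<exists>\<theta>. mollifier \<epsilon> \<theta> \<and> (\<forall>c. tsupp (\<lambda>u. \<theta> (u - c)) \<subseteq> S \<longrightarrow> D (\<lambda>u. \<theta> (u - c)) = 0)"
    and \<phi>: "test_fun \<phi>" "tsupp \<phi> \<subseteq> S"
  shows "D \<phi> = 0"
proof -
  \<comment> \<open>A margin around the support inside \<open>S\<close>: translates of small
    mollifiers centred in the support remain admissible.\<close>
  obtain \<eta> where \<eta>: "\<eta> > 0" "(\<Union>x\<in>tsupp \<phi>. cball x \<eta>) \<subseteq> S"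
  proof (cases "tsupp \<phi> = {}")
    case True then show ?thesis using that[of 1] by simp
  next
    case False
    then show ?thesis using compact_subset_open_imp_cball_epsilon_subset[OF test_fun_compact[OF \<phi>(1)] S \<phi>(2)] that by blast
  qed
  \<comment> \<open>One compact set carries all functions below, so that \<open>C\<close> and
    \<open>N\<close> are fixed before the mollifier is chosen.\<close>
  define A where "A = {x + y |x y. x \<in> tsupp \<phi> \<and> y \<in> cball 0 \<eta>}"
  have A: "compact A" unfolding A_def by (intro compact_sums test_fun_compact \<phi> compact_cball)
  have AS: "A \<subseteq> S" using \<eta>(2) unfolding A_def by (auto simp: subset_eq dist_norm)
  have \<phi>A: "tsupp \<phi> \<subseteq> A"
  proof
    fix x assume "x \<in> tsupp \<phi>" then show "x \<in> A" unfolding A_def using \<eta>(1) by (intro CollectI exI[of _ x] exI[of _ 0]) auto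
  qed
  obtain C N where CN: "\<And>\<phi> e. test_fun \<phi> \<Longrightarrow> tsupp \<phi> \<subseteq> A \<Longrightarrow>
        (\<And>vs u. set vs \<subseteq> Basis \<Longrightarrow> length vs \<le> N \<Longrightarrow> norm (dir_derivs vs \<phi> u) \<le> e) \<Longrightarrow> norm (D \<phi>) \<le> C * e"
    using est[OF A AS] by blast
  define L where "L = {vs::'e list. set vs \<subseteq> Basis \<and> length vs \<le> N}"
  have L: "finite L" unfolding L_def by (rule finite_lists_length_le) simp
  define I where "I = (LINT s|lborel. norm (\<phi> s))"
  have I: "I \<ge> 0" unfolding I_def by simp
  have bound: "norm (D \<phi>) \<le> C * (2 * e)" if e: "e > 0" for e
  proof -
    have "\<exists>d>0. \<forall>vs\<in>L. \<forall>u v. norm (u - v) < d \<longrightarrow> norm (dir_derivs vs \<phi> u - dir_derivs vs \<phi> v) < e"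
      by (rule finite_family_modulus[OF L]) (rule test_fun_uniformly_continuous[OF test_fun_dir_derivs[OF \<phi>(1)] e])
    then obtain d where d: "d > 0" "\<And>vs u v. vs \<in> L \<Longrightarrow> norm (u - v) < d \<Longrightarrow> norm (dir_derivs vs \<phi> u - dir_derivs vs \<phi> v) < e"
      by blast
    \<comment> \<open>The half is there because mollifiers live in closed balls, while the modulus
      \<open>d\<close> is strict.\<close>
    define \<epsilon> where "\<epsilon> = min \<eta> (d / 2)"
    have \<epsilon>: "\<epsilon> > 0" "\<epsilon> \<le> \<eta>" "\<epsilon> < d" using d(1) \<eta>(1) by (auto simp: \<epsilon>_def)
    obtain \<theta> where \<theta>: "mollifier \<epsilon> \<theta>" "\<And>c. tsupp (\<lambda>u. \<theta> (u - c)) \<subseteq> S \<Longrightarrow> D (\<lambda>u. \<theta> (u - c)) = 0"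
      using moll[OF \<epsilon>(1)] by blast
    have t\<theta>: "test_fun \<theta>" and s\<theta>: "\<And>u. \<theta> u \<noteq> 0 \<Longrightarrow> norm u \<le> \<epsilon>" using \<theta>(1) unfolding mollifier_def by blast+
    have e': "e / (I + 1) > 0" using e I by simp
    \<comment> \<open>This modulus depends on \<open>\<theta>\<close>, hence the mesh of the Riemann
      sum is chosen after the mollifier.\<close>
    have "\<exists>d>0. \<forall>vs\<in>L. \<forall>u v. norm (u - v) < d \<longrightarrow> norm (dir_derivs vs \<theta> u - dir_derivs vs \<theta> v) < e / (I + 1)"
      by (rule finite_family_modulus[OF L]) (rule test_fun_uniformly_continuous[OF test_fun_dir_derivs[OF t\<theta>] e'])
    then obtain d' where d': "d' > 0" "\<And>vs u v. vs \<in> L \<Longrightarrow> norm (u - v) < d' \<Longrightarrow> norm (dir_derivs vs \<theta> u - dir_derivs vs \<theta> v) < e / (I + 1)"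
      by blast
    obtain n t c where tc: "\<And>i. i < n \<Longrightarrow> t i \<in> tsupp \<phi>" "\<And>\<theta> e u. test_fun \<theta> \<Longrightarrow>
      (\<And>u v. norm (u - v) < d' \<Longrightarrow> norm (\<theta> u - \<theta> v) \<le> e) \<Longrightarrow>
      norm ((LINT s|lborel. \<phi> (u - s) * \<theta> s) - (\<Sum>i<(n::nat). c i * \<theta> (u - t i))) \<le> e * I"
      using Riemann_sum_convolution[OF \<phi>(1) d'(1)] unfolding I_def by blast
    let ?f = "\<lambda>i u. \<theta> (u - t i)"
    \<comment> \<open>\<open>\<phi>\<close> minus the Riemann sum: \<open>D\<close> takes the same
      value as on \<open>\<phi>\<close>, but all derivatives up to order \<open>N\<close> are
      small.\<close>
    let ?\<chi> = "\<lambda>u. \<phi> u + (\<Sum>i<n. (- c i) * ?f i u)"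
    have fA: "tsupp (?f i) \<subseteq> A" if "i < n" for i
    proof (rule tsupp_subsetI[OF compact_imp_closed[OF A]])
      fix u assume "\<theta> (u - t i) \<noteq> 0"
      then have "norm (u - t i) \<le> \<eta>" using s\<theta> \<epsilon>(2) by force
      then show "u \<in> A" unfolding A_def using tc(1)[OF that]
        by (intro CollectI exI[of _ "t i"] exI[of _ "u - t i"]) auto
    qed
    have f: "test_fun (?f i) \<and> tsupp (?f i) \<subseteq> S \<and> D (?f i) = 0" if "i < n" for i
      using test_fun_translate[OF t\<theta>] fA[OF that] AS \<theta>(2) by (meson order_trans)
    have S1: "test_fun ?\<chi> \<and> tsupp ?\<chi> \<subseteq> S \<and> D ?\<chi> = D \<phi>"
      by (rule functional_sum[OF add scale f \<phi>])
    have "tsupp ?\<chi> \<subseteq> A"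
    proof (rule tsupp_subsetI[OF compact_imp_closed[OF A]])
      fix u assume "?\<chi> u \<noteq> 0"
      then have "\<phi> u \<noteq> 0 \<or> (\<exists>i<n. ?f i u \<noteq> 0)" by (auto intro: ccontr)
      then show "u \<in> A" using \<phi>A fA not_in_tsupp[of u \<phi>] not_in_tsupp[of u "?f i" for i] by blast
    qed
    moreover have "norm (dir_derivs vs ?\<chi> u) \<le> 2 * e" if vs: "set vs \<subseteq> Basis" "length vs \<le> N" for vs u
    proof -
      have vL: "vs \<in> L" using vs by (simp add: L_def)
      have Cf: "Cinf_on UNIV (?f i)" for i by (rule test_fun_Cinf[OF test_fun_translate[OF t\<theta>]])
      have "dir_derivs vs ?\<chi> u = dir_derivs vs \<phi> u + (\<Sum>i<n. - c i * dir_derivs vs \<theta> (u - t i))"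
      proof -
        have Ccf: "Cinf_on UNIV (\<lambda>u. - c i * ?f i u)" for i by (intro Cinf_on_mult Cinf_on_const Cf open_UNIV)
        have "dir_derivs vs (\<lambda>u. - c i * ?f i u) = (\<lambda>u. - c i * dir_derivs vs \<theta> (u - t i))" for i
          by (simp only: dir_derivs_cmult[OF Cf] dir_derivs_translate_minus[OF t\<theta>])
        moreover have "dir_derivs vs ?\<chi> u = dir_derivs vs \<phi> u + (\<Sum>i<n. dir_derivs vs (\<lambda>u. - c i * ?f i u) u)"
          by (simp only: dir_derivs_add[OF test_fun_Cinf[OF \<phi>(1)] Cinf_on_sum[OF Ccf open_UNIV]] dir_derivs_sum[OF Ccf])
        ultimately show ?thesis by simp
      qed
      \<comment> \<open>The convolution is inserted: the first bracket is the mollification error of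
        a derivative of \<open>\<phi>\<close>, the second the Riemann error for a derivative of
        \<open>\<theta>\<close>. Moving the derivatives across identifies the two
        convolutions.\<close>
      also have "\<dots> = (dir_derivs vs \<phi> u - (LINT s|lborel. dir_derivs vs \<phi> (u - s) * \<theta> s))
         + ((LINT s|lborel. \<phi> (u - s) * dir_derivs vs \<theta> s) - (\<Sum>i<n. c i * dir_derivs vs \<theta> (u - t i)))"
        by (simp add: convolution_move_derivs[OF \<phi>(1) t\<theta>] sum_negf)
      also have "norm \<dots> \<le> e + e"
      proof (rule norm_triangle_le, rule add_mono)
        show "norm (dir_derivs vs \<phi> u - (LINT s|lborel. dir_derivs vs \<phi> (u - s) * \<theta> s)) \<le> e"
          by (rule mollifier_error[OF \<theta>(1) test_fun_dir_derivs[OF \<phi>(1)]])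
            (use d(2)[OF vL] \<epsilon>(3) in \<open>auto intro: less_imp_le\<close>)
        have "norm ((LINT s|lborel. \<phi> (u - s) * dir_derivs vs \<theta> s) - (\<Sum>i<n. c i * dir_derivs vs \<theta> (u - t i)))
          \<le> e / (I + 1) * I"
          by (rule tc(2)[OF test_fun_dir_derivs[OF t\<theta>]]) (use d'(2)[OF vL] in \<open>auto intro: less_imp_le\<close>)
        also have "\<dots> \<le> e" using e I by (simp add: field_simps)
        finally show "norm ((LINT s|lborel. \<phi> (u - s) * dir_derivs vs \<theta> s) - (\<Sum>i<n. c i * dir_derivs vs \<theta> (u - t i))) \<le> e" .
      qed
      finally show ?thesis by simp
    qed
    ultimately have "norm (D ?\<chi>) \<le> C * (2 * e)" using S1 by (intro CN) auto
    then show ?thesis using S1 by simp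
  qed
  have "norm (D \<phi>) \<le> 0"
  proof (rule field_le_epsilon)
    fix e :: real assume e: "e > 0"
    define e' where "e' = e / (2 * (\<bar>C\<bar> + 1))"
    have "e' > 0" using e by (simp add: e'_def)
    from bound[OF this] have "norm (D \<phi>) \<le> C * (2 * e')" .
    also have "\<dots> \<le> (\<bar>C\<bar> + 1) * (2 * e')" using \<open>e' > 0\<close> by (intro mult_right_mono) auto
    also have "\<dots> = e" by (simp add: e'_def field_simps)
    finally show "norm (D \<phi>) \<le> 0 + e" by simp
  qed
  then show ?thesis by simp
qed

section \<open>The kernel as a distribution\<close>

lemma weight_bound_test_fun:
  fixes f :: "'e::euclidean_space \<Rightarrow> complex"
  assumes "test_fun f" shows "\<exists>C>0. \<forall>i\<in>I. \<forall>\<zeta>. norm (f \<zeta>) \<le> C * weight \<nu> \<zeta>"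
proof -
  let ?h = "\<lambda>\<zeta>. norm (f \<zeta>) * weight (- \<nu>) \<zeta>"
  have "bounded (?h ` tsupp f)"
    by (intro compact_imp_bounded compact_continuous_image test_fun_compact assms
        continuous_intros test_fun_continuous continuous_on_weight)
  then obtain B where B: "B > 0" "\<forall>y\<in>?h ` tsupp f. norm y \<le> B" using bounded_pos by blast
  have "norm (f \<zeta>) \<le> B * weight \<nu> \<zeta>" for \<zeta>
  proof (cases "\<zeta> \<in> tsupp f")
    case True
    then have "?h \<zeta> \<le> B" using B(2) abs_ge_self[of "?h \<zeta>"] by force
    then have "?h \<zeta> * weight \<nu> \<zeta> \<le> B * weight \<nu> \<zeta>" by (intro mult_right_mono weight_nonneg)
    then show ?thesis using weight_add[of "- \<nu>" \<nu> \<zeta>] by (simp add: mult.assoc weight_zero)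
  qed (use B(1) in \<open>simp add: not_in_tsupp weight_nonneg\<close>)
  with B(1) show ?thesis by blast
qed

text \<open>With \<open>\<rho> = 0\<close> a derivative keeps the order, and compact support admits
  any order \<open>\<nu>\<close>, so the derivatives fall under the same statement.\<close>

lemma symbol_family_test_fun:
  fixes f :: "'e::euclidean_space \<Rightarrow> complex"
  assumes "test_fun f" shows "symbol_family 0 I k \<nu> (\<lambda>_. f)"
  using assms
proof (induction k arbitrary: f)
  case (0 f)
  show ?case unfolding symbol_family.simps(1)
    using weight_bound_test_fun[OF 0] test_fun_continuous[OF 0] by blast
next
  case (Suc k)
  show ?case
    by (rule symbol_family_SucI[where F' = "\<lambda>v _ \<zeta>. frechet_derivative f (at \<zeta>) v"])
      (use weight_bound_test_fun[OF Suc.prems] Cinf_on_has_derivative[OF test_fun_Cinf[OF Suc.prems] UNIV_I]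
        Suc.IH test_fun_dir_derivs[OF Suc.prems, of "[v]" for v] in auto)
qed

lemma fourier_eq_osc: "fourier f \<xi> = osc f (- \<xi>)"
  by (simp add: fourier_def osc_def wave_def inner_commute)

text \<open>The Fourier transform of a test function is an oscillatory integral whose amplitude has
  an integrable order, so integration by parts gives any decay. The exponents 0 and \<open>N\<close>
  are combined, since \<open>norm \<xi> ^ N\<close> gives nothing near the origin.\<close>

lemma fourier_decay:
  fixes f :: "real ^ 'n::finite \<Rightarrow> complex"
  assumes "test_fun f"
  shows "\<exists>C>0. \<forall>\<xi>. norm (fourier f \<xi>) \<le> C * weight (- real N) \<xi>"
proof -
  let ?n = "- real DIM(real ^ 'n) - 1"
  have f: "symbol_family 0 I k ?n (\<lambda>_::unit. f)" for I k by (rule symbol_family_test_fun[OF assms])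
  have "\<exists>C>0. \<forall>i\<in>UNIV. \<forall>u::real ^ 'n. norm u ^ k * norm (osc ((\<lambda>_::unit. f) i) u) \<le> C" for k
    by (rule osc_decay_norm[OF f]) (use f in \<open>auto intro!: exI[of _ ?n]\<close>)
  then obtain C where C: "\<And>k. C k > 0" "\<And>k u. norm u ^ k * norm (osc f u) \<le> C k" by (metis UNIV_I)
  have "norm (fourier f \<xi>) \<le> (2 ^ N * (C 0 + C N)) * weight (- real N) \<xi>" for \<xi>
  proof -
    let ?s = "norm \<xi>" and ?o = "norm (osc f (- \<xi>))"
    have "(1 + ?s) ^ N \<le> (2 * max 1 ?s) ^ N" by (intro power_mono) auto
    also have "\<dots> = 2 ^ N * max 1 ?s ^ N" by (simp add: power_mult_distrib)
    also have "max 1 ?s ^ N \<le> 1 + ?s ^ N" by (cases "1 \<le> ?s") (auto simp: max_def)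
    finally have "(1 + ?s) ^ N * ?o \<le> (2 ^ N * (1 + ?s ^ N)) * ?o" by (intro mult_right_mono) auto
    also have "\<dots> = 2 ^ N * (norm (- \<xi>) ^ 0 * ?o + norm (- \<xi>) ^ N * ?o)" by (simp add: algebra_simps)
    also have "\<dots> \<le> 2 ^ N * (C 0 + C N)" using C(2)[of "- \<xi>" 0] C(2)[of "- \<xi>" N] by (intro mult_left_mono add_mono) auto
    finally have "(1 + ?s) ^ N * ?o \<le> 2 ^ N * (C 0 + C N)" .
    moreover have "weight (- real N) \<xi> = 1 / (1 + ?s) ^ N" and "(1 + ?s) ^ N > 0"
      using one_plus_norm_pos[of \<xi>] by (auto simp: weight_def powr_minus_divide powr_realpow)
    ultimately show ?thesis by (simp add: fourier_eq_osc field_simps)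
  qed
  moreover have "2 ^ N * (C 0 + C N) > 0" using C(1)[of 0] C(1)[of N] by simp
  ultimately show ?thesis by blast
qed

lemma borel_measurable_fourier [measurable]:
  assumes [measurable]: "f \<in> borel_measurable borel" shows "fourier f \<in> borel_measurable borel"
  unfolding fourier_def[abs_def] by measurable

lemma test_fun_measurable: "test_fun f \<Longrightarrow> f \<in> borel_measurable borel"
  by (intro borel_measurable_continuous_onI test_fun_continuous)

lemma test_fun_tensor:
  fixes f :: "'a::euclidean_space \<Rightarrow> complex" and g :: "'b::euclidean_space \<Rightarrow> complex"
  assumes "test_fun f" "test_fun g"
  shows "test_fun (\<lambda>w. f (fst w) * g (snd w))"
proof (rule test_funI)
  show "Cinf_on UNIV (\<lambda>w::'a \<times> 'b. f (fst w) * g (snd w))"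
    using Cinf_on_affine[OF bounded_linear_fst test_fun_Cinf[OF assms(1)], of 0]
      Cinf_on_affine[OF bounded_linear_snd test_fun_Cinf[OF assms(2)], of 0]
    by (intro Cinf_on_mult) auto
  show "compact (tsupp f \<times> tsupp g)" by (intro compact_Times test_fun_compact assms)
  show "w \<in> tsupp f \<times> tsupp g" if "f (fst w) * g (snd w) \<noteq> 0" for w
    using that not_in_tsupp[of "fst w" f] not_in_tsupp[of "snd w" g] by (cases w) auto
qed

lemma wave_add: "wave (a + b) \<zeta> = wave a \<zeta> * wave b \<zeta>"
  by (simp add: wave_def inner_add_left distrib_left exp_add)

lemma wave_Pair: "wave (a, b) (\<xi>, \<eta>) = wave a \<xi> * wave b \<eta>"
  by (simp add: wave_def distrib_left exp_add)

lemma integrable_product: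
  fixes f :: "'a::euclidean_space \<Rightarrow> complex" and g :: "'b::euclidean_space \<Rightarrow> complex"
  assumes f: "integrable lborel f" and g: "integrable lborel g"
  shows "integrable (lborel \<Otimes>\<^sub>M lborel) (\<lambda>w. f (fst w) * g (snd w))"
proof (rule lborel_pair.Fubini_integrable)
  have [measurable]: "f \<in> borel_measurable borel" "g \<in> borel_measurable borel" using f g by auto
  show "(\<lambda>w. f (fst w) * g (snd w)) \<in> borel_measurable (lborel \<Otimes>\<^sub>M lborel)" by measurable
  show "integrable lborel (\<lambda>x. LINT y|lborel. norm (f (fst (x, y)) * g (snd (x, y))))"
    using f by (simp add: norm_mult integrable_mult_left)
  show "AE x in lborel. integrable lborel (\<lambda>y. f (fst (x, y)) * g (snd (x, y)))"
    using g by simp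
qed

lemma integral_iterated:
  fixes F :: "'a::euclidean_space \<times> 'b::euclidean_space \<Rightarrow> complex"
  assumes "integrable lborel F"
  shows "(LINT x|lborel. LINT y|lborel. F (x, y)) = (LINT w|lborel. F w)"
  using lborel_pair.integral_fst'[of F] assms unfolding lborel_prod by blast

section \<open>The bilinear operator and its kernel\<close>

definition fourier_tensor :: "(real ^ 'n::finite \<Rightarrow> complex) \<Rightarrow> (real ^ 'n \<Rightarrow> complex) \<Rightarrow> (real ^ 'n) \<times> (real ^ 'n) \<Rightarrow> complex" where
  "fourier_tensor f g \<zeta> = fourier f (fst \<zeta>) * fourier g (snd \<zeta>)"

lemma fourier_tensor_measurable:
  assumes "test_fun f" "test_fun g" shows "fourier_tensor f g \<in> borel_measurable borel"
proof -
  have [measurable]: "f \<in> borel_measurable borel" "g \<in> borel_measurable borel" using assms test_fun_measurable by auto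
  have "(\<lambda>\<zeta>. fourier f (fst \<zeta>) * fourier g (snd \<zeta>)) \<in> borel_measurable (borel \<Otimes>\<^sub>M borel)" by measurable
  then show ?thesis by (simp add: fourier_tensor_def[abs_def] borel_prod)
qed

lemma fourier_tensor_decay:
  assumes "test_fun f" "test_fun g"
  shows "\<exists>C>0. \<forall>\<zeta>. norm (fourier_tensor f g \<zeta>) \<le> C * weight (- real N) \<zeta>"
proof -
  obtain A B where AB: "A > 0" "B > 0" "\<And>\<xi>. norm (fourier f \<xi>) \<le> A * weight (- real N) \<xi>"
    "\<And>\<xi>. norm (fourier g \<xi>) \<le> B * weight (- real N) \<xi>"
    using fourier_decay[OF assms(1)] fourier_decay[OF assms(2)] by metis
  have "norm (fourier_tensor f g \<zeta>) \<le> (A * B) * weight (- real N) \<zeta>" for \<zeta>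
  proof -
    obtain \<xi> \<eta> where \<zeta>: "\<zeta> = (\<xi>, \<eta>)" by (rule prod.exhaust)
    have "norm (fourier_tensor f g \<zeta>) \<le> (A * weight (- real N) \<xi>) * (B * weight (- real N) \<eta>)"
      unfolding fourier_tensor_def norm_mult \<zeta> fst_conv snd_conv
      using AB by (intro mult_mono) (auto simp: weight_nonneg)
    also have "\<dots> = (A * B) * ((1 + norm \<xi>) * (1 + norm \<eta>)) powr (- real N)"
      using one_plus_norm_pos[of \<xi>] one_plus_norm_pos[of \<eta>] by (simp add: weight_def powr_mult)
    also have "\<dots> \<le> (A * B) * weight (- real N) \<zeta>"
    proof (rule mult_left_mono)
      have "1 + norm \<zeta> \<le> 1 + (norm \<xi> + norm \<eta>)" using norm_Pair_le[of \<xi> \<eta>] by (simp add: \<zeta>)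
      also have "\<dots> \<le> (1 + norm \<xi>) * (1 + norm \<eta>)" by (simp add: algebra_simps)
      finally show "((1 + norm \<xi>) * (1 + norm \<eta>)) powr (- real N) \<le> weight (- real N) \<zeta>"
        unfolding weight_def using one_plus_norm_pos[of \<zeta>] by (intro powr_mono2') auto
    qed (use AB in simp)
    finally show ?thesis .
  qed
  moreover have "A * B > 0" using AB by simp
  ultimately show ?thesis by blast
qed

lemma fourier_tensor_eq:
  assumes "test_fun f" "test_fun g"
  shows "fourier_tensor f g \<zeta> = (LINT w|lborel. f (fst w) * g (snd w) * wave (- w) \<zeta>)"
proof -
  obtain \<xi> \<eta> where \<zeta>: "\<zeta> = (\<xi>, \<eta>)" by (rule prod.exhaust)
  let ?F = "\<lambda>w. (f (fst w) * wave (- fst w) \<xi>) * (g (snd w) * wave (- snd w) \<eta>)"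
  have eq: "f (fst w) * g (snd w) * wave (- w) \<zeta> = ?F w" for w
    using wave_Pair[of "- fst w" "- snd w" \<xi> \<eta>] by (cases w) (simp add: \<zeta> mult_ac)
  have sw: "wave (- a) b = wave (- b) a" for a b :: "real ^ 'a" by (simp add: wave_def inner_commute)
  have i: "integrable lborel (\<lambda>y. f y * wave (- y) \<xi>)" if "test_fun f" for f :: "real ^ 'a \<Rightarrow> complex" and \<xi>
    unfolding sw[of _ \<xi>] by (rule integrable_mult_wave[OF test_fun_integrable[OF that]])
  have "integrable lborel ?F"
    using integrable_product[OF i[OF assms(1), of \<xi>] i[OF assms(2), of \<eta>]] by (simp add: lborel_prod)
  from integral_iterated[OF this]
  have "(LINT w|lborel. ?F w) = (LINT y|lborel. LINT z|lborel. (f y * wave (- y) \<xi>) * (g z * wave (- z) \<eta>))" by simp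
  also have "\<dots> = fourier f \<xi> * fourier g \<eta>"
    by (simp add: fourier_eq_osc osc_def sw[of _ \<xi>] sw[of _ \<eta>])
  finally have F: "(LINT w|lborel. ?F w) = fourier f \<xi> * fourier g \<eta>" .
  show ?thesis unfolding eq F by (simp add: fourier_tensor_def \<zeta>)
qed

text \<open>The iterated integral becomes one integral over the pair of frequencies, where the rapid
  decay of the Fourier transforms outweighs the growth of the symbol. The exponential is the wave
  with parameter \<open>(x, x)\<close>.\<close>

lemma bilin_op_eq:
  fixes q :: "'n::finite triple \<Rightarrow> complex"
  assumes q: "continuous_on UNIV (\<lambda>\<zeta>. q (x, \<zeta>))" "\<And>\<zeta>. norm (q (x, \<zeta>)) \<le> K * weight \<mu> \<zeta>"
    and fg: "test_fun f" "test_fun g"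
  shows "integrable lborel (\<lambda>\<zeta>. q (x, \<zeta>) * fourier_tensor f g \<zeta> * wave (x, x) \<zeta>)"
    and "bilin_op q f g x = (LINT \<zeta>|lborel. q (x, \<zeta>) * fourier_tensor f g \<zeta> * wave (x, x) \<zeta>)"
proof -
  define N where "N = nat \<lceil>\<mu> + real DIM((real ^ 'n) \<times> (real ^ 'n)) + 1\<rceil>"
  have N: "\<mu> - real N < - real DIM((real ^ 'n) \<times> (real ^ 'n))" unfolding N_def by linarith
  obtain C where C: "C > 0" "\<And>\<zeta>. norm (fourier_tensor f g \<zeta>) \<le> C * weight (- real N) \<zeta>"
    using fourier_tensor_decay[OF fg] by blast
  have m: "(\<lambda>\<zeta>. q (x, \<zeta>)) \<in> borel_measurable borel" by (rule borel_measurable_continuous_onI[OF q(1)])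
  have i: "integrable lborel (\<lambda>\<zeta>. q (x, \<zeta>) * fourier_tensor f g \<zeta>)"
  proof (rule Bochner_Integration.integrable_bound)
    show "integrable lborel (\<lambda>\<zeta>::(real ^ 'n) \<times> (real ^ 'n). (K * C) * weight (\<mu> - real N) \<zeta>)"
      by (intro integrable_mult_right integrable_weight N)
    show "(\<lambda>\<zeta>. q (x, \<zeta>) * fourier_tensor f g \<zeta>) \<in> borel_measurable lborel"
      using m fourier_tensor_measurable[OF fg] by simp
    have "norm (q (x, \<zeta>) * fourier_tensor f g \<zeta>) \<le> norm ((K * C) * weight (\<mu> - real N) \<zeta>)" for \<zeta>
    proof -
      have "norm (q (x, \<zeta>) * fourier_tensor f g \<zeta>) \<le> (K * weight \<mu> \<zeta>) * (C * weight (- real N) \<zeta>)"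
        unfolding norm_mult using order_trans[OF norm_ge_zero q(2)] by (intro mult_mono q(2) C(2)) auto
      also have "\<dots> = (K * C) * weight (\<mu> - real N) \<zeta>" using weight_add[of \<mu> "- real N" \<zeta>] by simp
      finally show ?thesis by (rule order_trans) simp
    qed
    then show "AE \<zeta> in lborel. norm (q (x, \<zeta>) * fourier_tensor f g \<zeta>) \<le> norm ((K * C) * weight (\<mu> - real N) \<zeta>)" by simp
  qed
  show I: "integrable lborel (\<lambda>\<zeta>. q (x, \<zeta>) * fourier_tensor f g \<zeta> * wave (x, x) \<zeta>)"
    by (rule integrable_mult_wave[OF i])
  have eq: "q (x, \<xi>, \<eta>) * fourier f \<xi> * fourier g \<eta> * exp (\<i> * complex_of_real (x \<bullet> (\<xi> + \<eta>)))
      = q (x, (\<xi>, \<eta>)) * fourier_tensor f g (\<xi>, \<eta>) * wave (x, x) (\<xi>, \<eta>)" for \<xi> \<eta>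
    by (simp add: fourier_tensor_def wave_def inner_add_right)
  show "bilin_op q f g x = (LINT \<zeta>|lborel. q (x, \<zeta>) * fourier_tensor f g \<zeta> * wave (x, x) \<zeta>)"
    unfolding bilin_op_def eq by (rule integral_iterated[OF I])
qed

definition regularized :: "nat \<Rightarrow> ('a::euclidean_space \<times> 'a \<times> 'a \<Rightarrow> complex) \<Rightarrow> 'a \<times> 'a \<times> 'a \<Rightarrow> complex" where
  "regularized j q w = q w * gauss (eps j) (snd w)"

lemma continuous_on_gauss: "continuous_on S (gauss \<epsilon>)"
  by (intro continuous_at_imp_continuous_on ballI) (rule has_derivative_continuous[OF gauss_has_derivative])

lemma symbol_continuous_bound:
  assumes "symbol \<rho> \<mu> q"
  shows "\<exists>K>0. \<forall>x \<zeta>. norm (q (x, \<zeta>)) \<le> K * weight \<mu> \<zeta>" and "continuous_on UNIV (\<lambda>\<zeta>. q (x, \<zeta>))"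
  using symbol_family_bound[OF symbol_fam[OF assms, of 0]] symbol_family_continuous[OF symbol_fam[OF assms, of 0]] by auto

lemma regularized_bound:
  assumes "\<And>x \<zeta>. norm (q (x, \<zeta>)) \<le> K * weight \<mu> \<zeta>" shows "norm (regularized j q (x, \<zeta>)) \<le> K * weight \<mu> \<zeta>"
proof -
  have "norm (gauss (eps j) \<zeta>) \<le> 1" using eps_bounds[of j] by (simp add: norm_gauss)
  then have "norm (q (x, \<zeta>)) * norm (gauss (eps j) \<zeta>) \<le> norm (q (x, \<zeta>)) * 1" by (intro mult_left_mono) auto
  then show ?thesis using assms[of x \<zeta>] by (simp add: regularized_def norm_mult)
qed

text \<open>The regularized symbol is integrable in \<open>\<zeta>\<close>, so the Fourier
  transforms may be written out and the integrals exchanged. The inner integral is then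
  \<open>kernel_seq\<close>, because \<open>(x, x) - w\<close> is the phase at
  \<open>(x, w)\<close>.\<close>

lemma bilin_op_regularized:
  fixes q :: "'n::finite triple \<Rightarrow> complex"
  assumes q: "symbol \<rho> \<mu> q" and \<rho>: "\<rho> \<le> 1" and fg: "test_fun f" "test_fun g"
  shows "bilin_op (regularized j q) f g x = (LINT w|lborel. kernel_seq j q (x, w) * (f (fst w) * g (snd w)))"
proof -
  obtain K where K: "K > 0" "\<And>x \<zeta>. norm (q (x, \<zeta>)) \<le> K * weight \<mu> \<zeta>" using symbol_continuous_bound(1)[OF q] by blast
  let ?r = "\<lambda>\<zeta>. regularized j q (x, \<zeta>)" and ?F = "\<lambda>w. f (fst w) * g (snd w)"
  have c: "continuous_on UNIV ?r"
    unfolding regularized_def snd_conv by (intro continuous_intros symbol_continuous_bound(2)[OF q] continuous_on_gauss)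
  have ir: "integrable lborel ?r"
    using integrable_regularized[OF q \<rho>, of x j] by (simp add: regularized_def)
  have iF: "integrable lborel ?F" by (rule test_fun_integrable[OF test_fun_tensor[OF fg]])
  have [measurable]: "?r \<in> borel_measurable borel" "?F \<in> borel_measurable borel" using ir iF by auto
  let ?H = "\<lambda>\<zeta> w. (?r \<zeta> * ?F w) * wave ((x, x) - w) \<zeta>"
  have iH: "integrable (lborel \<Otimes>\<^sub>M lborel) (\<lambda>(\<zeta>, w). ?H \<zeta> w)"
  proof (rule Bochner_Integration.integrable_bound[OF integrable_product[OF ir iF]])
    show "(\<lambda>(\<zeta>, w). ?H \<zeta> w) \<in> borel_measurable (lborel \<Otimes>\<^sub>M lborel)" by measurable
  qed (auto simp: norm_mult split_beta)
  have "bilin_op (regularized j q) f g x = (LINT \<zeta>|lborel. ?r \<zeta> * fourier_tensor f g \<zeta> * wave (x, x) \<zeta>)"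
    by (rule bilin_op_eq(2)[OF c regularized_bound[OF K(2)] fg])
  also have "\<dots> = (LINT \<zeta>|lborel. LINT w|lborel. ?H \<zeta> w)"
  proof (rule Bochner_Integration.integral_cong[OF refl])
    fix \<zeta>
    have eq: "?H \<zeta> w = (?r \<zeta> * wave (x, x) \<zeta>) * (?F w * wave (- w) \<zeta>)" for w
      using wave_add[of "(x, x)" "- w" \<zeta>] by (simp add: mult_ac)
    show "?r \<zeta> * fourier_tensor f g \<zeta> * wave (x, x) \<zeta> = (LINT w|lborel. ?H \<zeta> w)"
      unfolding eq integral_mult_right_zero fourier_tensor_eq[OF fg] by (simp only: mult_ac)
  qed
  also have "\<dots> = (LINT w|lborel. LINT \<zeta>|lborel. ?H \<zeta> w)"
    by (rule lborel_pair.Fubini_integral[OF iH, symmetric])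
  also have "\<dots> = (LINT w|lborel. kernel_seq j q (x, w) * ?F w)"
  proof (rule Bochner_Integration.integral_cong[OF refl])
    fix w :: "(real ^ 'n) \<times> (real ^ 'n)"
    have "phase (x, w) = (x, x) - w" by (cases w) (simp add: phase_def)
    then have "kernel_seq j q (x, w) = (LINT \<zeta>|lborel. ?r \<zeta> * wave ((x, x) - w) \<zeta>)"
      by (simp add: kernel_seq_def osc_def regularized_def)
    moreover have "?H \<zeta> w = (?r \<zeta> * wave ((x, x) - w) \<zeta>) * ?F w" for \<zeta> by (simp add: mult_ac)
    ultimately show "(LINT \<zeta>|lborel. ?H \<zeta> w) = kernel_seq j q (x, w) * ?F w"
      by (simp only: integral_mult_left_zero)
  qed
  finally show ?thesis .
qed

text \<open>Dominated convergence with a majorant independent of \<open>j\<close> and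
  \<open>x\<close>. The second claim later supplies the majorant for integration against a test
  function in \<open>x\<close>.\<close>

lemma bilin_op_limit:
  fixes q :: "'n::finite triple \<Rightarrow> complex"
  assumes q: "symbol \<rho> \<mu> q" and fg: "test_fun f" "test_fun g"
  shows "(\<lambda>j. bilin_op (regularized j q) f g x) \<longlonglongrightarrow> bilin_op q f g x"
    and "\<exists>B. \<forall>j x. norm (bilin_op (regularized j q) f g x) \<le> B"
proof -
  obtain K where K: "K > 0" "\<And>x \<zeta>. norm (q (x, \<zeta>)) \<le> K * weight \<mu> \<zeta>" using symbol_continuous_bound(1)[OF q] by blast
  have c: "continuous_on UNIV (\<lambda>\<zeta>. regularized j q (x, \<zeta>))" for j x
    unfolding regularized_def snd_conv by (intro continuous_intros symbol_continuous_bound(2)[OF q] continuous_on_gauss)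
  define N where "N = nat \<lceil>\<mu> + real DIM((real ^ 'n) \<times> (real ^ 'n)) + 1\<rceil>"
  have N: "\<mu> - real N < - real DIM((real ^ 'n) \<times> (real ^ 'n))" unfolding N_def by linarith
  obtain C where C: "C > 0" "\<And>\<zeta>. norm (fourier_tensor f g \<zeta>) \<le> C * weight (- real N) \<zeta>"
    using fourier_tensor_decay[OF fg] by blast
  let ?w = "\<lambda>\<zeta>. (K * C) * weight (\<mu> - real N) \<zeta>"
  have iw: "integrable lborel (?w :: (real ^ 'n) \<times> (real ^ 'n) \<Rightarrow> real)"
    by (intro integrable_mult_right integrable_weight N)
  have b: "norm (regularized j q (x, \<zeta>) * fourier_tensor f g \<zeta> * wave (x, x) \<zeta>) \<le> ?w \<zeta>" for j x \<zeta>
  proof -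
    have "norm (regularized j q (x, \<zeta>) * fourier_tensor f g \<zeta> * wave (x, x) \<zeta>)
        = norm (regularized j q (x, \<zeta>)) * norm (fourier_tensor f g \<zeta>)" by (simp add: norm_mult)
    also have "\<dots> \<le> (K * weight \<mu> \<zeta>) * (C * weight (- real N) \<zeta>)"
      using K(1) by (intro mult_mono regularized_bound K(2) C(2)) (auto simp: weight_nonneg)
    also have "\<dots> = ?w \<zeta>" using weight_add[of \<mu> "- real N" \<zeta>] by simp
    finally show ?thesis .
  qed
  note e = bilin_op_eq[OF c regularized_bound[OF K(2)] fg]
  note e0 = bilin_op_eq[OF symbol_continuous_bound(2)[OF q] K(2) fg]
  show "(\<lambda>j. bilin_op (regularized j q) f g x) \<longlonglongrightarrow> bilin_op q f g x"
    unfolding e(2) e0(2)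
  proof (rule integral_dominated_convergence[OF _ _ iw])
    show "AE \<zeta> in lborel. (\<lambda>j. regularized j q (x, \<zeta>) * fourier_tensor f g \<zeta> * wave (x, x) \<zeta>)
        \<longlonglongrightarrow> q (x, \<zeta>) * fourier_tensor f g \<zeta> * wave (x, x) \<zeta>"
    proof (intro AE_I2)
      fix \<zeta> :: "(real ^ 'n) \<times> (real ^ 'n)"
      have "(\<lambda>j. complex_of_real (exp (- eps j * (norm \<zeta>)\<^sup>2))) \<longlonglongrightarrow> complex_of_real (exp (- 0 * (norm \<zeta>)\<^sup>2))"
        by (intro tendsto_intros eps_tendsto_0)
      then have g: "(\<lambda>j. gauss (eps j) \<zeta>) \<longlonglongrightarrow> 1" by (simp add: gauss_def)
      have "(\<lambda>j. q (x, \<zeta>) * gauss (eps j) \<zeta> * fourier_tensor f g \<zeta> * wave (x, x) \<zeta>)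
          \<longlonglongrightarrow> q (x, \<zeta>) * 1 * fourier_tensor f g \<zeta> * wave (x, x) \<zeta>"
        by (intro tendsto_intros g)
      then show "(\<lambda>j. regularized j q (x, \<zeta>) * fourier_tensor f g \<zeta> * wave (x, x) \<zeta>)
        \<longlonglongrightarrow> q (x, \<zeta>) * fourier_tensor f g \<zeta> * wave (x, x) \<zeta>" by (simp add: regularized_def)
    qed
    show "(\<lambda>\<zeta>. q (x, \<zeta>) * fourier_tensor f g \<zeta> * wave (x, x) \<zeta>) \<in> borel_measurable lborel"
      using borel_measurable_integrable[OF e0(1)] .
    show "(\<lambda>\<zeta>. regularized j q (x, \<zeta>) * fourier_tensor f g \<zeta> * wave (x, x) \<zeta>) \<in> borel_measurable lborel" for j
      using borel_measurable_integrable[OF e(1)] .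
  qed (use b in auto)
  have "norm (bilin_op (regularized j q) f g x) \<le> (LINT \<zeta>::(real ^ 'n) \<times> (real ^ 'n)|lborel. ?w \<zeta>)" for j x
    unfolding e(2)
    by (rule order_trans[OF integral_norm_bound]) (intro integral_mono integrable_norm e(1) iw b)
  then show "\<exists>B. \<forall>j x. norm (bilin_op (regularized j q) f g x) \<le> B" by blast
qed

lemma kernel_uniform_limit_compact:
  assumes "convergence_domain \<rho> \<mu> S" "symbol \<rho> \<mu> q" "compact K" "K \<subseteq> S"
  shows "uniform_limit K (\<lambda>j. kernel_seq j q) (symbol_kernel q) sequentially"
proof -
  have "\<forall>P\<in>S. \<exists>r>0. uniformly_convergent_on (ball P r) (\<lambda>j. kernel_seq j q)"
    using assms(1,2) unfolding convergence_domain_def by blast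
  then obtain r where r: "\<And>P. P \<in> S \<Longrightarrow> r P > 0" "\<And>P. P \<in> S \<Longrightarrow> uniformly_convergent_on (ball P (r P)) (\<lambda>j. kernel_seq j q)"
    by metis
  obtain T where T: "T \<subseteq> K" "finite T" "K \<subseteq> (\<Union>P\<in>T. ball P (r P))"
  proof (rule compactE_image[OF assms(3), of K "\<lambda>P. ball P (r P)"])
    show "K \<subseteq> (\<Union>P\<in>K. ball P (r P))"
    proof
      fix P assume "P \<in> K"
      moreover from this have "P \<in> ball P (r P)" using assms(4) r(1)[of P] by auto
      ultimately show "P \<in> (\<Union>P\<in>K. ball P (r P))" by blast
    qed
  qed auto
  have "uniform_limit (\<Union>P\<in>T. ball P (r P)) (\<lambda>j. kernel_seq j q) (symbol_kernel q) sequentially"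
    by (rule uniform_limit_on_UNION[OF T(2)], rule kernel_uniform_limit[OF r(2)]) (use T(1) assms(4) in auto)
  then show ?thesis using uniform_limit_on_subset[OF _ T(3)] by blast
qed

lemma kernel_integrable:
  assumes "convergence_domain \<rho> \<mu> S" "symbol \<rho> \<mu> q" "\<rho> \<le> 1" "test_fun \<phi>" "tsupp \<phi> \<subseteq> S"
  shows "integrable lborel (\<lambda>u. symbol_kernel q u * \<phi> u)"
proof (rule integrable_compact_support)
  show "continuous_on (tsupp \<phi>) (\<lambda>u. symbol_kernel q u * \<phi> u)"
    by (intro continuous_intros test_fun_continuous assms(4)
        continuous_on_subset[OF continuous_on_kernel[OF assms(2,3,1)] assms(5)])
qed (use assms(4) in \<open>auto intro: test_fun_compact simp: not_in_tsupp\<close>)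

lemma kernel_seq_integrable:
  assumes "symbol \<rho> \<mu> q" "\<rho> \<le> 1" "test_fun \<phi>"
  shows "integrable lborel (\<lambda>u. kernel_seq j q u * \<phi> u)"
proof (rule integrable_compact_support)
  show "continuous_on (tsupp \<phi>) (\<lambda>u. kernel_seq j q u * \<phi> u)"
    by (intro continuous_intros test_fun_continuous assms(3) continuous_on_kernel_seq[OF assms(1,2)])
qed (use assms(3) in \<open>auto intro: test_fun_compact simp: not_in_tsupp\<close>)

lemma kernel_integral_limit:
  assumes cd: "convergence_domain \<rho> \<mu> S" and q: "symbol \<rho> \<mu> q" and \<rho>: "\<rho> \<le> 1"
    and \<phi>: "test_fun \<phi>" "tsupp \<phi> \<subseteq> S"
  shows "(\<lambda>j. LINT u|lborel. kernel_seq j q u * \<phi> u) \<longlonglongrightarrow> (LINT u|lborel. symbol_kernel q u * \<phi> u)"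
proof (rule metric_LIMSEQ_I)
  fix e :: real assume e: "e > 0"
  define I where "I = (LINT u|lborel. norm (\<phi> u))"
  have I: "I \<ge> 0" unfolding I_def by simp
  define e' where "e' = e / (I + 1)"
  have e': "e' > 0" "e' * I < e" using e I by (auto simp: e'_def field_simps)
  obtain M where M: "\<And>j u. j \<ge> M \<Longrightarrow> u \<in> tsupp \<phi> \<Longrightarrow> dist (kernel_seq j q u) (symbol_kernel q u) < e'"
    using kernel_uniform_limit_compact[OF cd q test_fun_compact[OF \<phi>(1)] \<phi>(2)] e'(1)
    unfolding uniform_limit_iff eventually_sequentially by blast
  have "dist (LINT u|lborel. kernel_seq j q u * \<phi> u) (LINT u|lborel. symbol_kernel q u * \<phi> u) < e" if j: "j \<ge> M" for j
  proof -
    note i = kernel_seq_integrable[OF q \<rho> \<phi>(1), of j] kernel_integrable[OF cd q \<rho> \<phi>]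
    have "dist (LINT u|lborel. kernel_seq j q u * \<phi> u) (LINT u|lborel. symbol_kernel q u * \<phi> u)
        = norm (LINT u|lborel. kernel_seq j q u * \<phi> u - symbol_kernel q u * \<phi> u)"
      using i by (simp add: dist_norm)
    also have "\<dots> \<le> (LINT u|lborel. norm (kernel_seq j q u * \<phi> u - symbol_kernel q u * \<phi> u))" by (rule integral_norm_bound)
    also have "\<dots> \<le> (LINT u|lborel. e' * norm (\<phi> u))"
    proof (intro integral_mono integrable_norm Bochner_Integration.integrable_diff i integrable_mult_right test_fun_integrable[OF \<phi>(1)])
      fix u
      show "norm (kernel_seq j q u * \<phi> u - symbol_kernel q u * \<phi> u) \<le> e' * norm (\<phi> u)"
      proof (cases "u \<in> tsupp \<phi>")
        case True
        have "norm (kernel_seq j q u - symbol_kernel q u) * norm (\<phi> u) \<le> e' * norm (\<phi> u)"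
          using M[OF j True] by (intro mult_right_mono) (auto simp: dist_norm)
        then show ?thesis by (simp add: norm_mult[symmetric] left_diff_distrib)
      qed (simp add: not_in_tsupp)
    qed
    also have "\<dots> < e" using e'(2) by (simp add: I_def)
    finally show ?thesis .
  qed
  then show "\<exists>M. \<forall>j\<ge>M. dist (LINT u|lborel. kernel_seq j q u * \<phi> u) (LINT u|lborel. symbol_kernel q u * \<phi> u) < e" by blast
qed

text \<open>Both sides are limits of one sequence, since for regularized symbols the identity is
  Fubini's theorem: the left side by dominated convergence of the operators, the right side by
  uniform convergence of the kernels on the support.\<close>

lemma bilin_op_kernel:
  fixes q :: "'n::finite triple \<Rightarrow> complex"
  assumes cd: "convergence_domain \<rho> \<mu> S" and q: "symbol \<rho> \<mu> q" and \<rho>: "\<rho> \<le> 1"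
    and fgh: "test_fun f" "test_fun g" "test_fun h" and supp: "tsupp (\<lambda>u. h (fst u) * (f (fst (snd u)) * g (snd (snd u)))) \<subseteq> S"
  shows "(LINT x|lborel. bilin_op q f g x * h x) = (LINT u|lborel. symbol_kernel q u * (h (fst u) * (f (fst (snd u)) * g (snd (snd u)))))"
proof -
  let ?T = "\<lambda>u. h (fst u) * (f (fst (snd u)) * g (snd (snd u)))"
  have T: "test_fun ?T" by (rule test_fun_tensor[OF fgh(3) test_fun_tensor[OF fgh(1,2)]])
  have i: "integrable lborel (\<lambda>u. kernel_seq j q u * ?T u)" for j by (rule kernel_seq_integrable[OF q \<rho> T])
  have eq: "bilin_op (regularized j q) f g x * h x = (LINT w|lborel. kernel_seq j q (x, w) * ?T (x, w))" for j x
    by (simp add: bilin_op_regularized[OF q \<rho> fgh(1,2)] mult_ac flip: integral_mult_right_zero)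
  have 1: "(LINT x|lborel. bilin_op (regularized j q) f g x * h x) = (LINT u|lborel. kernel_seq j q u * ?T u)" for j
    unfolding eq using integral_iterated[OF i] .
  obtain B where B: "\<And>j x. norm (bilin_op (regularized j q) f g x) \<le> B" using bilin_op_limit(2)[OF q fgh(1,2)] by blast
  have m: "(\<lambda>x. bilin_op (regularized j q) f g x * h x) \<in> borel_measurable lborel" for j
  proof -
    have "integrable (lborel \<Otimes>\<^sub>M lborel) (\<lambda>u. kernel_seq j q u * ?T u)" using i unfolding lborel_prod .
    from lborel_pair.integrable_fst'[OF this] show ?thesis unfolding eq by simp
  qed
  have l: "(\<lambda>j. bilin_op (regularized j q) f g x * h x) \<longlonglongrightarrow> bilin_op q f g x * h x" for x
    by (intro tendsto_intros bilin_op_limit(1)[OF q fgh(1,2)])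
  have "(\<lambda>j. LINT x|lborel. bilin_op (regularized j q) f g x * h x) \<longlonglongrightarrow> (LINT x|lborel. bilin_op q f g x * h x)"
  proof (rule integral_dominated_convergence)
    show "(\<lambda>x. bilin_op q f g x * h x) \<in> borel_measurable lborel"
      by (rule borel_measurable_LIMSEQ_metric[OF m l])
    show "integrable lborel (\<lambda>x. B * norm (h x))" by (intro integrable_mult_right integrable_norm test_fun_integrable fgh)
    show "AE x in lborel. norm (bilin_op (regularized j q) f g x * h x) \<le> B * norm (h x)" for j
      by (intro AE_I2) (simp add: norm_mult mult_right_mono B)
  qed (use m l in auto)
  then have "(\<lambda>j. LINT u|lborel. kernel_seq j q u * ?T u) \<longlonglongrightarrow> (LINT x|lborel. bilin_op q f g x * h x)" unfolding 1 .
  from LIMSEQ_unique[OF this kernel_integral_limit[OF cd q \<rho> T supp]] show ?thesis .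
qed

text \<open>The bump is borrowed from the given test function: its squared modulus is smooth and
  nonnegative, and a translation brings a point where it is positive to the origin before
  scaling.\<close>

lemma mollifier_exists:
  fixes f :: "'e::euclidean_space \<Rightarrow> complex"
  assumes f: "test_fun f" "f x0 \<noteq> 0" and \<epsilon>: "\<epsilon> > 0"
  shows "\<exists>\<theta> :: 'e \<Rightarrow> complex. mollifier \<epsilon> \<theta>"
proof -
  obtain R where R: "R > 0" "\<And>x. x \<in> tsupp f \<Longrightarrow> norm x \<le> R"
    using compact_imp_bounded[OF test_fun_compact[OF f(1)]] bounded_pos by blast
  \<comment> \<open>After the translation the support lies in the ball of radius
    \<open>R + norm x0\<close>; this scale brings it into the ball of radius
    \<open>\<epsilon>\<close>.\<close>
  define r where "r = \<epsilon> / (R + norm x0 + 1)"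
  have d: "R + norm x0 + 1 > 0" using R(1) norm_ge_zero[of x0] by linarith
  have r: "r > 0" using \<epsilon> d by (simp add: r_def)
  \<comment> \<open>The product with the conjugate, because the norm itself need not be smooth at
    zeros of \<open>f\<close>.\<close>
  define \<gamma> where "\<gamma> = (\<lambda>x. f (x /\<^sub>R r + x0) * cnj (f (x /\<^sub>R r + x0)))"
  have \<gamma>_real: "\<gamma> x = complex_of_real ((norm (f (x /\<^sub>R r + x0)))\<^sup>2)" for x
    by (simp only: \<gamma>_def complex_norm_square)
  have C1: "Cinf_on UNIV (\<lambda>x. f (x /\<^sub>R r + x0))"
    by (rule Cinf_on_affine[OF bounded_linear_scaleR_right test_fun_Cinf[OF f(1)]])
  have supp: "norm x \<le> \<epsilon>" if "\<gamma> x \<noteq> 0" for x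
  proof -
    have "f (x /\<^sub>R r + x0) \<noteq> 0" using that by (auto simp: \<gamma>_def)
    then have "norm (x /\<^sub>R r + x0) \<le> R" using R(2) not_in_tsupp by blast
    then have "norm (x /\<^sub>R r) \<le> R + norm x0 + 1" using norm_triangle_ineq4[of "x /\<^sub>R r + x0" x0] by simp
    then have "norm x \<le> r * (R + norm x0 + 1)" using r by (simp add: field_simps)
    then show ?thesis using d by (simp add: r_def)
  qed
  have t\<gamma>: "test_fun \<gamma>"
  proof (rule test_funI[where K = "cball 0 \<epsilon>"])
    show "Cinf_on UNIV \<gamma>" unfolding \<gamma>_def
      by (intro Cinf_on_mult C1 Cinf_on_bounded_linear_comp[OF bounded_linear_cnj C1] open_UNIV)
  qed (use supp in auto)
  let ?g = "\<lambda>x. norm (\<gamma> x)"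
  define I where "I = (LINT x|lborel. ?g x)"
  have "I > 0"
  proof -
    have c: "continuous_on UNIV ?g" by (intro continuous_intros test_fun_continuous t\<gamma>)
    have g0: "?g 0 > 0" using f(2) by (simp add: \<gamma>_def)
    define a where "a = ?g 0 / 2"
    have a: "a > 0" using g0 by (simp add: a_def)
    obtain s where s: "s > 0" "\<And>x. dist x 0 < s \<Longrightarrow> dist (?g x) (?g 0) < a"
      using c a unfolding continuous_on_iff by (metis UNIV_I)
    have i: "integrable lborel (\<lambda>x::'e. a * indicator (ball 0 s) x :: real)"
      using emeasure_bounded_finite[OF bounded_ball[of "0::'e" s]] by (intro integrable_mult_right integrable_real_indicator) auto
    have "0 < a * measure lborel (ball (0::'e) s)" using a s(1) by (simp add: content_ball_pos)
    also have "\<dots> = (LINT x|lborel. a * indicator (ball (0::'e) s) x)" by simp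
    also have "\<dots> \<le> I" unfolding I_def
    proof (intro integral_mono i integrable_norm test_fun_integrable t\<gamma>)
      fix x :: 'e
      show "a * indicator (ball 0 s) x \<le> ?g x"
        using s(2)[of x] by (auto simp: indicator_def a_def dist_real_def abs_if split: if_splits)
    qed
    finally show ?thesis .
  qed
  have \<gamma>I: "(LINT x|lborel. \<gamma> x) = complex_of_real I"
  proof -
    have "\<gamma> x = complex_of_real (?g x)" for x by (simp only: \<gamma>_real norm_of_real abs_power2)
    then have "(LINT x|lborel. \<gamma> x) = (LINT x|lborel. complex_of_real (?g x))" by (intro Bochner_Integration.integral_cong) auto
    then show ?thesis by (simp add: I_def)
  qed
  have "mollifier \<epsilon> (\<lambda>x. complex_of_real (1 / I) * \<gamma> x)"
    unfolding mollifier_def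
  proof (intro conjI allI impI)
    show "test_fun (\<lambda>x. complex_of_real (1 / I) * \<gamma> x)" by (rule test_fun_mult(1)[OF t\<gamma> Cinf_on_const])
    show "complex_of_real (1 / I) * \<gamma> u = complex_of_real (norm (complex_of_real (1 / I) * \<gamma> u))" for u
    proof -
      have e: "complex_of_real (1 / I) * \<gamma> u = complex_of_real (1 / I * (norm (f (u /\<^sub>R r + x0)))\<^sup>2)"
        by (simp only: \<gamma>_real of_real_mult)
      have "0 \<le> 1 / I * (norm (f (u /\<^sub>R r + x0)))\<^sup>2" using \<open>I > 0\<close> by simp
      then show ?thesis unfolding e norm_of_real by (simp only: abs_of_nonneg)
    qed
    show "(LINT u|lborel. complex_of_real (1 / I) * \<gamma> u) = 1"
      unfolding integral_mult_right_zero \<gamma>I using \<open>I > 0\<close> by simp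
    show "norm u \<le> \<epsilon>" if "complex_of_real (1 / I) * \<gamma> u \<noteq> 0" for u using that supp by auto
  qed
  then show ?thesis by blast
qed

lemma mollifier_tensor:
  fixes \<theta> :: "'a::euclidean_space \<Rightarrow> complex" and \<tau> :: "'b::euclidean_space \<Rightarrow> complex"
  assumes "mollifier \<epsilon> \<theta>" "mollifier \<delta> \<tau>"
  shows "mollifier (\<epsilon> + \<delta>) (\<lambda>w. \<theta> (fst w) * \<tau> (snd w))"
proof -
  have \<theta>: "test_fun \<theta>" "\<And>u. \<theta> u = complex_of_real (norm (\<theta> u))" "(LINT u|lborel. \<theta> u) = 1" "\<And>u. \<theta> u \<noteq> 0 \<Longrightarrow> norm u \<le> \<epsilon>"
    using assms(1) unfolding mollifier_def by blast+
  have \<tau>: "test_fun \<tau>" "\<And>u. \<tau> u = complex_of_real (norm (\<tau> u))" "(LINT u|lborel. \<tau> u) = 1" "\<And>u. \<tau> u \<noteq> 0 \<Longrightarrow> norm u \<le> \<delta>"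
    using assms(2) unfolding mollifier_def by blast+
  note T = test_fun_tensor[OF \<theta>(1) \<tau>(1)]
  show ?thesis unfolding mollifier_def
  proof (intro conjI allI impI)
    show "test_fun (\<lambda>w. \<theta> (fst w) * \<tau> (snd w))" by (rule T)
    show "\<theta> (fst w) * \<tau> (snd w) = complex_of_real (norm (\<theta> (fst w) * \<tau> (snd w)))" for w
      using \<theta>(2)[of "fst w"] \<tau>(2)[of "snd w"] by (metis norm_mult of_real_mult)
    show "(LINT w|lborel. \<theta> (fst w) * \<tau> (snd w)) = 1"
      using integral_iterated[OF test_fun_integrable[OF T]] \<theta>(3) \<tau>(3) by simp
    fix w assume "\<theta> (fst w) * \<tau> (snd w) \<noteq> 0"
    then have "norm (fst w) \<le> \<epsilon>" "norm (snd w) \<le> \<delta>" using \<theta>(4) \<tau>(4) by auto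
    then show "norm w \<le> \<epsilon> + \<delta>" using norm_Pair_le[of "fst w" "snd w"] by simp
  qed
qed

text \<open>The difference \<open>D\<close> between \<open>k\<close> and integration against the
  kernel vanishes on tensor products supported in \<open>S\<close>, by the defining property of
  \<open>k\<close>. Its seminorm estimate joins that of the distribution with the integrability of
  the kernel on compact subsets of \<open>S\<close>, so the density argument applies.\<close>

lemma kernel_distribution:
  fixes p :: "'n::finite triple \<Rightarrow> complex"
  assumes cd: "convergence_domain \<rho> \<mu> S" and p: "symbol \<rho> \<mu> p" and \<rho>: "\<rho> \<le> 1" and k: "dist_kernel p k"
  shows "dist_eq_fun_on S k (symbol_kernel p)"
  unfolding dist_eq_fun_on_def
proof (intro conjI allI impI)
  show "continuous_on S (symbol_kernel p)" by (rule continuous_on_kernel[OF p \<rho> cd])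
  fix \<phi> :: "'n triple \<Rightarrow> complex" assume \<phi>: "test_fun \<phi>" "tsupp \<phi> \<subseteq> S"
  have dk: "distribution k" using k by (simp add: dist_kernel_def)
  have k_add: "k (\<lambda>u. \<phi> u + \<psi> u) = k \<phi> + k \<psi>" if "test_fun \<phi>" "test_fun \<psi>" for \<phi> \<psi>
    using dk that unfolding distribution_def by blast
  have k_scale: "k (\<lambda>u. c * \<phi> u) = c * k \<phi>" if "test_fun \<phi>" for c \<phi>
    using dk that unfolding distribution_def by blast
  define D where "D \<omega> = k \<omega> - (LINT u|lborel. symbol_kernel p u * \<omega> u)" for \<omega>
  note ik = kernel_integrable[OF cd p \<rho>]
  have "D \<phi> = 0"
  \<comment> \<open>A nonzero value is the raw material for the mollifiers; the zero function is
    settled by homogeneity.\<close>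
  proof (cases "\<exists>u. \<phi> u \<noteq> 0")
    case False
    then have z: "\<phi> = (\<lambda>_. 0)" by auto
    then have "k (\<lambda>_. 0) = 0" using k_scale[OF \<phi>(1), of 0] by simp
    then show ?thesis by (simp add: D_def z)
  next
    case True
    then obtain x0 y0 z0 where u0: "\<phi> (x0, y0, z0) \<noteq> 0" by (metis prod_cases3)
    \<comment> \<open>A slice of \<open>\<phi>\<close> itself yields the bump function for the mollifiers.\<close>
    define f0 where "f0 x = \<phi> (x, y0, z0)" for x
    have f0: "test_fun f0"
    proof (rule test_funI)
      have "bounded_linear (\<lambda>x::real ^ 'n. (x, 0 :: real ^ 'n, 0 :: real ^ 'n))"
        by (intro bounded_linear_Pair bounded_linear_ident bounded_linear_zero)
      from Cinf_on_affine[OF this test_fun_Cinf[OF \<phi>(1)], of "(0, y0, z0)"]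
      show "Cinf_on UNIV f0" by (simp add: f0_def[abs_def])
      show "compact (fst ` tsupp \<phi>)" by (intro compact_continuous_image continuous_intros test_fun_compact \<phi>)
      show "x \<in> fst ` tsupp \<phi>" if "f0 x \<noteq> 0" for x
        using that not_in_tsupp[of "(x, y0, z0)" \<phi>] unfolding f0_def by (metis fst_conv image_eqI)
    qed
    show ?thesis
    proof (rule functional_vanishes[OF _ _ _ _ _ \<phi>])
      show "open S" using cd by (simp add: convergence_domain_def)
      show "D (\<lambda>u. \<phi> u + \<psi> u) = D \<phi> + D \<psi>" if "test_fun \<phi>" "test_fun \<psi>" "tsupp \<phi> \<subseteq> S" "tsupp \<psi> \<subseteq> S" for \<phi> \<psi>
        using k_add[OF that(1,2)] Bochner_Integration.integral_add[OF ik[OF that(1,3)] ik[OF that(2,4)]]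
        by (simp add: D_def distrib_left)
      show "D (\<lambda>u. c * \<phi> u) = c * D \<phi>" if "test_fun \<phi>" "tsupp \<phi> \<subseteq> S" for c \<phi>
      proof -
        have "(LINT u|lborel. symbol_kernel p u * (c * \<phi> u)) = c * (LINT u|lborel. symbol_kernel p u * \<phi> u)"
          by (simp add: mult.left_commute)
        then show ?thesis by (simp add: D_def k_scale[OF that(1)] right_diff_distrib)
      qed
      show "\<exists>\<theta>. mollifier \<epsilon> \<theta> \<and> (\<forall>c. tsupp (\<lambda>u. \<theta> (u - c)) \<subseteq> S \<longrightarrow> D (\<lambda>u. \<theta> (u - c)) = 0)" if pos: "\<epsilon> > 0" for \<epsilon>
      proof -
        obtain \<beta> :: "real ^ 'n \<Rightarrow> complex" where \<beta>: "mollifier (\<epsilon> / 3) \<beta>"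
          using mollifier_exists[OF f0, of x0 "\<epsilon> / 3"] u0 pos by (auto simp: f0_def)
        let ?\<theta> = "\<lambda>u. \<beta> (fst u) * (\<beta> (fst (snd u)) * \<beta> (snd (snd u)))"
        have "mollifier (\<epsilon> / 3 + (\<epsilon> / 3 + \<epsilon> / 3)) ?\<theta>" by (rule mollifier_tensor[OF \<beta> mollifier_tensor[OF \<beta> \<beta>]])
        then have m: "mollifier \<epsilon> ?\<theta>" by simp
        have t\<beta>: "test_fun \<beta>" using \<beta> by (simp add: mollifier_def)
        have "D (\<lambda>u. ?\<theta> (u - c)) = 0" if s: "tsupp (\<lambda>u. ?\<theta> (u - c)) \<subseteq> S" for c
        proof -
          obtain a b e where c: "c = (a, b, e)" by (rule prod_cases3)
          note t = test_fun_translate[OF t\<beta>, of a] test_fun_translate[OF t\<beta>, of b] test_fun_translate[OF t\<beta>, of e]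
          have eq: "(\<lambda>u. ?\<theta> (u - c)) = (\<lambda>(x, y, z). \<beta> (x - a) * \<beta> (y - b) * \<beta> (z - e))"
            by (auto simp: c mult.assoc)
          have eq': "(\<lambda>u. ?\<theta> (u - c)) = (\<lambda>u. \<beta> (fst u - a) * (\<beta> (fst (snd u) - b) * \<beta> (snd (snd u) - e)))"
            by (auto simp: c)
          have "k (\<lambda>u. ?\<theta> (u - c)) = (LINT x|lborel. bilin_op p (\<lambda>y. \<beta> (y - b)) (\<lambda>z. \<beta> (z - e)) x * \<beta> (x - a))"
            unfolding eq using k t unfolding dist_kernel_def by blast
          also have "\<dots> = (LINT u|lborel. symbol_kernel p u * (\<beta> (fst u - a) * (\<beta> (fst (snd u) - b) * \<beta> (snd (snd u) - e))))"
            by (rule bilin_op_kernel[OF cd p \<rho> t(2,3,1)]) (rule s[unfolded eq'])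
          finally have k_eq: "k (\<lambda>u. ?\<theta> (u - c)) = \<dots>" .
          have pt: "?\<theta> (u - c) = \<beta> (fst u - a) * (\<beta> (fst (snd u) - b) * \<beta> (snd (snd u) - e))" for u
            by (simp add: c)
          show ?thesis unfolding D_def pt using k_eq[unfolded pt] by simp
        qed
        with m show ?thesis by blast
      qed
      fix A :: "'n triple set" assume A: "compact A" "A \<subseteq> S"
      obtain C N where CN: "\<And>\<phi>. test_fun \<phi> \<Longrightarrow> tsupp \<phi> \<subseteq> A \<Longrightarrow>
          norm (k \<phi>) \<le> C * (\<Sum>vs | set vs \<subseteq> Basis \<and> length vs \<le> N. SUP u. norm (dir_derivs vs \<phi> u))"
        using dk A(1) unfolding distribution_def by blast
      let ?L = "{vs :: 'n triple list. set vs \<subseteq> Basis \<and> length vs \<le> N}"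
      define M where "M = (LINT u|lborel. indicator A u * norm (symbol_kernel p u))"
      have iA: "integrable lborel (\<lambda>u. indicator A u * norm (symbol_kernel p u))"
        using borel_integrable_compact[OF A(1), of "\<lambda>u. norm (symbol_kernel p u)"]
          continuous_on_norm[OF continuous_on_subset[OF continuous_on_kernel[OF p \<rho> cd] A(2)]] by simp
      have "norm (D \<omega>) \<le> (\<bar>C\<bar> * real (card ?L) + M) * e"
        if \<omega>: "test_fun \<omega>" "tsupp \<omega> \<subseteq> A" and e: "\<And>vs u. set vs \<subseteq> Basis \<Longrightarrow> length vs \<le> N \<Longrightarrow> norm (dir_derivs vs \<omega> u) \<le> e" for \<omega> e
      proof -
        have e0: "norm (\<omega> u) \<le> e" for u using e[of "[]" u] by simp
        have enn: "e \<ge> 0" using order_trans[OF norm_ge_zero e0] by blast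
        \<comment> \<open>The suprema are taken in the reals, so boundedness has to be checked
          before they can be compared with 0.\<close>
        have s: "(SUP u. norm (dir_derivs vs \<omega> u)) \<le> e" "0 \<le> (SUP u. norm (dir_derivs vs \<omega> u))" if "vs \<in> ?L" for vs
        proof -
          have b: "norm (dir_derivs vs \<omega> u) \<le> e" for u using e that by simp
          show "(SUP u. norm (dir_derivs vs \<omega> u)) \<le> e" by (rule cSUP_least) (use b in auto)
          have "bdd_above (range (\<lambda>u. norm (dir_derivs vs \<omega> u)))" using b by (auto intro!: bdd_aboveI)
          then show "0 \<le> (SUP u. norm (dir_derivs vs \<omega> u))" by (rule cSUP_upper2[where x = 0]) auto
        qed
        have "norm (k \<omega>) \<le> C * (\<Sum>vs\<in>?L. SUP u. norm (dir_derivs vs \<omega> u))" by (rule CN[OF \<omega>])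
        also have "\<dots> \<le> \<bar>C\<bar> * (\<Sum>vs\<in>?L. SUP u. norm (dir_derivs vs \<omega> u))"
          using s(2) by (intro mult_right_mono sum_nonneg) auto
        also have "\<dots> \<le> \<bar>C\<bar> * (\<Sum>vs\<in>?L. e)" using s(1) by (intro mult_left_mono sum_mono) auto
        finally have 1: "norm (k \<omega>) \<le> \<bar>C\<bar> * real (card ?L) * e" by simp
        have "norm (LINT u|lborel. symbol_kernel p u * \<omega> u) \<le> (LINT u|lborel. norm (symbol_kernel p u * \<omega> u))" by (rule integral_norm_bound)
        also have "\<dots> \<le> (LINT u|lborel. (indicator A u * norm (symbol_kernel p u)) * e)"
        proof (intro integral_mono integrable_norm integrable_mult_left iA ik \<omega>(1))
          show "tsupp \<omega> \<subseteq> S" using \<omega>(2) A(2) by blast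
          show "norm (symbol_kernel p u * \<omega> u) \<le> indicator A u * norm (symbol_kernel p u) * e" for u
          proof (cases "u \<in> A")
            case True
            then show ?thesis using e0[of u] by (simp add: norm_mult mult_left_mono)
          next
            case False
            then have "\<omega> u = 0" using \<omega>(2) not_in_tsupp by blast
            then show ?thesis using False by simp
          qed
        qed
        also have "\<dots> = M * e" by (simp add: M_def)
        finally have "norm (LINT u|lborel. symbol_kernel p u * \<omega> u) \<le> M * e" .
        with 1 show ?thesis unfolding D_def
          by (intro order_trans[OF norm_triangle_ineq4]) (simp add: distrib_right)
      qed
      then show "\<exists>C N. \<forall>\<phi> e. test_fun \<phi> \<longrightarrow> tsupp \<phi> \<subseteq> A \<longrightarrow>
        (\<forall>vs. set vs \<subseteq> Basis \<longrightarrow> length vs \<le> N \<longrightarrow> (\<forall>u. norm (dir_derivs vs \<phi> u) \<le> e)) \<longrightarrow> norm (D \<phi>) \<le> C * e"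
        by blast
    qed
  qed
  then show "k \<phi> = (LINT u|lborel. symbol_kernel p u * \<phi> u)" by (simp add: D_def)
qed

section \<open>Estimates off the diagonal\<close>

text \<open>Two of the three distances are the norms of the components of the phase, the third is at
  most their sum; this gives the factor 4.\<close>

lemma S3_phase:
  shows "norm (phase (x, y, z)) \<le> S3 x y z" "S3 x y z \<le> 4 * norm (phase (x, y, z))"
proof -
  have "norm (phase (x, y, z)) \<le> norm (x - y) + norm (x - z)"
    using norm_Pair_le[of "x - y" "x - z"] by (simp add: phase_def)
  then show "norm (phase (x, y, z)) \<le> S3 x y z" unfolding S3_def using norm_ge_zero[of "y - z"] by linarith
  have "norm (x - y) \<le> norm (phase (x, y, z))" "norm (x - z) \<le> norm (phase (x, y, z))"
    using norm_fst_le[of "x - y" "x - z"] norm_snd_le[of "x - z" "x - y"] by (simp_all add: phase_def)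
  moreover have "norm (y - z) \<le> norm (x - y) + norm (x - z)"
    using norm_triangle_ineq4[of "x - z" "x - y"] by (simp add: norm_minus_commute)
  ultimately show "S3 x y z \<le> 4 * norm (phase (x, y, z))" unfolding S3_def by linarith
qed

lemma S3_pos_iff: "S3 x y z > 0 \<longleftrightarrow> (x, y, z) \<in> off_axis"
  using S3_phase[of x y z] by (auto simp: off_axis_def) (smt (verit) norm_le_zero_iff)

lemma off_diag_eq: "off_diag = off_axis"
  by (auto simp: off_diag_def S3_pos_iff)

definition pd3_dirs :: "('n::finite \<Rightarrow> nat) \<Rightarrow> ('n \<Rightarrow> nat) \<Rightarrow> ('n \<Rightarrow> nat) \<Rightarrow> 'n triple list" where
  "pd3_dirs \<alpha> \<beta> \<gamma> = map (\<lambda>u. (u, 0, 0)) (mi_dirs \<alpha>) @ map (\<lambda>v. (0, v, 0)) (mi_dirs \<beta>)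
                 @ map (\<lambda>w. (0, 0, w)) (mi_dirs \<gamma>)"

lemma length_pd3_dirs: "length (pd3_dirs \<alpha> \<beta> \<gamma>) = mi_order (\<lambda>i. \<alpha> i + \<beta> i + \<gamma> i)"
  by (simp add: pd3_dirs_def length_mi_dirs) (simp add: mi_order_def sum.distrib)

abbreviation pd3_symbol :: "('n::finite \<Rightarrow> nat) \<Rightarrow> ('n \<Rightarrow> nat) \<Rightarrow> ('n \<Rightarrow> nat) \<Rightarrow> ('n triple \<Rightarrow> complex) \<Rightarrow> 'n triple \<Rightarrow> complex" where
  "pd3_symbol \<alpha> \<beta> \<gamma> p \<equiv> foldr deriv_symbol (pd3_dirs \<alpha> \<beta> \<gamma>) p"

lemma pd3_symbol_symbol:
  "symbol \<rho> m p \<Longrightarrow> \<rho> \<le> 1 \<Longrightarrow> symbol \<rho> (m + real (mi_order (\<lambda>i. \<alpha> i + \<beta> i + \<gamma> i))) (pd3_symbol \<alpha> \<beta> \<gamma> p)"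
  using symbol_deriv_symbols[of \<rho> m p "pd3_dirs \<alpha> \<beta> \<gamma>"] by (simp add: length_pd3_dirs)

lemma pd3_kernel_off_axis:
  assumes "symbol \<rho> m p" "0 < \<rho>" "\<rho> \<le> 1" "P \<in> off_axis"
  shows "pd3 \<alpha> \<beta> \<gamma> (symbol_kernel p) P = symbol_kernel (pd3_symbol \<alpha> \<beta> \<gamma> p) P"
  unfolding pd3_def pd3_dirs_def[symmetric]
  by (rule dir_derivs_kernel[OF assms(3) convergence_domain_off_axis[OF assms(2,3)] assms(1,4)])

lemma pd3_kernel_UNIV:
  fixes p :: "'n::finite triple \<Rightarrow> complex"
  assumes "symbol \<rho> m p" "\<rho> \<le> 1" "m + real (mi_order (\<lambda>i. \<alpha> i + \<beta> i + \<gamma> i)) < - real DIM((real ^ 'n) \<times> (real ^ 'n))"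
  shows "pd3 \<alpha> \<beta> \<gamma> (symbol_kernel p) = symbol_kernel (pd3_symbol \<alpha> \<beta> \<gamma> p)"
proof
  fix P
  show "pd3 \<alpha> \<beta> \<gamma> (symbol_kernel p) P = symbol_kernel (pd3_symbol \<alpha> \<beta> \<gamma> p) P"
    unfolding pd3_def pd3_dirs_def[symmetric]
  proof (rule dir_derivs_kernel[OF assms(2) _ assms(1) UNIV_I])
    show "convergence_domain \<rho> (m + real i) (UNIV :: 'n triple set)" if "i \<le> length (pd3_dirs \<alpha> \<beta> \<gamma>)" for i
    proof (rule convergence_domain_UNIV[OF assms(2)])
      have "real i \<le> real (mi_order (\<lambda>i. \<alpha> i + \<beta> i + \<gamma> i))" using that by (simp add: length_pd3_dirs)
      then show "m + real i < - real DIM((real ^ 'n) \<times> (real ^ 'n))" using assms(3) by linarith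
    qed
  qed
qed

text \<open>Finiteness lets the constants of the single derivatives be added; nonemptiness makes the
  supremum over the index set meaningful.\<close>

lemma mi_triples_finite_nonempty:
  "finite (mi_triples M :: (('n::finite \<Rightarrow> nat) \<times> ('n \<Rightarrow> nat) \<times> ('n \<Rightarrow> nat)) set)"
  "(mi_triples M :: (('n \<Rightarrow> nat) \<times> ('n \<Rightarrow> nat) \<times> ('n \<Rightarrow> nat)) set) \<noteq> {}"
proof -
  let ?F = "{f :: 'n \<Rightarrow> nat. \<forall>i. f i \<in> {..M}}"
  have F: "finite ?F" using finite_PiE[of "UNIV :: 'n set" "\<lambda>_. {..M}"] by (simp add: PiE_def Pi_def)
  have "\<alpha> i + \<beta> i + \<gamma> i \<le> M" if "mi_order (\<lambda>i. \<alpha> i + \<beta> i + \<gamma> i) = M" for \<alpha> \<beta> \<gamma> :: "'n \<Rightarrow> nat" and i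
    using member_le_sum[of i UNIV "\<lambda>i. \<alpha> i + \<beta> i + \<gamma> i"] that by (simp add: mi_order_def)
  then have "mi_triples M \<subseteq> ?F \<times> ?F \<times> ?F" unfolding mi_triples_def by (fastforce dest: add_leD1 add_leD2)
  then show "finite (mi_triples M :: (('n \<Rightarrow> nat) \<times> ('n \<Rightarrow> nat) \<times> ('n \<Rightarrow> nat)) set)"
    by (rule finite_subset) (intro finite_cartesian_product F)
  obtain a :: 'n where True by simp
  have "((\<lambda>i. if i = a then M else 0), (\<lambda>_. 0), (\<lambda>_. 0)) \<in> mi_triples M"
    by (simp add: mi_triples_def mi_order_def)
  then show "(mi_triples M :: (('n \<Rightarrow> nat) \<times> ('n \<Rightarrow> nat) \<times> ('n \<Rightarrow> nat)) set) \<noteq> {}" by blast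
qed

lemma SUP_mi_triples_bound:
  fixes F :: "('n::finite \<Rightarrow> nat) \<Rightarrow> ('n \<Rightarrow> nat) \<Rightarrow> ('n \<Rightarrow> nat) \<Rightarrow> 'n triple \<Rightarrow> complex"
  assumes "\<And>\<alpha> \<beta> \<gamma>. mi_order (\<lambda>i. \<alpha> i + \<beta> i + \<gamma> i) = M \<Longrightarrow>
      \<exists>C>0. \<forall>x y z. S3 x y z > 0 \<longrightarrow> norm (F \<alpha> \<beta> \<gamma> (x, y, z)) \<le> C * g (S3 x y z)"
    and g: "\<And>s. s > 0 \<Longrightarrow> g s \<ge> 0"
  shows "\<exists>C>0. \<forall>x y z. S3 x y z > 0 \<longrightarrow>
     (SUP (\<alpha>, \<beta>, \<gamma>)\<in>mi_triples M. norm (F \<alpha> \<beta> \<gamma> (x, y, z))) \<le> C * g (S3 x y z)"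
proof -
  let ?T = "mi_triples M :: (('n \<Rightarrow> nat) \<times> ('n \<Rightarrow> nat) \<times> ('n \<Rightarrow> nat)) set"
  have "\<exists>C>0. \<forall>x y z. S3 x y z > 0 \<longrightarrow> norm (F (fst t) (fst (snd t)) (snd (snd t)) (x, y, z)) \<le> C * g (S3 x y z)"
    if "t \<in> ?T" for t
    by (rule assms(1)) (use that in \<open>auto simp: mi_triples_def\<close>)
  then obtain C where C: "\<And>t. t \<in> ?T \<Longrightarrow> C t > 0"
    "\<And>t x y z. t \<in> ?T \<Longrightarrow> S3 x y z > 0 \<Longrightarrow> norm (F (fst t) (fst (snd t)) (snd (snd t)) (x, y, z)) \<le> C t * g (S3 x y z)"
    by metis
  note T = mi_triples_finite_nonempty[where 'n = 'n, of M]
  have "(SUP (\<alpha>, \<beta>, \<gamma>)\<in>?T. norm (F \<alpha> \<beta> \<gamma> (x, y, z))) \<le> (\<Sum>t\<in>?T. C t) * g (S3 x y z)" if S: "S3 x y z > 0" for x y z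
  proof (rule cSUP_least[OF T(2)])
    fix t assume t: "t \<in> ?T"
    have "C t \<le> (\<Sum>t\<in>?T. C t)" using T(1) C(1) t by (intro member_le_sum) (auto intro: less_imp_le)
    then have "C t * g (S3 x y z) \<le> (\<Sum>t\<in>?T. C t) * g (S3 x y z)" using g[OF S] by (rule mult_right_mono)
    with C(2)[OF t S] show "(case t of (\<alpha>, \<beta>, \<gamma>) \<Rightarrow> norm (F \<alpha> \<beta> \<gamma> (x, y, z))) \<le> (\<Sum>t\<in>?T. C t) * g (S3 x y z)"
      by (simp add: split_beta)
  qed
  moreover have "(\<Sum>t\<in>?T. C t) > 0" using C(1) T by (intro sum_pos) auto
  ultimately show ?thesis by blast
qed

lemma DIM_pair: "real DIM((real ^ 'n::finite) \<times> (real ^ 'n)) = 2 * real CARD('n)"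
  by simp

lemma kernel_S3_decay:
  fixes q :: "'n::finite triple \<Rightarrow> complex"
  assumes "symbol \<rho> \<mu> q" "0 < \<rho>" "\<rho> \<le> 1" "\<mu> - \<rho> * N < - 2 * real CARD('n)"
  shows "\<exists>C>0. \<forall>x y z. S3 x y z > 0 \<longrightarrow> S3 x y z ^ N * norm (symbol_kernel q (x, y, z)) \<le> C"
proof -
  obtain C where C: "C > 0" "\<And>P :: 'n triple. P \<in> off_axis \<Longrightarrow> norm (phase P) ^ N * norm (symbol_kernel q P) \<le> C"
    using kernel_decay[OF assms(1-3), of N] assms(4) by (auto simp: DIM_pair)
  have "S3 x y z ^ N * norm (symbol_kernel q (x, y, z)) \<le> 4 ^ N * C" if S: "S3 x y z > 0" for x y z
  proof -
    have "S3 x y z ^ N * norm (symbol_kernel q (x, y, z)) \<le> (4 * norm (phase (x, y, z))) ^ N * norm (symbol_kernel q (x, y, z))"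
      using S S3_phase(2)[of x y z] by (intro mult_right_mono power_mono) auto
    also have "\<dots> = 4 ^ N * (norm (phase (x, y, z)) ^ N * norm (symbol_kernel q (x, y, z)))" by (simp add: power_mult_distrib)
    also have "\<dots> \<le> 4 ^ N * C" using C(2) S by (intro mult_left_mono) (auto simp: S3_pos_iff)
    finally show ?thesis .
  qed
  with C(1) show ?thesis by (intro exI[of _ "4 ^ N * C"]) auto
qed

lemma kernel_S3_positive_order:
  fixes q :: "'n::finite triple \<Rightarrow> complex"
  assumes "symbol \<rho> \<mu> q" "0 < \<rho>" "\<rho> \<le> 1" "\<mu> + 2 * real CARD('n) > 0"
  shows "\<exists>C>0. \<forall>x y z. S3 x y z > 0 \<longrightarrow> norm (symbol_kernel q (x, y, z)) \<le> C * S3 x y z powr (- (\<mu> + 2 * real CARD('n)) / \<rho>)"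
proof -
  define a where "a = (\<mu> + 2 * real CARD('n)) / \<rho>"
  have a: "a > 0" "- (\<mu> + 2 * real CARD('n)) / \<rho> = - a" using assms by (simp_all add: a_def minus_divide_left)
  obtain C where C: "C > 0" "\<And>P :: 'n triple. P \<in> off_axis \<Longrightarrow> norm (symbol_kernel q P) \<le> C * norm (phase P) powr (- a)"
    using kernel_bound_positive_order[OF assms(1-3)] assms(4) a(2) by (auto simp: DIM_pair)
  have "norm (symbol_kernel q (x, y, z)) \<le> (C * 4 powr a) * S3 x y z powr (- a)" if S: "S3 x y z > 0" for x y z
  proof -
    have p: "norm (phase (x, y, z)) > 0" using S by (simp add: S3_pos_iff off_axis_def)
    have "norm (symbol_kernel q (x, y, z)) \<le> C * norm (phase (x, y, z)) powr (- a)" using C(2) S by (simp add: S3_pos_iff)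
    also have "norm (phase (x, y, z)) powr (- a) \<le> (S3 x y z / 4) powr (- a)"
      using S S3_phase(2)[of x y z] a by (intro powr_mono2') auto
    also have "(S3 x y z / 4) powr (- a) = 4 powr a * S3 x y z powr (- a)"
      by (simp add: powr_divide powr_minus_divide)
    finally show ?thesis using C(1) by (simp add: mult.assoc)
  qed
  moreover have "C * 4 powr a > 0" using C(1) by simp
  ultimately show ?thesis unfolding a(2) by blast
qed

text \<open>The summand 1 accounts for the points with \<open>S3 x y z = 1\<close>, where the
  logarithm vanishes but the kernel need not. Passing from the phase to \<open>S3\<close> shifts the
  logarithm by at most \<open>ln 4\<close>.\<close>

lemma kernel_S3_zero_order:
  fixes q :: "'n::finite triple \<Rightarrow> complex"
  assumes "symbol \<rho> \<mu> q" "0 < \<rho>" "\<rho> \<le> 1" "\<mu> + 2 * real CARD('n) = 0"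
  shows "\<exists>C>0. \<forall>x y z. S3 x y z > 0 \<longrightarrow> norm (symbol_kernel q (x, y, z)) \<le> C * (1 + \<bar>ln (S3 x y z)\<bar>)"
proof -
  obtain C where C: "C > 0" "\<And>P :: 'n triple. P \<in> off_axis \<Longrightarrow> norm (symbol_kernel q P) \<le> C * (1 + \<bar>ln (norm (phase P))\<bar>)"
    using kernel_bound_zero_order[OF assms(1-3)] assms(4) by (auto simp: DIM_pair)
  have "norm (symbol_kernel q (x, y, z)) \<le> (C * (1 + ln 4)) * (1 + \<bar>ln (S3 x y z)\<bar>)" if S: "S3 x y z > 0" for x y z
  proof -
    have p: "norm (phase (x, y, z)) > 0" using S by (simp add: S3_pos_iff off_axis_def)
    have l: "ln (norm (phase (x, y, z))) \<le> ln (S3 x y z)"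
      using p S S3_phase(1)[of x y z] by (subst ln_le_cancel_iff) auto
    have "ln (S3 x y z) \<le> ln (4 * norm (phase (x, y, z)))"
      using p S S3_phase(2)[of x y z] by (subst ln_le_cancel_iff) auto
    also have "\<dots> = ln 4 + ln (norm (phase (x, y, z)))" using p by (simp add: ln_mult)
    finally have "\<bar>ln (norm (phase (x, y, z)))\<bar> \<le> ln 4 + \<bar>ln (S3 x y z)\<bar>" using l ln_ge_zero[of 4] by linarith
    then have "1 + \<bar>ln (norm (phase (x, y, z)))\<bar> \<le> (1 + ln 4) * (1 + \<bar>ln (S3 x y z)\<bar>)"
      by (simp add: algebra_simps) (smt (verit) ln_ge_zero mult_nonneg_nonneg)
    then have "C * (1 + \<bar>ln (norm (phase (x, y, z)))\<bar>) \<le> C * ((1 + ln 4) * (1 + \<bar>ln (S3 x y z)\<bar>))"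
      using C(1) by (intro mult_left_mono) auto
    with C(2)[of "(x, y, z)"] S show ?thesis by (simp add: S3_pos_iff mult.assoc)
  qed
  moreover have "C * (1 + ln 4) > 0" using C(1) by (intro mult_pos_pos add_pos_nonneg) auto
  ultimately show ?thesis by blast
qed

text \<open>The order is integrable from the start, so the exponents 0 and \<open>N\<close> are both
  available: the first serves near the diagonal, the second far from it.\<close>

lemma kernel_S3_rapid_decay:
  fixes q :: "'n::finite triple \<Rightarrow> complex"
  assumes "symbol \<rho> \<mu> q" "0 < \<rho>" "\<rho> \<le> 1" "\<mu> < - 2 * real CARD('n)"
  shows "\<exists>C>0. \<forall>x y z. S3 x y z > 0 \<longrightarrow> norm (symbol_kernel q (x, y, z)) \<le> C * (1 + S3 x y z) powr (- real N)"
proof -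
  have "0 \<le> \<rho> * real k" for k using assms(2) by simp
  then have k: "\<mu> - \<rho> * real k < - 2 * real CARD('n)" for k using assms(4) by (smt (verit))
  obtain A where A: "A > 0" "\<And>x y z. S3 x y z > 0 \<Longrightarrow> norm (symbol_kernel q (x, y, z)) \<le> A"
    using kernel_S3_decay[OF assms(1-3) k[of 0]] by auto
  obtain B where B: "B > 0" "\<And>x y z. S3 x y z > 0 \<Longrightarrow> S3 x y z ^ N * norm (symbol_kernel q (x, y, z)) \<le> B"
    using kernel_S3_decay[OF assms(1-3) k[of N]] by auto
  have "norm (symbol_kernel q (x, y, z)) \<le> (2 ^ N * (A + B)) * (1 + S3 x y z) powr (- real N)" if S: "S3 x y z > 0" for x y z
  proof -
    let ?s = "S3 x y z" and ?o = "norm (symbol_kernel q (x, y, z))"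
    have "(1 + ?s) ^ N \<le> (2 * max 1 ?s) ^ N" using S by (intro power_mono) auto
    also have "\<dots> = 2 ^ N * max 1 ?s ^ N" by (simp add: power_mult_distrib)
    also have "max 1 ?s ^ N \<le> 1 + ?s ^ N" using S by (cases "1 \<le> ?s") (auto simp: max_def)
    finally have "(1 + ?s) ^ N * ?o \<le> (2 ^ N * (1 + ?s ^ N)) * ?o" by (intro mult_right_mono) auto
    also have "\<dots> = 2 ^ N * (?o + ?s ^ N * ?o)" by (simp add: algebra_simps)
    also have "\<dots> \<le> 2 ^ N * (A + B)" using A(2)[OF S] B(2)[OF S] by (intro mult_left_mono add_mono) auto
    finally have "(1 + ?s) ^ N * ?o \<le> 2 ^ N * (A + B)" .
    moreover have "(1 + ?s) powr (- real N) = 1 / (1 + ?s) ^ N" and "(1 + ?s) ^ N > 0"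
      using S by (auto simp: powr_minus_divide powr_realpow)
    ultimately show ?thesis by (simp add: field_simps)
  qed
  moreover have "2 ^ N * (A + B) > 0" using A(1) B(1) by simp
  ultimately show ?thesis by blast
qed

text \<open>Pointwise claims about the distribution \<open>k\<close> are claims about a function
  \<open>K\<close> that represents it, off the diagonal in general, and on the whole space when the
  order is low enough or the symbol has compact frequency support.\<close>

theorem theorem6:
  fixes m \<rho> \<delta> :: real
    and p :: "'n::finite triple \<Rightarrow> complex"
    and k :: "('n triple \<Rightarrow> complex) \<Rightarrow> complex"
  assumes "0 < \<rho>" "\<rho> \<le> 1" "0 \<le> \<delta>" "\<delta> < 1"
    and "p \<in> BS m \<rho> \<delta>"
    and "dist_kernel p k"
  shows "\<exists>K :: 'n triple \<Rightarrow> complex.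
    Cinf_on off_diag K \<and> dist_eq_fun_on off_diag k K \<and>
    (\<forall>\<alpha> \<beta> \<gamma>. \<exists>N0::nat. \<forall>N\<ge>N0.
        bdd_above ((\<lambda>(x, y, z). S3 x y z ^ N * norm (pd3 \<alpha> \<beta> \<gamma> K (x, y, z))) ` off_diag)) \<and>
    ((\<exists>A. compact A \<and> (\<forall>x \<xi> \<eta>. (\<xi>, \<eta>) \<notin> A \<longrightarrow> p (x, \<xi>, \<eta>) = 0)) \<longrightarrow>
        Cinf_on UNIV K \<and> dist_eq_fun_on UNIV k K \<and>
        (\<forall>\<alpha> \<beta> \<gamma>. \<forall>N::nat. \<exists>C>0. \<forall>x y z. S3 x y z > 0 \<longrightarrow>
            norm (pd3 \<alpha> \<beta> \<gamma> K (x, y, z)) \<le> C * (1 + S3 x y z) powr (- real N))) \<and>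
    (\<forall>M::nat. m + real M + 2 * real CARD('n) < 0 \<longrightarrow>
        Ck_on M UNIV K \<and> dist_eq_fun_on UNIV k K \<and>
        (\<forall>\<alpha> \<beta> \<gamma>. mi_order (\<lambda>i. \<alpha> i + \<beta> i + \<gamma> i) \<le> M \<longrightarrow>
            continuous_on UNIV (pd3 \<alpha> \<beta> \<gamma> K) \<and> bounded (range (pd3 \<alpha> \<beta> \<gamma> K)))) \<and>
    (\<forall>M::nat. m + real M + 2 * real CARD('n) = 0 \<longrightarrow>
        (\<exists>C>0. \<forall>x y z. S3 x y z > 0 \<longrightarrow>
            (SUP (\<alpha>, \<beta>, \<gamma>)\<in>mi_triples M. norm (pd3 \<alpha> \<beta> \<gamma> K (x, y, z)))
              \<le> C * (1 + \<bar>ln (S3 x y z)\<bar>))) \<and>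
    (\<forall>M::nat. m + real M + 2 * real CARD('n) > 0 \<longrightarrow>
        (\<exists>C>0. \<forall>x y z. S3 x y z > 0 \<longrightarrow>
            (SUP (\<alpha>, \<beta>, \<gamma>)\<in>mi_triples M. norm (pd3 \<alpha> \<beta> \<gamma> K (x, y, z)))
              \<le> C * S3 x y z powr (- (m + real M + 2 * real CARD('n)) / \<rho>)))"
proof -
  note \<rho> = assms(1,2)
  have p: "symbol \<rho> m p" using BS_symbol[OF assms(5)] assms(4) by simp
  let ?K = "symbol_kernel p"
  let ?o = "\<lambda>\<alpha> \<beta> \<gamma> :: 'n \<Rightarrow> nat. mi_order (\<lambda>i. \<alpha> i + \<beta> i + \<gamma> i)"
  let ?q = "\<lambda>\<alpha> \<beta> \<gamma>. pd3_symbol \<alpha> \<beta> \<gamma> p"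
  have pd: "pd3 \<alpha> \<beta> \<gamma> ?K (x, y, z) = symbol_kernel (?q \<alpha> \<beta> \<gamma>) (x, y, z)" if "S3 x y z > 0" for \<alpha> \<beta> \<gamma> x y z
    by (rule pd3_kernel_off_axis[OF p \<rho>]) (use that in \<open>simp add: S3_pos_iff\<close>)
  have q: "symbol \<rho> (m + real (?o \<alpha> \<beta> \<gamma>)) (?q \<alpha> \<beta> \<gamma>)" for \<alpha> \<beta> \<gamma> by (rule pd3_symbol_symbol[OF p \<rho>(2)])
  \<comment> \<open>The order \<open>m'\<close> is a parameter because a symbol with compact
    frequency support may be assigned any order.\<close>
  have small: "Ck_on M UNIV ?K" "dist_eq_fun_on UNIV k ?K"
    if M: "m' + real M + 2 * real CARD('n) < 0" and p': "symbol \<rho> m' p" for M m'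
  proof -
    have cd: "convergence_domain \<rho> (m' + real i) (UNIV :: 'n triple set)" if "i \<le> M" for i
      by (rule convergence_domain_UNIV[OF \<rho>(2)]) (use M that in \<open>simp add: DIM_pair\<close>)
    show "Ck_on M UNIV ?K" by (rule Ck_on_kernel[OF \<rho>(2) cd p'])
    show "dist_eq_fun_on UNIV k ?K"
      by (rule kernel_distribution[OF _ p' \<rho>(2) assms(6)]) (use cd[of 0] in simp)
  qed
  show ?thesis
  proof (intro exI[of _ ?K] conjI allI impI)
    show "Cinf_on off_diag ?K" unfolding off_diag_eq Cinf_on_def
      by (intro allI Ck_on_kernel[OF \<rho>(2) convergence_domain_off_axis[OF \<rho>] p])
    show "dist_eq_fun_on off_diag k ?K" unfolding off_diag_eq
      by (rule kernel_distribution[OF convergence_domain_off_axis[OF \<rho>] p \<rho>(2) assms(6)])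
  next
    fix \<alpha> \<beta> \<gamma> :: "'n \<Rightarrow> nat"
    \<comment> \<open>From this exponent on, the integrations by parts make the symbol of the
      derivative integrable; the summand 1 yields the strict inequality.\<close>
    define N0 where "N0 = nat \<lceil>(m + real (?o \<alpha> \<beta> \<gamma>) + 2 * real CARD('n) + 1) / \<rho>\<rceil>"
    have "bdd_above ((\<lambda>(x, y, z). S3 x y z ^ N * norm (pd3 \<alpha> \<beta> \<gamma> ?K (x, y, z))) ` off_diag)" if N: "N \<ge> N0" for N
    proof -
      have "(m + real (?o \<alpha> \<beta> \<gamma>) + 2 * real CARD('n) + 1) / \<rho> \<le> real N" using N unfolding N0_def by linarith
      then have "m + real (?o \<alpha> \<beta> \<gamma>) - \<rho> * real N < - 2 * real CARD('n)" using \<rho>(1) by (simp add: field_simps)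
      from kernel_S3_decay[OF q \<rho> this]
      obtain C where "\<And>x y z. S3 x y z > 0 \<Longrightarrow> S3 x y z ^ N * norm (symbol_kernel (?q \<alpha> \<beta> \<gamma>) (x, y, z)) \<le> C" by blast
      then show ?thesis by (intro bdd_aboveI2[where M = C]) (auto simp: off_diag_def pd)
    qed
    then show "\<exists>N0. \<forall>N\<ge>N0. bdd_above ((\<lambda>(x, y, z). S3 x y z ^ N * norm (pd3 \<alpha> \<beta> \<gamma> ?K (x, y, z))) ` off_diag)" by blast
  next
    assume "\<exists>A. compact A \<and> (\<forall>x \<xi> \<eta>. (\<xi>, \<eta>) \<notin> A \<longrightarrow> p (x, \<xi>, \<eta>) = 0)"
    then have p': "symbol \<rho> m' p" for m'
      using BS_symbol[OF BS_compact_support[OF assms(5)]] assms(4) by (meson less_imp_le)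
    have "Ck_on M UNIV ?K" for M by (rule small(1)[OF _ p', of "- real M - 2 * real CARD('n) - 1"]) simp
    then show "Cinf_on UNIV ?K" by (simp add: Cinf_on_def)
    show "dist_eq_fun_on UNIV k ?K" by (rule small(2)[OF _ p', of "- 2 * real CARD('n) - 1" 0]) simp
    fix \<alpha> \<beta> \<gamma> :: "'n \<Rightarrow> nat" and N :: nat
    \<comment> \<open>The order of \<open>p\<close> is lowered in advance by the number of
      derivatives, so that the differentiated symbol still has an integrable order.\<close>
    have "symbol \<rho> (- 2 * real CARD('n) - 1) (?q \<alpha> \<beta> \<gamma>)"
      using pd3_symbol_symbol[OF p' \<rho>(2), of "- real (?o \<alpha> \<beta> \<gamma>) - 2 * real CARD('n) - 1" \<alpha> \<beta> \<gamma>] by simp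
    from kernel_S3_rapid_decay[OF this \<rho>, of N]
    show "\<exists>C>0. \<forall>x y z. S3 x y z > 0 \<longrightarrow> norm (pd3 \<alpha> \<beta> \<gamma> ?K (x, y, z)) \<le> C * (1 + S3 x y z) powr (- real N)"
      by (simp add: pd cong: imp_cong)
  next
    fix M :: nat assume M: "m + real M + 2 * real CARD('n) < 0"
    show "Ck_on M UNIV ?K" "dist_eq_fun_on UNIV k ?K" by (rule small[OF M p])+
    fix \<alpha> \<beta> \<gamma> :: "'n \<Rightarrow> nat" assume o: "?o \<alpha> \<beta> \<gamma> \<le> M"
    have lt: "m + real (?o \<alpha> \<beta> \<gamma>) < - real DIM((real ^ 'n) \<times> (real ^ 'n))" using o M unfolding DIM_pair by linarith
    have e: "pd3 \<alpha> \<beta> \<gamma> ?K = symbol_kernel (?q \<alpha> \<beta> \<gamma>)" by (rule pd3_kernel_UNIV[OF p \<rho>(2) lt])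
    show "continuous_on UNIV (pd3 \<alpha> \<beta> \<gamma> ?K)"
      unfolding e by (rule continuous_on_kernel[OF q \<rho>(2) convergence_domain_UNIV[OF \<rho>(2) lt]])
    show "bounded (range (pd3 \<alpha> \<beta> \<gamma> ?K))"
      unfolding e using kernel_bounded[OF q less_imp_le[OF \<rho>(1)] \<rho>(2) lt] by (auto simp: bounded_iff)
  next
    fix M :: nat assume M: "m + real M + 2 * real CARD('n) = 0"
    show "\<exists>C>0. \<forall>x y z. S3 x y z > 0 \<longrightarrow> (SUP (\<alpha>, \<beta>, \<gamma>)\<in>mi_triples M. norm (pd3 \<alpha> \<beta> \<gamma> ?K (x, y, z)))
        \<le> C * (1 + \<bar>ln (S3 x y z)\<bar>)"
    proof (rule SUP_mi_triples_bound)
      fix \<alpha> \<beta> \<gamma> :: "'n \<Rightarrow> nat" assume "?o \<alpha> \<beta> \<gamma> = M"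
      with M have "m + real (?o \<alpha> \<beta> \<gamma>) + 2 * real CARD('n) = 0" by simp
      from kernel_S3_zero_order[OF q \<rho> this]
      show "\<exists>C>0. \<forall>x y z. S3 x y z > 0 \<longrightarrow> norm (pd3 \<alpha> \<beta> \<gamma> ?K (x, y, z)) \<le> C * (1 + \<bar>ln (S3 x y z)\<bar>)"
        by (simp add: pd cong: imp_cong)
    qed simp
  next
    fix M :: nat assume M: "m + real M + 2 * real CARD('n) > 0"
    show "\<exists>C>0. \<forall>x y z. S3 x y z > 0 \<longrightarrow> (SUP (\<alpha>, \<beta>, \<gamma>)\<in>mi_triples M. norm (pd3 \<alpha> \<beta> \<gamma> ?K (x, y, z)))
        \<le> C * S3 x y z powr (- (m + real M + 2 * real CARD('n)) / \<rho>)"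
    proof (rule SUP_mi_triples_bound)
      fix \<alpha> \<beta> \<gamma> :: "'n \<Rightarrow> nat" assume o: "?o \<alpha> \<beta> \<gamma> = M"
      have "m + real (?o \<alpha> \<beta> \<gamma>) + 2 * real CARD('n) > 0" unfolding o by (rule M)
      from kernel_S3_positive_order[OF q \<rho> this]
      show "\<exists>C>0. \<forall>x y z. S3 x y z > 0 \<longrightarrow> norm (pd3 \<alpha> \<beta> \<gamma> ?K (x, y, z))
          \<le> C * S3 x y z powr (- (m + real M + 2 * real CARD('n)) / \<rho>)"
        unfolding o by (simp add: pd cong: imp_cong)
    qed simp
  qed
qed

end
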